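(* Assume detailed balance, that $a_{r,s},\dot a_{r,s},b_{r+1,s},\dot b_{r,s+1}\in\mathcal O((r+s)^\alpha)$ for some $0\le\alpha<1$, and that $$\lim_{N\to\infty}\inf_{r+s\ge N}Q_{r,s}^{\frac1{r+s}}>0\quad\text{and}\quad\lim_{N\to\infty}\sup_{r+s\ge N}Q_{r,s}^{\frac1{r+s}}<\infty .$$ Let $c^0\in X^+$ satisfy $\sum_{(r,s)\in\Omega} r\,c^0_{r,s}\ne0\ne\sum_{(r,s)\in\Omega}s\,c^0_{r,s}$ and $\sum_{(r,s)\in\Omega}(r+s)^{1+\alpha}c^0_{r,s}<\infty$. Then any solution $c:[0,T)\to X^+$ of the two-component Becker--Döring equations with initial data $c^0$ satisfies $$V(c(t))=V(c(0))-\int_0^tD(c(\tau))\,d\tau\quad\text{for all }0\le t<T.$$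
   Context: Let $\Omega=\{(r,s)\in\mathbb N_0^2 : r+s\ge1\}$. (Dots are part of the symbol names, not time derivatives.) Detailed balance means: $a_{r,s},\dot a_{r,s}>0$ and $Q_{r,s}>0$ for $(r,s)\in\Omega$ are given with $Q_{1,0}=Q_{0,1}=1$, and $b_{r+1,s}=a_{r,s}\frac{Q_{r,s}}{Q_{r+1,s}}$, $\dot b_{r,s+1}=\dot a_{r,s}\frac{Q_{r,s}}{Q_{r,s+1}}$. The notation $f_{r,s}\in\mathcal O((r+s)^\alpha)$ means $|f_{r,s}|\le C(r+s)^\alpha$ for some $C<\infty$ and all indices. Let $X$ be the Banach space of real sequences $c=(c_{r,s})_{(r,s)\in\Omega}$ with $\|c\|:=\sum_{(r,s)\in\Omega}(r+s)|c_{r,s}|<\infty$, and $X^+=\{c\in X: c_{r,s}\ge0\ \text{for all }(r,s)\in\Omega\}$. Fluxes: for $(r,s)\in\Omega$, $$J_{r,s}(c)=a_{r,s}c_{1,0}c_{r,s}-b_{r+1,s}c_{r+1,s},\qquad \dot J_{r,s}(c)=\dot a_{r,s}c_{0,1}c_{r,s}-\dot b_{r,s+1}c_{r,s+1}.$$ For a sequence $f$ on $\Omega$ (set to $0$ outside $\Omega$) put $\Delta_r f_{r,s}=f_{r,s}-f_{r-1,s}$ and $\Delta_s f_{r,s}=f_{r,s}-f_{r,s-1}$. Entropy and dissipation: $$V(c)=\sum_{(r,s)\in\Omega}c_{r,s}\Big[\ln\Big(\frac{c_{r,s}}{Q_{r,s}}\Big)-1\Big]\quad(0\ln 0=0),$$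 $$D(c)=-\sum_{(r,s)\in\Omega}\Big\{J_{r,s}(c)\Big(\ln\frac{c_{r+1,s}}{Q_{r+1,s}}-\ln\frac{c_{r,s}}{Q_{r,s}}-\ln c_{1,0}\Big)+\dot J_{r,s}(c)\Big(\ln\frac{c_{r,s+1}}{Q_{r,s+1}}-\ln\frac{c_{r,s}}{Q_{r,s}}-\ln c_{0,1}\Big)\Big\}.$$ $D(c)$ is defined for strictly positive $c$, is a sum of nonnegative terms, and takes values in $[0,\infty]$; with positive coefficients and both masses of $c^0$ nonzero, every solution satisfies $c_{r,s}(t)>0$ for all $t>0$ and $(r,s)\in\Omega$, so $D(c(\tau))$ is defined for $\tau>0$. Solution: for $0<T\le\infty$, a function $c:[0,T)\to X^+$ is a solution of the two-component Becker--Döring equations on $[0,T)$ with initial data $c^0\in X^+$ if (i) each $c_{r,s}:[0,T)\to\mathbb R_{\ge0}$ is continuous and $\sup_{t\in[0,T)}\|c(t)\|<\infty$; (ii) for all $t\in[0,T)$, $\int_0^t\sum_{(r,s)\in\Omega}\big((a_{r,s}+\dot a_{r,s})c_{r,s}+b_{r+1,s}c_{r+1,s}+\dot b_{r,s+1}c_{r,s+1}\big)(\tau)\,d\tau<\infty$; (iii) for all $t\in[0,T)$, $$c_{1,0}(t)=c^0_{1,0}-\int_0^t\Big(J_{1,0}+\dot J_{1,0}+\sum_{(r,s)\in\Omega}J_{r,s}\Big)(c(\tau))\,d\tau,$$ $$c_{0,1}(t)=c^0_{0,1}-\int_0^t\Big(J_{0,1}+\dot J_{0,1}+\sum_{(r,s)\in\Omega}\dot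 J_{r,s}\Big)(c(\tau))\,d\tau,$$ $$c_{r,s}(t)=c^0_{r,s}-\int_0^t\big(\Delta_rJ_{r,s}+\Delta_s\dot J_{r,s}\big)(c(\tau))\,d\tau\quad\text{for all } r+s\ge2.$$ *)

theory Defs
  imports "HOL-Analysis.Analysis"
begin

text \<open>Sequences indexed by \<open>Idx\<close> are represented by functions \<open>nat \<Rightarrow> nat \<Rightarrow> real\<close>
  whose value at \<open>(0,0)\<close> is never used. Dotted symbols carry the suffix \<open>d\<close>.\<close>

definition Idx :: "(nat \<times> nat) set" where
  "Idx = {(r, s). r + s \<ge> 1}"

definition detailed_balance ::
  "(nat \<Rightarrow> nat \<Rightarrow> real) \<Rightarrow> (nat \<Rightarrow> nat \<Rightarrow> real) \<Rightarrow> (nat \<Rightarrow> nat \<Rightarrow> real) \<Rightarrow> (nat \<Rightarrow> nat \<Rightarrow> real)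
    \<Rightarrow> (nat \<Rightarrow> nat \<Rightarrow> real) \<Rightarrow> bool" where
  "detailed_balance a ad b bd Q \<longleftrightarrow>
     (\<forall>(r, s)\<in>Idx. a r s > 0 \<and> ad r s > 0 \<and> Q r s > 0) \<and>
     Q 1 0 = 1 \<and> Q 0 1 = 1 \<and>
     (\<forall>(r, s)\<in>Idx. b (r + 1) s = a r s * (Q r s / Q (r + 1) s) \<and>
                   bd r (s + 1) = ad r s * (Q r s / Q r (s + 1)))"

definition bigO_pow :: "real \<Rightarrow> (nat \<Rightarrow> nat \<Rightarrow> real) \<Rightarrow> bool" where
  "bigO_pow \<alpha> f \<longleftrightarrow> (\<exists>C. \<forall>(r, s)\<in>Idx. \<bar>f r s\<bar> \<le> C * real (r + s) powr \<alpha>)"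

definition normX :: "(nat \<Rightarrow> nat \<Rightarrow> real) \<Rightarrow> real" where
  "normX c = (\<Sum>\<^sub>\<infinity>(r, s)\<in>Idx. real (r + s) * \<bar>c r s\<bar>)"

definition X :: "(nat \<Rightarrow> nat \<Rightarrow> real) set" where
  "X = {c. (\<lambda>(r, s). real (r + s) * \<bar>c r s\<bar>) summable_on Idx}"

definition Xplus :: "(nat \<Rightarrow> nat \<Rightarrow> real) set" where
  "Xplus = {c \<in> X. \<forall>(r, s)\<in>Idx. c r s \<ge> 0}"

definition J :: "(nat \<Rightarrow> nat \<Rightarrow> real) \<Rightarrow> (nat \<Rightarrow> nat \<Rightarrow> real) \<Rightarrow> (nat \<Rightarrow> nat \<Rightarrow> real)
    \<Rightarrow> nat \<Rightarrow> nat \<Rightarrow> real" where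
  "J a b c r s = a r s * c 1 0 * c r s - b (r + 1) s * c (r + 1) s"

definition Jd :: "(nat \<Rightarrow> nat \<Rightarrow> real) \<Rightarrow> (nat \<Rightarrow> nat \<Rightarrow> real) \<Rightarrow> (nat \<Rightarrow> nat \<Rightarrow> real)
    \<Rightarrow> nat \<Rightarrow> nat \<Rightarrow> real" where
  "Jd ad bd c r s = ad r s * c 0 1 * c r s - bd r (s + 1) * c r (s + 1)"

text \<open>The conditionals implement the convention that sequences vanish outside \<open>Idx\<close>;
  the tests \<open>r \<ge> 1\<close> and \<open>s \<ge> 1\<close> guard against truncated subtraction.\<close>

definition diff_r :: "(nat \<Rightarrow> nat \<Rightarrow> real) \<Rightarrow> nat \<Rightarrow> nat \<Rightarrow> real" where
  "diff_r f r s = f r s - (if r \<ge> 1 \<and> (r - 1, s) \<in> Idx then f (r - 1) s else 0)"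

definition diff_s :: "(nat \<Rightarrow> nat \<Rightarrow> real) \<Rightarrow> nat \<Rightarrow> nat \<Rightarrow> real" where
  "diff_s f r s = f r s - (if s \<ge> 1 \<and> (r, s - 1) \<in> Idx then f r (s - 1) else 0)"

text \<open>The convention \<open>0 ln 0 = 0\<close> holds for the library's \<^const>\<open>ln\<close>. Absolute
  convergence is \<open>summable_entropy\<close> below.\<close>

definition entropy :: "(nat \<Rightarrow> nat \<Rightarrow> real) \<Rightarrow> (nat \<Rightarrow> nat \<Rightarrow> real) \<Rightarrow> real" where
  "entropy Q c = (\<Sum>\<^sub>\<infinity>(r, s)\<in>Idx. c r s * (ln (c r s / Q r s) - 1))"

text \<open>The summand of the dissipation is nonnegative for strictly positive sequences
  (\<open>dissipation_term_nonneg\<close> below), so passing to \<^typ>\<open>ennreal\<close> loses nothing.\<close>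

definition dissipation_term ::
  "(nat \<Rightarrow> nat \<Rightarrow> real) \<Rightarrow> (nat \<Rightarrow> nat \<Rightarrow> real) \<Rightarrow> (nat \<Rightarrow> nat \<Rightarrow> real) \<Rightarrow> (nat \<Rightarrow> nat \<Rightarrow> real)
    \<Rightarrow> (nat \<Rightarrow> nat \<Rightarrow> real) \<Rightarrow> (nat \<Rightarrow> nat \<Rightarrow> real) \<Rightarrow> nat \<Rightarrow> nat \<Rightarrow> real" where
  "dissipation_term a ad b bd Q c r s =
     - (J a b c r s * (ln (c (r + 1) s / Q (r + 1) s) - ln (c r s / Q r s) - ln (c 1 0))
        + Jd ad bd c r s * (ln (c r (s + 1) / Q r (s + 1)) - ln (c r s / Q r s) - ln (c 0 1)))"

definition dissipation ::
  "(nat \<Rightarrow> nat \<Rightarrow> real) \<Rightarrow> (nat \<Rightarrow> nat \<Rightarrow> real) \<Rightarrow> (nat \<Rightarrow> nat \<Rightarrow> real) \<Rightarrow> (nat \<Rightarrow> nat \<Rightarrow> real)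
    \<Rightarrow> (nat \<Rightarrow> nat \<Rightarrow> real) \<Rightarrow> (nat \<Rightarrow> nat \<Rightarrow> real) \<Rightarrow> ennreal" where
  "dissipation a ad b bd Q c = (\<Sum>\<^sub>\<infinity>(r, s)\<in>Idx. ennreal (dissipation_term a ad b bd Q c r s))"

definition time_dom :: "ereal \<Rightarrow> real set" where
  "time_dom T = {t. 0 \<le> t \<and> ereal t < T}"

text \<open>Condition (ii), together with boundedness, makes the flux series converge for
  almost every time and makes all the integrals in (iii) absolutely convergent.\<close>

definition is_solution ::
  "(nat \<Rightarrow> nat \<Rightarrow> real) \<Rightarrow> (nat \<Rightarrow> nat \<Rightarrow> real) \<Rightarrow> (nat \<Rightarrow> nat \<Rightarrow> real) \<Rightarrow> (nat \<Rightarrow> nat \<Rightarrow> real)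
    \<Rightarrow> ereal \<Rightarrow> (nat \<Rightarrow> nat \<Rightarrow> real) \<Rightarrow> (real \<Rightarrow> nat \<Rightarrow> nat \<Rightarrow> real) \<Rightarrow> bool" where
  "is_solution a ad b bd T c0 c \<longleftrightarrow>
     (\<forall>t\<in>time_dom T. c t \<in> Xplus) \<and>
     \<comment> \<open>(i)\<close>
     (\<forall>(r, s)\<in>Idx. continuous_on (time_dom T) (\<lambda>t. c t r s)) \<and>
     bdd_above ((\<lambda>t. normX (c t)) ` time_dom T) \<and>
     \<comment> \<open>(ii)\<close>
     (\<forall>t\<in>time_dom T.
        (\<integral>\<^sup>+\<tau>\<in>{0..t}. (\<Sum>\<^sub>\<infinity>(r, s)\<in>Idx. ennreal ((a r s + ad r s) * c \<tau> r s
             + b (r + 1) s * c \<tau> (r + 1) s + bd r (s + 1) * c \<tau> r (s + 1))) \<partial>lborel) < \<infinity>) \<and>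
     \<comment> \<open>(iii)\<close>
     (\<forall>t\<in>time_dom T.
        c t 1 0 = c0 1 0 - (LINT \<tau>:{0..t}|lborel. J a b (c \<tau>) 1 0 + Jd ad bd (c \<tau>) 1 0
                              + (\<Sum>\<^sub>\<infinity>(r, s)\<in>Idx. J a b (c \<tau>) r s)) \<and>
        c t 0 1 = c0 0 1 - (LINT \<tau>:{0..t}|lborel. J a b (c \<tau>) 0 1 + Jd ad bd (c \<tau>) 0 1
                              + (\<Sum>\<^sub>\<infinity>(r, s)\<in>Idx. Jd ad bd (c \<tau>) r s)) \<and>
        (\<forall>r s. r + s \<ge> 2 \<longrightarrow>
           c t r s = c0 r s - (LINT \<tau>:{0..t}|lborel.
                                 diff_r (J a b (c \<tau>)) r s + diff_s (Jd ad bd (c \<tau>)) r s)))"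

text \<open>The two hypotheses on \<open>Q\<close>: the limits are taken in the extended reals, where
  these monotone sequences always converge.\<close>

definition Q_root_liminf :: "(nat \<Rightarrow> nat \<Rightarrow> real) \<Rightarrow> ereal" where
  "Q_root_liminf Q = lim (\<lambda>N::nat. INF (r, s)\<in>{(r, s)\<in>Idx. r + s \<ge> N}.
                              ereal (Q r s powr (1 / real (r + s))))"

definition Q_root_limsup :: "(nat \<Rightarrow> nat \<Rightarrow> real) \<Rightarrow> ereal" where
  "Q_root_limsup Q = lim (\<lambda>N::nat. SUP (r, s)\<in>{(r, s)\<in>Idx. r + s \<ge> N}.
                              ereal (Q r s powr (1 / real (r + s))))"

lemma dissipation_term_nonneg:
  assumes db: "detailed_balance a ad b bd Q" and rs: "(r, s) \<in> Idx"
    and pos: "\<forall>(r, s)\<in>Idx. c r s > 0"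
  shows "dissipation_term a ad b bd Q c r s \<ge> 0"
proof -
  have I: "(r + 1, s) \<in> Idx" "(r, s + 1) \<in> Idx" "(1, 0) \<in> Idx" "(0, 1) \<in> Idx"
    using rs by (auto simp: Idx_def)
  have Qp: "Q r s > 0" "Q (r + 1) s > 0" "Q r (s + 1) > 0" and ap: "a r s > 0" "ad r s > 0"
    and beq: "b (r + 1) s = a r s * (Q r s / Q (r + 1) s)"
             "bd r (s + 1) = ad r s * (Q r s / Q r (s + 1))"
    using db rs I(1,2) unfolding detailed_balance_def by blast+
  have cp: "c r s > 0" "c (r + 1) s > 0" "c r (s + 1) > 0" "c 1 0 > 0" "c 0 1 > 0"
    using pos rs I by blast+
  have key: "(k * m * x - (k * (q / q')) * y) * (ln (y / q') - ln (x / q) - ln m) \<le> 0"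
    if "k > 0" "m > 0" "x > 0" "y > 0" "q > 0" "q' > 0" for k m x y q q' :: real
  proof -
    have e: "k * m * x - (k * (q / q')) * y = k * q * (m * (x / q) - y / q')"
      using that by (simp add: field_simps)
    have l: "ln (x / q) + ln m = ln (m * (x / q))"
      using that by (simp add: ln_mult ln_div)
    have p: "m * (x / q) > 0" "y / q' > 0" "k * q > 0" using that by auto
    have "(u - v) * (ln v - ln u) \<le> 0" if "u > 0" "v > 0" for u v :: real
      using that by (cases "u \<le> v") (auto simp: mult_le_0_iff)
    from this[OF p(1,2)] have "(m * (x / q) - y / q') * (ln (y / q') - ln (x / q) - ln m) \<le> 0"
      using l by (simp add: algebra_simps)
    with p(3) show ?thesis
      unfolding e mult.assoc[of "k * q"] by (simp add: mult_le_0_iff)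
  qed
  show ?thesis
    using key[OF ap(1) cp(4) cp(1) cp(2) Qp(1,2)] key[OF ap(2) cp(5) cp(1) cp(3) Qp(1,3)]
    unfolding dissipation_term_def J_def Jd_def beq by linarith
qed

lemma summable_entropy:
  assumes Qpos: "\<forall>(r, s)\<in>Idx. Q r s > 0"
    and Qinf: "Q_root_liminf Q > 0" and Qsup: "Q_root_limsup Q < \<infinity>"
    and c: "c \<in> Xplus"
  shows "(\<lambda>(r, s). c r s * (ln (c r s / Q r s) - 1)) summable_on Idx"
proof -
  define A where "A = (\<lambda>N::nat. {(r, s)\<in>Idx. r + s \<ge> N})"
  define q where "q = (\<lambda>(r, s). ereal (Q r s powr (1 / real (r + s))))"
  have A_mono: "A n \<subseteq> A m" if "m \<le> n" for m n
    using that by (auto simp: A_def)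
  have "incseq (\<lambda>N. INF p\<in>A N. q p)"
    by (intro incseq_def[THEN iffD2] allI impI INF_superset_mono A_mono) auto
  then have "(\<lambda>N. INF p\<in>A N. q p) \<longlonglongrightarrow> (SUP N. INF p\<in>A N. q p)"
    by (rule LIMSEQ_SUP)
  then have "(SUP N. INF p\<in>A N. q p) > 0"
    using Qinf limI unfolding Q_root_liminf_def A_def q_def by (metis (no_types, lifting))
  then obtain N1 where N1: "(INF p\<in>A N1. q p) > 0"
    unfolding less_SUP_iff by blast
  obtain e where e: "0 < ereal e" "ereal e < (INF p\<in>A N1. q p)"
    using ereal_dense2[OF N1] by blast
  have "decseq (\<lambda>N. SUP p\<in>A N. q p)"
    by (intro decseq_def[THEN iffD2] allI impI SUP_subset_mono A_mono) auto
  then have "(\<lambda>N. SUP p\<in>A N. q p) \<longlonglongrightarrow> (INF N. SUP p\<in>A N. q p)"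
    by (rule LIMSEQ_INF)
  then have "(INF N. SUP p\<in>A N. q p) < \<infinity>"
    using Qsup limI unfolding Q_root_limsup_def A_def q_def by (metis (no_types, lifting))
  then obtain N2 where N2: "(SUP p\<in>A N2. q p) < \<infinity>"
    unfolding INF_less_iff by blast
  obtain E where E: "(SUP p\<in>A N2. q p) < ereal E"
    using ereal_dense2[OF N2] by blast
  define N where "N = max N1 N2"
  define F where "F = {(r, s)\<in>Idx. r + s < N}"
  define K where "K = \<bar>ln e\<bar> + \<bar>ln E\<bar> + (\<Sum>(r, s)\<in>F. \<bar>ln (Q r s)\<bar>)"
  have finF: "finite F"
    by (rule finite_subset[of _ "{..N} \<times> {..N}"]) (auto simp: F_def)
  have sumF: "(\<Sum>(r, s)\<in>F. \<bar>ln (Q r s)\<bar>) \<ge> 0"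
    by (intro sum_nonneg) auto
  have K: "\<bar>ln (Q r s)\<bar> \<le> K * real (r + s)" if rs: "(r, s) \<in> Idx" for r s
  proof (cases "r + s < N")
    case True
    then have "(r, s) \<in> F" using rs by (simp add: F_def)
    then have "\<bar>ln (Q r s)\<bar> \<le> (\<Sum>(r, s)\<in>F. \<bar>ln (Q r s)\<bar>)"
      using member_le_sum[OF _ _ finF, of "(r, s)" "\<lambda>(r, s). \<bar>ln (Q r s)\<bar>"] by auto
    also have "\<dots> \<le> K * 1" by (simp add: K_def)
    also have "\<dots> \<le> K * real (r + s)"
      using rs sumF by (intro mult_left_mono) (auto simp: Idx_def K_def)
    finally show ?thesis .
  next
    case False
    have n: "real (r + s) \<ge> 1" using rs by (auto simp: Idx_def)
    have Q: "Q r s > 0" using Qpos rs by auto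
    have m: "(r, s) \<in> A N1" "(r, s) \<in> A N2" using False rs by (auto simp: A_def N_def)
    define y where "y = Q r s powr (1 / real (r + s))"
    have "e < y" "y < E"
      using less_le_trans[OF e(2) INF_lower[OF m(1)]] le_less_trans[OF SUP_upper[OF m(2)] E]
      by (auto simp: q_def y_def)
    with e(1) have "ln e \<le> ln y" "ln y \<le> ln E" by auto
    then have "\<bar>ln y\<bar> \<le> K" using sumF by (auto simp: K_def)
    moreover have "ln (Q r s) = ln y * real (r + s)" using n Q by (simp add: y_def ln_powr)
    ultimately show ?thesis using n by (simp add: abs_mult mult_right_mono)
  qed
  have cX: "(\<lambda>(r, s). real (r + s) * \<bar>c r s\<bar>) summable_on Idx"
    and cpos: "\<And>r s. (r, s) \<in> Idx \<Longrightarrow> c r s \<ge> 0"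
    using c by (auto simp: Xplus_def X_def)
  have cle: "c r s \<le> normX c" if rs: "(r, s) \<in> Idx" for r s
  proof -
    have "1 * c r s \<le> real (r + s) * c r s"
      using rs cpos by (intro mult_right_mono) (auto simp: Idx_def)
    also have "\<dots> = (\<Sum>(r, s)\<in>{(r, s)}. real (r + s) * \<bar>c r s\<bar>)"
      using cpos[OF rs] by simp
    also have "\<dots> \<le> normX c"
      unfolding normX_def using rs by (intro finite_sum_le_infsum[OF cX]) auto
    finally show ?thesis by simp
  qed
  have x_ln_x_le: "x * \<bar>ln x\<bar> \<le> (n + B) * x + 2 * exp (- (n / 2))"
    if "0 \<le> x" "x \<le> B" "0 \<le> n" for x B n :: real
  proof -
    consider "x = 0" | "0 < x" "x \<ge> exp (- n)" | "0 < x" "x < exp (- n)"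
      using \<open>0 \<le> x\<close> by (metis linorder_not_le order_le_less)
    then show ?thesis
    proof cases
      case 1 then show ?thesis by simp
    next
      case 2
      then have "- n \<le> ln x" by (simp add: ln_ge_iff)
      moreover have "ln x \<le> B" using ln_bound[of x] 2 that by linarith
      ultimately have "\<bar>ln x\<bar> \<le> n + B" using that by linarith
      then have "x * \<bar>ln x\<bar> \<le> x * (n + B)" using that by (intro mult_left_mono) auto
      then show ?thesis by (simp add: mult.commute add_increasing2)
    next
      case 3
      define y where "y = sqrt x"
      have y: "y > 0" "x = y * y" using 3 by (auto simp: y_def)
      have lnx: "ln x = 2 * ln y" using y by (simp add: ln_mult)
      have "x < 1" using 3 that by (smt (verit) exp_le_one_iff)
      then have "ln x < 0" using 3 by simp
      moreover have "- ln y \<le> 1 / y"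
        using ln_bound[of "1 / y"] y by (simp add: ln_div)
      ultimately have "\<bar>ln x\<bar> \<le> 2 * (1 / y)" using lnx by linarith
      then have "x * \<bar>ln x\<bar> \<le> x * (2 * (1 / y))" using that by (intro mult_left_mono)
      also have "\<dots> = 2 * y" using y by simp
      also have "y \<le> exp (- (n / 2))"
      proof -
        have "x \<le> (exp (- (n / 2)))\<^sup>2" using 3 by (simp flip: exp_double)
        then show ?thesis unfolding y_def by (simp add: real_le_lsqrt)
      qed
      finally show ?thesis using that by (simp add: add_increasing)
    qed
  qed
  have geo: "(\<lambda>(r, s). exp (- (real (r + s) / 2))) summable_on Idx"
  proof -
    define h :: real where "h = exp (- 1 / 2)"
    have h: "h > 0" "h < 1" by (auto simp: h_def)
    have 1: "(\<lambda>n. h ^ n) summable_on UNIV"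
      using h by (intro norm_summable_imp_summable_on) (auto intro!: summable_geometric)
    have "(\<lambda>(r, s). h ^ r * h ^ s) summable_on UNIV \<times> UNIV"
    proof (rule summable_on_SigmaI)
      fix r :: nat
      show "((\<lambda>s. case (r, s) of (r, s) \<Rightarrow> h ^ r * h ^ s) has_sum h ^ r * (\<Sum>\<^sub>\<infinity>s. h ^ s)) UNIV"
        using has_sum_cmult_right[OF has_sum_infsum[OF 1]] by simp
    qed (use h summable_on_cmult_left[OF 1] in auto)
    then have "(\<lambda>(r, s). h ^ r * h ^ s) summable_on Idx"
      by (rule summable_on_subset_banach) auto
    moreover have "h ^ r * h ^ s = exp (- (real (r + s) / 2))" for r s
      using exp_of_nat_mult[of "r + s" "- 1 / 2 :: real"] by (simp add: h_def power_add)
    ultimately show ?thesis by simp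
  qed
  define g where "g = (\<lambda>(r, s). (K + normX c + 2) * (real (r + s) * \<bar>c r s\<bar>)
                          + 2 * exp (- (real (r + s) / 2)))"
  have "g = (\<lambda>p. (K + normX c + 2) * (\<lambda>(r, s). real (r + s) * \<bar>c r s\<bar>) p
                          + 2 * (\<lambda>(r, s). exp (- (real (r + s) / 2))) p)"
    by (auto simp: g_def)
  then have g: "g summable_on Idx"
    using summable_on_add[OF summable_on_cmult_right[OF cX] summable_on_cmult_right[OF geo]]
    by simp
  have bound: "norm (c r s * (ln (c r s / Q r s) - 1)) \<le> g (r, s)" if rs: "(r, s) \<in> Idx" for r s
  proof -
    define x n where "x = c r s" and "n = real (r + s)"
    have n: "n \<ge> 1" using rs by (auto simp: Idx_def n_def)
    have x: "0 \<le> x" "x \<le> normX c" using cpos cle rs by (auto simp: x_def)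
    have Q: "Q r s > 0" using Qpos rs by auto
    have "\<bar>x * (ln (x / Q r s) - 1)\<bar> \<le> x * \<bar>ln x\<bar> + x * \<bar>ln (Q r s)\<bar> + x"
    proof (cases "x = 0")
      case False
      then have "\<bar>ln (x / Q r s) - 1\<bar> \<le> \<bar>ln x\<bar> + \<bar>ln (Q r s)\<bar> + 1"
        using x Q by (simp add: ln_div)
      then have "x * \<bar>ln (x / Q r s) - 1\<bar> \<le> x * (\<bar>ln x\<bar> + \<bar>ln (Q r s)\<bar> + 1)"
        using x by (intro mult_left_mono)
      then show ?thesis using x unfolding abs_mult by (simp add: distrib_left)
    qed simp
    also have "\<dots> \<le> ((n + normX c) * x + 2 * exp (- (n / 2))) + x * (K * n) + x"
      using x_ln_x_le[OF x, of n] K[OF rs] n x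
      by (intro add_mono mult_left_mono) (auto simp: n_def)
    also have "\<dots> \<le> (K + normX c + 2) * (n * x) + 2 * exp (- (n / 2))"
    proof -
      have "x * 1 \<le> x * n" "(normX c * x) * 1 \<le> (normX c * x) * n"
        using mult_left_mono[OF n x(1)] mult_left_mono[OF n, of "normX c * x"] x by auto
      then show ?thesis by (simp add: algebra_simps)
    qed
    finally show ?thesis using x by (simp add: g_def x_def n_def)
  qed
  have "(\<lambda>p. norm ((\<lambda>(r, s). c r s * (ln (c r s / Q r s) - 1)) p)) summable_on Idx"
    by (rule Infinite_Sum.abs_summable_on_comparison_test'[OF g]) (use bound in auto)
  then show ?thesis
    by (rule summable_on_iff_abs_summable_on_real[THEN iffD2])
qed

end

theory Submission
  imports Defs
begin

text \<open>Since \<open>\<alpha> < 1\<close>, bounded mass makes the tails of the flux series uniformly small in time,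
  so all components are continuously differentiable for positive times. Let \<open>V_N\<close> and
  \<open>D_N\<close> be the entropy and dissipation restricted to sizes \<open>r + s \<le> N\<close>. Summation by parts
  gives \<open>V_N' = - D_{N-1} + boundary\<close> and also \<open>V_N' = - D_N + boundary'\<close>, where the two boundary
  terms carry the logarithm at size \<open>N\<close> and \<open>N + 1\<close>, respectively. As \<open>x ln x\<close> is harmless for small
  \<open>x\<close>, the first is small from above and the second from below, up to \<open>N powr (1 + \<alpha>)\<close> times
  the number density at sizes \<open>N\<close> and \<open>N + 1\<close>. Propagation of the moment of order \<open>1 + \<alpha>\<close> makes the
  time integral of this error vanish as \<open>N\<close> grows, which gives the identity on \<open>[u, t]\<close> for \<open>u > 0\<close>.
  Mass conservation makes \<open>V_N\<close> converge uniformly, so \<open>V\<close> is continuous down to time \<open>0\<close>.\<close>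

section \<open>Finite index sets and summation by parts\<close>

text \<open>The exponent 1 + \<alpha> is dictated by the cutoff: a flux through size N is O(N powr
  \<alpha>) times the density there, and the logarithm in front of it is at most O(N) from above,
  because the root conditions on \<open>Q\<close> amount to |ln Q| <= K (r + s). The product is one
  shell of the moment series. From below the logarithm has no such bound, since components may decay
  arbitrarily fast in the size; so the boundary terms are estimated from one side only. A second
  error comes from the monomers: their equations contain the full flux series, while the truncated
  sum supplies only its part up to the cutoff. The missing tail is O(N powr (\<alpha> - 1)), but it
  is multiplied by the logarithm of a monomer density, which may diverge at time 0. Hence the start
  at u > 0, where strict positivity and compactness bound these logarithms.\<close>

definition Idx_le :: "nat \<Rightarrow> (nat \<times> nat) set" where
  "Idx_le N = {(r, s). 1 \<le> r + s \<and> r + s \<le> N}"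

definition Idx_eq :: "nat \<Rightarrow> (nat \<times> nat) set" where
  "Idx_eq N = {(r, s). r + s = N}"

lemma finite_Idx_le [simp]: "finite (Idx_le N)"
  by (rule finite_subset[of _ "{..N} \<times> {..N}"]) (auto simp: Idx_le_def)

lemma Idx_eq_image: "Idx_eq N = (\<lambda>r. (r, N - r)) ` {..N}"
  by (auto simp: Idx_eq_def image_iff)

lemma finite_Idx_eq [simp]: "finite (Idx_eq N)"
  by (simp add: Idx_eq_image)

lemma card_Idx_eq: "card (Idx_eq N) = N + 1"
  by (simp add: Idx_eq_image card_image inj_on_def)

lemma Idx_le_subset: "Idx_le N \<subseteq> Idx"
  by (auto simp: Idx_le_def Idx_def)

lemma Idx_le_mono: "m \<le> n \<Longrightarrow> Idx_le m \<subseteq> Idx_le n"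
  by (auto simp: Idx_le_def)

lemma Idx_le_0 [simp]: "Idx_le 0 = {}"
  by (auto simp: Idx_le_def)

lemma sum_Idx_le_Suc:
  fixes f :: "nat \<times> nat \<Rightarrow> 'a::comm_monoid_add"
  shows "sum f (Idx_le (Suc N)) = sum f (Idx_le N) + sum f (Idx_eq (Suc N))"
proof -
  have "Idx_le (Suc N) = Idx_le N \<union> Idx_eq (Suc N)" "Idx_le N \<inter> Idx_eq (Suc N) = {}"
    by (auto simp: Idx_le_def Idx_eq_def)
  then show ?thesis
    by (simp add: sum.union_disjoint)
qed

text \<open>Every finite set of indices lies in some triangle \<open>Idx_le N\<close>, so triangular
  partial sums compute any unconditional sum over \<open>Idx\<close>, be it real or
  \<open>ennreal\<close>.\<close>

lemma filterlim_Idx_le: "filterlim Idx_le (finite_subsets_at_top Idx) sequentially"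
  unfolding filterlim_finite_subsets_at_top
proof (intro allI impI)
  fix Y :: "(nat \<times> nat) set"
  assume Y: "finite Y \<and> Y \<subseteq> Idx"
  define N where "N = (\<Sum>(r, s)\<in>Y. r + s)"
  have "r + s \<le> N" if "(r, s) \<in> Y" for r s
    using Y member_le_sum[OF that, of "\<lambda>(r, s). r + s"] by (auto simp: N_def)
  then have "Y \<subseteq> Idx_le n" if "N \<le> n" for n
    using Y that by (force simp: Idx_le_def Idx_def)
  then show "\<forall>\<^sub>F n in sequentially. finite (Idx_le n) \<and> Y \<subseteq> Idx_le n \<and> Idx_le n \<subseteq> Idx"
    using Idx_le_subset by (auto simp: eventually_sequentially)
qed

lemma has_sum_imp_Idx_le:
  "(f has_sum S) Idx \<Longrightarrow> (\<lambda>N. sum f (Idx_le N)) \<longlonglongrightarrow> S"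
  unfolding has_sum_def by (rule filterlim_compose[OF _ filterlim_Idx_le])

text \<open>Only an inequality: the shift misses the index (0, Suc N), whose term is nonnegative by
  assumption.\<close>

lemma sum_Idx_eq_shift_r:
  fixes f :: "nat \<Rightarrow> nat \<Rightarrow> real"
  assumes "\<And>r s. r + s = Suc N \<Longrightarrow> 0 \<le> f r s"
  shows "(\<Sum>(r, s)\<in>Idx_eq N. f (r + 1) s) \<le> (\<Sum>(r, s)\<in>Idx_eq (Suc N). f r s)"
proof -
  have "(\<Sum>(r, s)\<in>Idx_eq N. f (r + 1) s) = (\<Sum>(r, s)\<in>(\<lambda>(r, s). (r + 1, s)) ` Idx_eq N. f r s)"
    by (subst sum.reindex) (auto simp: inj_on_def split_def)
  also have "\<dots> \<le> (\<Sum>(r, s)\<in>Idx_eq (Suc N). f r s)"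
    using assms by (intro sum_mono2 finite_Idx_eq) (auto simp: Idx_eq_def)
  finally show ?thesis .
qed

lemma sum_Idx_eq_shift_s:
  fixes f :: "nat \<Rightarrow> nat \<Rightarrow> real"
  assumes "\<And>r s. r + s = Suc N \<Longrightarrow> 0 \<le> f r s"
  shows "(\<Sum>(r, s)\<in>Idx_eq N. f r (s + 1)) \<le> (\<Sum>(r, s)\<in>Idx_eq (Suc N). f r s)"
proof -
  have "(\<Sum>(r, s)\<in>Idx_eq N. f r (s + 1)) = (\<Sum>(r, s)\<in>(\<lambda>(r, s). (r, s + 1)) ` Idx_eq N. f r s)"
    by (subst sum.reindex) (auto simp: inj_on_def split_def)
  also have "\<dots> \<le> (\<Sum>(r, s)\<in>Idx_eq (Suc N). f r s)"
    using assms by (intro sum_mono2 finite_Idx_eq) (auto simp: Idx_eq_def)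
  finally show ?thesis .
qed

text \<open>The guard is the one in \<open>diff_r\<close>. Indices outside the image of the shift
  have r = 0 or predecessor (0, 0), and there the guard is false.\<close>

lemma sum_pred_r:
  fixes g F :: "nat \<Rightarrow> nat \<Rightarrow> real"
  shows "(\<Sum>(r, s)\<in>Idx_le (Suc N). g r s * (if r \<ge> 1 \<and> (r - 1, s) \<in> Idx then F (r - 1) s else 0))
    = (\<Sum>(r, s)\<in>Idx_le N. g (r + 1) s * F r s)"
proof -
  have "(\<Sum>(r, s)\<in>Idx_le N. g (r + 1) s * F r s)
      = (\<Sum>(r, s)\<in>(\<lambda>(r, s). (r + 1, s)) ` Idx_le N. g r s * F (r - 1) s)"
    by (subst sum.reindex) (auto simp: inj_on_def split_def)
  also have "\<dots> = (\<Sum>(r, s)\<in>(\<lambda>(r, s). (r + 1, s)) ` Idx_le N.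
      g r s * (if r \<ge> 1 \<and> (r - 1, s) \<in> Idx then F (r - 1) s else 0))"
    by (rule sum.cong) (auto simp: Idx_def Idx_le_def)
  also have "\<dots> = (\<Sum>(r, s)\<in>Idx_le (Suc N).
      g r s * (if r \<ge> 1 \<and> (r - 1, s) \<in> Idx then F (r - 1) s else 0))"
  proof (rule sum.mono_neutral_left)
    show "\<forall>i\<in>Idx_le (Suc N) - (\<lambda>(r, s). (r + 1, s)) ` Idx_le N.
       (case i of (r, s) \<Rightarrow> g r s * (if 1 \<le> r \<and> (r - 1, s) \<in> Idx then F (r - 1) s else 0)) = 0"
    proof (clarify, goal_cases)
      case (1 r s)
      have "\<not> (1 \<le> r \<and> (r - 1, s) \<in> Idx)"
      proof
        assume *: "1 \<le> r \<and> (r - 1, s) \<in> Idx"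
        then obtain k where k: "r = Suc k" by (cases r) auto
        then have "(k, s) \<in> Idx_le N" using 1 * by (auto simp: Idx_le_def Idx_def)
        then show False using 1 k image_eqI[of "(r, s)" "\<lambda>(r, s). (r + 1, s)" "(k, s)" "Idx_le N"]
          by auto
      qed
      then show ?case by auto
    qed
  qed (simp, auto simp: Idx_le_def)
  finally show ?thesis by simp
qed

text \<open>Mirror image of \<open>sum_pred_r\<close> under the exchange of the two
  coordinates.\<close>

lemma sum_pred_s:
  fixes g F :: "nat \<Rightarrow> nat \<Rightarrow> real"
  shows "(\<Sum>(r, s)\<in>Idx_le (Suc N). g r s * (if s \<ge> 1 \<and> (r, s - 1) \<in> Idx then F r (s - 1) else 0))
    = (\<Sum>(r, s)\<in>Idx_le N. g r (s + 1) * F r s)"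
proof -
  have sw: "(\<Sum>(r, s)\<in>Idx_le n. h r s) = (\<Sum>(r, s)\<in>Idx_le n. h s r)" for n and h :: "nat \<Rightarrow> nat \<Rightarrow> real"
    by (rule sum.reindex_bij_witness[of _ prod.swap prod.swap]) (auto simp: Idx_le_def)
  have I: "(r, s) \<in> Idx \<longleftrightarrow> (s, r) \<in> Idx" for r s
    by (auto simp: Idx_def)
  show ?thesis
    using sum_pred_r[of "\<lambda>r s. g s r" "\<lambda>r s. F s r" N]
    by (subst sw, subst (2) sw, subst I) simp
qed

text \<open>Fluxes leaving the largest shell have no partner inside the triangle and survive as the
  boundary sum; every other flux leaves one index and enters a neighbour, which produces a
  difference of \<open>g\<close>.\<close>

lemma summation_by_parts:
  fixes g F G :: "nat \<Rightarrow> nat \<Rightarrow> real"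
  shows "(\<Sum>(r, s)\<in>Idx_le (Suc N). g r s * (diff_r F r s + diff_s G r s)) =
    (\<Sum>(r, s)\<in>Idx_eq (Suc N). g r s * (F r s + G r s))
    - (\<Sum>(r, s)\<in>Idx_le N. (g (r + 1) s - g r s) * F r s + (g r (s + 1) - g r s) * G r s)"
proof -
  have "(\<Sum>(r, s)\<in>Idx_le (Suc N). g r s * (diff_r F r s + diff_s G r s)) =
     (\<Sum>(r, s)\<in>Idx_le (Suc N). g r s * (F r s + G r s))
     - (\<Sum>(r, s)\<in>Idx_le (Suc N). g r s * (if r \<ge> 1 \<and> (r - 1, s) \<in> Idx then F (r - 1) s else 0))
     - (\<Sum>(r, s)\<in>Idx_le (Suc N). g r s * (if s \<ge> 1 \<and> (r, s - 1) \<in> Idx then G r (s - 1) else 0))"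
    unfolding diff_r_def diff_s_def
    by (simp add: split_def algebra_simps sum.distrib sum_subtractf)
  also have "\<dots> = (\<Sum>(r, s)\<in>Idx_eq (Suc N). g r s * (F r s + G r s))
      + (\<Sum>(r, s)\<in>Idx_le N. g r s * (F r s + G r s))
      - (\<Sum>(r, s)\<in>Idx_le N. g (r + 1) s * F r s) - (\<Sum>(r, s)\<in>Idx_le N. g r (s + 1) * G r s)"
    unfolding sum_pred_r sum_pred_s by (simp add: sum_Idx_le_Suc)
  finally show ?thesis
    by (simp add: split_def algebra_simps sum.distrib sum_subtractf)
qed

section \<open>Elementary bounds for powers and for x ln x\<close>

text \<open>Trades the growth of the coefficients for the mass weight \<open>n\<close>, leaving a
  power of the cutoff that decays when \<alpha> < 1.\<close>

lemma powr_le_mult_of_le: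
  assumes "\<alpha> \<le> 1" "1 \<le> N" "N \<le> n"
  shows "real n powr \<alpha> \<le> real N powr (\<alpha> - 1) * real n"
proof -
  have "real n powr \<alpha> = real n powr (\<alpha> - 1) * real n powr 1"
    using assms unfolding powr_add[symmetric] by simp
  also have "\<dots> \<le> real N powr (\<alpha> - 1) * real n powr 1"
    using assms by (intro mult_right_mono powr_mono2') auto
  finally show ?thesis using assms by simp
qed

lemma ln_le_self: "0 \<le> x \<Longrightarrow> ln x \<le> (x::real)"
  by (cases "x = 0") (auto intro: ln_bound)

text \<open>If x >= exp (- n), then |ln x| is at most n + B; otherwise |ln x| <= 2 / sqrt x leaves 2
  * sqrt x <= 2 * exp (- (n / 2)). The parameter \<open>n\<close> is free and will be the cluster
  size, so that the first term is controlled by the mass and the second is summable.\<close>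

lemma abs_x_ln_x_le:
  fixes x B n :: real
  assumes "0 \<le> x" "x \<le> B" "0 \<le> n"
  shows "x * \<bar>ln x\<bar> \<le> (n + B) * x + 2 * exp (- (n / 2))"
proof (cases "x \<ge> exp (- n)")
  case True
  then have "- n \<le> ln x" using ln_ge_iff[of x] by (smt (verit) exp_gt_zero)
  then have "\<bar>ln x\<bar> \<le> n + B" using ln_le_self[of x] assms by linarith
  then have "x * \<bar>ln x\<bar> \<le> x * (n + B)" using assms by (intro mult_left_mono)
  then show ?thesis by (simp add: mult.commute add_increasing2)
next
  case False
  show ?thesis
  proof (cases "x = 0")
    case f: False
    define y where "y = sqrt x"
    have y: "y > 0" "x = y * y" using f assms by (auto simp: y_def)
    have "x < 1" using False assms by (smt (verit) exp_le_one_iff)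
    then have "y < 1" by (simp add: y_def)
    moreover have "- ln y \<le> 1 / y" using ln_le_self[of "1 / y"] y by (simp add: ln_div)
    ultimately have "\<bar>ln x\<bar> \<le> 2 * (1 / y)" using y f assms
      by (simp add: ln_mult abs_if)
    then have "x * \<bar>ln x\<bar> \<le> x * (2 * (1 / y))" using assms by (intro mult_left_mono)
    also have "\<dots> = 2 * y" using y by simp
    also have "y \<le> exp (- (n / 2))"
    proof -
      have "x \<le> (exp (- (n / 2)))\<^sup>2" using False by (simp flip: exp_double)
      then show ?thesis unfolding y_def by (simp add: real_le_lsqrt)
    qed
    finally show ?thesis using assms by (simp add: add_increasing)
  qed simp
qed

section \<open>Trajectories and their continuous differentiability\<close>

text \<open>Unifies the three equations of (iii): at the monomers the predecessor terms of
  \<open>diff_r\<close> and \<open>diff_s\<close> vanish, and the added series accounts for the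
  monomer consumed in every growth step.\<close>

definition net_loss ::
  "(nat \<Rightarrow> nat \<Rightarrow> real) \<Rightarrow> (nat \<Rightarrow> nat \<Rightarrow> real) \<Rightarrow> (nat \<Rightarrow> nat \<Rightarrow> real) \<Rightarrow> (nat \<Rightarrow> nat \<Rightarrow> real)
    \<Rightarrow> (nat \<Rightarrow> nat \<Rightarrow> real) \<Rightarrow> nat \<Rightarrow> nat \<Rightarrow> real" where
  "net_loss a ad b bd c r s = diff_r (J a b c) r s + diff_s (Jd ad bd c) r s
     + (if (r, s) = (1, 0) then \<Sum>\<^sub>\<infinity>(r, s)\<in>Idx. J a b c r s else 0)
     + (if (r, s) = (0, 1) then \<Sum>\<^sub>\<infinity>(r, s)\<in>Idx. Jd ad bd c r s else 0)"

lemma uniform_limit_real_bound: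
  fixes f :: "nat \<Rightarrow> 'a \<Rightarrow> real"
  assumes "\<And>n x. x \<in> S \<Longrightarrow> \<bar>f n x - l x\<bar> \<le> e n" and "e \<longlonglongrightarrow> 0"
  shows "uniform_limit S f l sequentially"
proof (rule uniform_limitI)
  fix d :: real assume "d > 0"
  then have "\<forall>\<^sub>F n in sequentially. e n < d"
    using assms(2) by (rule order_tendstoD(2)[rotated])
  then show "\<forall>\<^sub>F n in sequentially. \<forall>x\<in>S. dist (f n x) (l x) < d"
    using assms(1) by (auto simp: dist_real_def elim!: eventually_mono intro: le_less_trans)
qed

lemma continuous_on_if_const:
  fixes f :: "'a::topological_space \<Rightarrow> real"
  shows "(P \<Longrightarrow> continuous_on S f) \<Longrightarrow> continuous_on S (\<lambda>x. if P then f x else 0)"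
  by (cases P) auto

text \<open>A bound on all finite sums outside \<open>Idx_le N\<close> controls summability and the
  tail at once; N = 0 gives the former, because \<open>Idx_le 0\<close> is empty.\<close>

lemma infsum_Idx_tail:
  fixes f :: "nat \<times> nat \<Rightarrow> real"
  assumes B: "\<And>N F. finite F \<Longrightarrow> F \<subseteq> Idx - Idx_le N \<Longrightarrow> (\<Sum>p\<in>F. \<bar>f p\<bar>) \<le> B N"
  shows "f summable_on Idx" and "\<bar>infsum f Idx - sum f (Idx_le N)\<bar> \<le> B N"
proof -
  have "(\<lambda>p. \<bar>f p\<bar>) summable_on Idx"
    by (rule nonneg_bdd_above_summable_on) (use B[of _ 0] in \<open>auto intro!: bdd_aboveI2[of _ _ "B 0"]\<close>)
  then show s: "f summable_on Idx"
    using summable_on_iff_abs_summable_on_real by force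
  have lim: "(\<lambda>R. \<bar>sum f (Idx_le R) - sum f (Idx_le N)\<bar>) \<longlonglongrightarrow> \<bar>infsum f Idx - sum f (Idx_le N)\<bar>"
    by (intro tendsto_intros has_sum_imp_Idx_le has_sum_infsum s)
  show "\<bar>infsum f Idx - sum f (Idx_le N)\<bar> \<le> B N"
  proof (rule tendsto_upperbound[OF lim])
    show "\<forall>\<^sub>F R in sequentially. \<bar>sum f (Idx_le R) - sum f (Idx_le N)\<bar> \<le> B N"
    proof (rule eventually_sequentiallyI[of N])
      fix R assume "N \<le> R"
      then have "sum f (Idx_le R) - sum f (Idx_le N) = sum f (Idx_le R - Idx_le N)"
        by (intro sum_diff[symmetric] finite_Idx_le Idx_le_mono)
      then have "\<bar>sum f (Idx_le R) - sum f (Idx_le N)\<bar> \<le> (\<Sum>p\<in>Idx_le R - Idx_le N. \<bar>f p\<bar>)"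
        by simp
      also have "\<dots> \<le> B N"
        using Idx_le_subset by (intro B) auto
      finally show "\<bar>sum f (Idx_le R) - sum f (Idx_le N)\<bar> \<le> B N" .
    qed
  qed simp
qed

text \<open>Constants are merged: \<open>C\<close> bounds all four coefficient families,
  \<open>M\<close> the mass at all times, \<open>K\<close> the logarithm of \<open>Q\<close> per
  unit of size. The lower bounds 1 settle signs and let \<open>M\<close> be inserted as a factor.
  The mass is bounded through finite sums, the form in which it is used.\<close>

locale bd_trajectory =
  fixes a ad b bd Q :: "nat \<Rightarrow> nat \<Rightarrow> real" and c :: "real \<Rightarrow> nat \<Rightarrow> nat \<Rightarrow> real"
    and \<alpha> C M K :: real and T :: ereal
  assumes alpha: "0 \<le> \<alpha>" "\<alpha> < 1"
    and const_ge: "1 \<le> C" "1 \<le> M" "0 \<le> K"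
    and balance: "detailed_balance a ad b bd Q"
    and coeff_le:
      "(r, s) \<in> Idx \<Longrightarrow> a r s \<le> C * real (r + s) powr \<alpha>"
      "(r, s) \<in> Idx \<Longrightarrow> ad r s \<le> C * real (r + s) powr \<alpha>"
      "(r, s) \<in> Idx \<Longrightarrow> b (r + 1) s \<le> C * real (r + s) powr \<alpha>"
      "(r, s) \<in> Idx \<Longrightarrow> bd r (s + 1) \<le> C * real (r + s) powr \<alpha>"
    and lnQ_le: "(r, s) \<in> Idx \<Longrightarrow> \<bar>ln (Q r s)\<bar> \<le> K * real (r + s)"
    and c_nonneg: "t \<in> time_dom T \<Longrightarrow> (r, s) \<in> Idx \<Longrightarrow> 0 \<le> c t r s"
    and mass_le: "t \<in> time_dom T \<Longrightarrow> finite F \<Longrightarrow> F \<subseteq> Idx \<Longrightarrow> (\<Sum>(r, s)\<in>F. real (r + s) * c t r s) \<le> M"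
    and c_cont: "(r, s) \<in> Idx \<Longrightarrow> continuous_on (time_dom T) (\<lambda>t. c t r s)"
    and c_eq: "t \<in> time_dom T \<Longrightarrow> (r, s) \<in> Idx \<Longrightarrow>
      c t r s = c 0 r s - (LINT \<tau>:{0..t}|lborel. net_loss a ad b bd (c \<tau>) r s)"
begin

abbreviation "Jt t r s \<equiv> J a b (c t) r s"
abbreviation "Jdt t r s \<equiv> Jd ad bd (c t) r s"
abbreviation "loss t r s \<equiv> net_loss a ad b bd (c t) r s"

definition "flux t = (\<Sum>\<^sub>\<infinity>(r, s)\<in>Idx. Jt t r s)"
definition "fluxd t = (\<Sum>\<^sub>\<infinity>(r, s)\<in>Idx. Jdt t r s)"

lemma pos:
  assumes "(r, s) \<in> Idx"
  shows "0 < a r s" "0 < ad r s" "0 < b (r + 1) s" "0 < bd r (s + 1)" "0 < Q r s"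
proof -
  have Q: "0 < Q r s" if "(r, s) \<in> Idx" for r s
    using that balance unfolding detailed_balance_def by blast
  have "(r + 1, s) \<in> Idx" "(r, s + 1) \<in> Idx"
    using assms by (auto simp: Idx_def)
  note Qs = Q[OF assms] Q[OF this(1)] Q[OF this(2)]
  have A: "0 < a r s" "0 < ad r s"
    and B: "b (r + 1) s = a r s * (Q r s / Q (r + 1) s)" "bd r (s + 1) = ad r s * (Q r s / Q r (s + 1))"
    using balance assms unfolding detailed_balance_def by blast+
  show "0 < a r s" "0 < ad r s" "0 < b (r + 1) s" "0 < bd r (s + 1)" "0 < Q r s"
    unfolding B using A Qs by simp_all
qed

lemma Idx_simps [simp]: "(1, 0) \<in> Idx" "(Suc 0, 0) \<in> Idx" "(0, 1) \<in> Idx" "(0, Suc 0) \<in> Idx"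
  "(r + 1, s) \<in> Idx" "(r, s + 1) \<in> Idx" "(Suc r, s) \<in> Idx" "(r, Suc s) \<in> Idx" "(0, 0) \<notin> Idx"
  by (auto simp: Idx_def)

lemma Idx_le_imp_Idx: "(r, s) \<in> Idx_le N \<Longrightarrow> (r, s) \<in> Idx"
  using Idx_le_subset by blast

lemma size_c_le:
  assumes "t \<in> time_dom T" "(r, s) \<in> Idx"
  shows "real (r + s) * c t r s \<le> M"
  using mass_le[OF assms(1), of "{(r, s)}"] assms(2) by simp

lemma c_le:
  assumes "t \<in> time_dom T" "(r, s) \<in> Idx"
  shows "c t r s \<le> M"
proof -
  have "1 * c t r s \<le> real (r + s) * c t r s"
    using assms c_nonneg by (intro mult_right_mono) (auto simp: Idx_def)
  with size_c_le[OF assms] show ?thesis by simp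
qed

text \<open>The factor \<open>M\<close> bounds the monomer density \<open>m\<close> in the growth
  part and is inserted into the dissociation part because it is at least 1.\<close>

lemma flux_bound_aux:
  assumes "0 \<le> m" "m \<le> M" "0 \<le> x" "0 \<le> y" "0 < A" "0 < B"
    and A: "A \<le> C * real (r + s) powr \<alpha>" and B: "B \<le> C * real (r + s) powr \<alpha>"
  shows "\<bar>A * m * x - B * y\<bar> \<le> C * M * real (r + s) powr \<alpha> * (x + y)"
proof -
  have "A * m * x \<le> (C * real (r + s) powr \<alpha>) * M * x"
    using assms const_ge by (intro mult_right_mono mult_mono) auto
  moreover have "B * y \<le> (C * real (r + s) powr \<alpha>) * y"
    using assms by (intro mult_right_mono)
  moreover have "(C * real (r + s) powr \<alpha>) * y * 1 \<le> (C * real (r + s) powr \<alpha>) * y * M"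
    using assms const_ge by (intro mult_left_mono) auto
  moreover have "0 \<le> A * m * x" "0 \<le> B * y"
    using assms by auto
  ultimately show ?thesis
    unfolding abs_le_iff by (auto simp: algebra_simps)
qed

lemma J_bound:
  assumes t: "t \<in> time_dom T" and rs: "(r, s) \<in> Idx"
  shows "\<bar>Jt t r s\<bar> \<le> C * M * real (r + s) powr \<alpha> * (c t r s + c t (r + 1) s)"
  unfolding J_def using assms by (intro flux_bound_aux c_nonneg c_le pos coeff_le) auto

lemma Jd_bound:
  assumes t: "t \<in> time_dom T" and rs: "(r, s) \<in> Idx"
  shows "\<bar>Jdt t r s\<bar> \<le> C * M * real (r + s) powr \<alpha> * (c t r s + c t r (s + 1))"
  unfolding Jd_def using assms by (intro flux_bound_aux c_nonneg c_le pos coeff_le) auto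

text \<open>Outside \<open>Idx_le N\<close> a flux is at most C * M * (N + 1) powr (\<alpha> - 1)
  times the mass at its two ends; summing over all of them spends the mass bound \<open>M\<close>
  twice.\<close>

definition "tail_bound N = 2 * C * M\<^sup>2 * real (Suc N) powr (\<alpha> - 1)"

lemma tail_bound_nonneg: "0 \<le> tail_bound N"
  using const_ge by (simp add: tail_bound_def)

lemma tail_bound_lim: "tail_bound \<longlonglongrightarrow> 0"
proof -
  have "(\<lambda>N. real (Suc N) powr (\<alpha> - 1)) \<longlonglongrightarrow> 0"
    using alpha filterlim_compose[OF filterlim_real_sequentially filterlim_Suc]
    by (intro tendsto_neg_powr) auto
  then show ?thesis
    unfolding tail_bound_def by (auto intro: tendsto_mult_right_zero)
qed

text \<open>\<open>\<sigma>\<close> is the growth step by one monomer, which treats both flux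
  families together. Its injectivity makes the neighbours' masses a sum over the image of
  \<open>F\<close>, so the mass bound applies to them as well.\<close>

lemma flux_tail_aux:
  assumes t: "t \<in> time_dom T" and F: "finite F" "F \<subseteq> Idx - Idx_le N"
    and inj: "inj \<sigma>" and sz: "\<And>r s r' s'. \<sigma> (r, s) = (r', s') \<Longrightarrow> r' + s' = Suc (r + s)"
    and f: "\<And>r s. (r, s) \<in> Idx \<Longrightarrow> \<bar>f (r, s)\<bar>
       \<le> C * M * real (r + s) powr \<alpha> * (c t r s + (case \<sigma> (r, s) of (r', s') \<Rightarrow> c t r' s'))"
  shows "(\<Sum>p\<in>F. \<bar>f p\<bar>) \<le> tail_bound N"
proof -
  define m where "m = (\<lambda>(r, s). real (r + s) * c t r s)"
  define k where "k = C * M * real (Suc N) powr (\<alpha> - 1)"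
  have k: "0 \<le> k" using const_ge by (simp add: k_def)
  have \<sigma>: "\<sigma> p \<in> Idx" for p
    using sz[of "fst p" "snd p"] by (cases "\<sigma> p") (auto simp: Idx_def)
  have "\<bar>f p\<bar> \<le> k * m p + k * m (\<sigma> p)" if p: "p \<in> F" for p
  proof -
    obtain r s r' s' where rs: "p = (r, s)" "\<sigma> (r, s) = (r', s')"
      by (metis surj_pair)
    have I: "(r, s) \<in> Idx" "(r', s') \<in> Idx" "Suc N \<le> r + s"
      using p F \<sigma>[of p] rs by (auto simp: Idx_le_def Idx_def)
    note nn = c_nonneg[OF t I(1)] c_nonneg[OF t I(2)]
    have "\<bar>f p\<bar> \<le> C * M * real (r + s) powr \<alpha> * (c t r s + c t r' s')"
      using f[OF I(1)] rs by simp
    also have "\<dots> \<le> C * M * (real (Suc N) powr (\<alpha> - 1) * real (r + s)) * (c t r s + c t r' s')"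
      using alpha I nn const_ge by (intro mult_right_mono mult_left_mono powr_le_mult_of_le) auto
    also have "\<dots> = k * (real (r + s) * c t r s) + k * (real (r + s) * c t r' s')"
      by (simp add: k_def algebra_simps)
    also have "\<dots> \<le> k * (real (r + s) * c t r s) + k * (real (r' + s') * c t r' s')"
      using k nn sz[OF rs(2)] by (intro add_left_mono mult_left_mono mult_right_mono) auto
    finally show ?thesis using rs by (simp add: m_def)
  qed
  then have "(\<Sum>p\<in>F. \<bar>f p\<bar>) \<le> (\<Sum>p\<in>F. k * m p + k * m (\<sigma> p))"
    by (rule sum_mono)
  also have "\<dots> = k * sum m F + k * sum m (\<sigma> ` F)"
    using inj by (simp add: sum.distrib sum_distrib_left sum.reindex inj_on_subset)
  also have "\<dots> \<le> k * M + k * M"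
    unfolding m_def using F \<sigma> k t by (intro add_mono mult_left_mono mass_le) auto
  finally show ?thesis
    by (simp add: tail_bound_def k_def power2_eq_square algebra_simps)
qed

lemma J_tail_sum:
  assumes "t \<in> time_dom T" "finite F" "F \<subseteq> Idx - Idx_le N"
  shows "(\<Sum>p\<in>F. \<bar>(\<lambda>(r, s). Jt t r s) p\<bar>) \<le> tail_bound N"
  by (rule flux_tail_aux[OF assms, of "\<lambda>(r, s). (r + 1, s)"])
     (use J_bound[OF assms(1)] in \<open>auto simp: inj_def\<close>)

lemma Jd_tail_sum:
  assumes "t \<in> time_dom T" "finite F" "F \<subseteq> Idx - Idx_le N"
  shows "(\<Sum>p\<in>F. \<bar>(\<lambda>(r, s). Jdt t r s) p\<bar>) \<le> tail_bound N"
  by (rule flux_tail_aux[OF assms, of "\<lambda>(r, s). (r, s + 1)"])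
     (use Jd_bound[OF assms(1)] in \<open>auto simp: inj_def\<close>)

lemma flux_tail:
  assumes "t \<in> time_dom T"
  shows "\<bar>flux t - (\<Sum>(r, s)\<in>Idx_le N. Jt t r s)\<bar> \<le> tail_bound N"
    and "\<bar>fluxd t - (\<Sum>(r, s)\<in>Idx_le N. Jdt t r s)\<bar> \<le> tail_bound N"
  unfolding flux_def fluxd_def
  using infsum_Idx_tail(2)[OF J_tail_sum, OF assms] infsum_Idx_tail(2)[OF Jd_tail_sum, OF assms]
  by auto

lemma J_cont: "(r, s) \<in> Idx \<Longrightarrow> continuous_on (time_dom T) (\<lambda>t. Jt t r s)"
  and Jd_cont: "(r, s) \<in> Idx \<Longrightarrow> continuous_on (time_dom T) (\<lambda>t. Jdt t r s)"
  unfolding J_def Jd_def by (intro continuous_intros c_cont; simp)+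

text \<open>The partial sums converge uniformly because \<open>tail_bound\<close> does not depend on
  time.\<close>

lemma flux_cont: "continuous_on (time_dom T) flux" "continuous_on (time_dom T) fluxd"
proof -
  have c: "\<forall>\<^sub>F N in sequentially. continuous_on (time_dom T) (\<lambda>t. \<Sum>(r, s)\<in>Idx_le N. Jt t r s)"
       "\<forall>\<^sub>F N in sequentially. continuous_on (time_dom T) (\<lambda>t. \<Sum>(r, s)\<in>Idx_le N. Jdt t r s)"
    unfolding split_def
    by (auto intro!: always_eventually continuous_on_sum J_cont Jd_cont dest: Idx_le_imp_Idx)
  have u: "uniform_limit (time_dom T) (\<lambda>N t. \<Sum>(r, s)\<in>Idx_le N. Jt t r s) flux sequentially"
    "uniform_limit (time_dom T) (\<lambda>N t. \<Sum>(r, s)\<in>Idx_le N. Jdt t r s) fluxd sequentially"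
    using flux_tail by (auto intro!: uniform_limit_real_bound[OF _ tail_bound_lim] simp: abs_minus_commute)
  show "continuous_on (time_dom T) flux" "continuous_on (time_dom T) fluxd"
    by (rule uniform_limit_theorem[OF c(1) u(1)] uniform_limit_theorem[OF c(2) u(2)], simp)+
qed

lemma loss_eq: "loss t r s = diff_r (J a b (c t)) r s + diff_s (Jd ad bd (c t)) r s
     + (if (r, s) = (1, 0) then flux t else 0) + (if (r, s) = (0, 1) then fluxd t else 0)"
  by (simp add: net_loss_def flux_def fluxd_def)

lemma loss_cont:
  assumes "(r, s) \<in> Idx"
  shows "continuous_on (time_dom T) (\<lambda>t. loss t r s)"
  unfolding loss_eq diff_r_def diff_s_def using assms
  by (intro continuous_intros continuous_on_if_const J_cont Jd_cont flux_cont) auto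

lemma time_dom_subset: "t \<in> time_dom T \<Longrightarrow> {0..t} \<subseteq> time_dom T"
  unfolding time_dom_def by (auto intro: le_less_trans[of _ "ereal t"])

lemma time_dom_greater:
  assumes "t \<in> time_dom T"
  obtains u where "t < u" "u \<in> time_dom T"
proof -
  have "ereal t < T" "0 \<le> t" using assms by (auto simp: time_dom_def)
  then obtain u where "ereal t < ereal u" "ereal u < T"
    using ereal_dense2 by blast
  with \<open>0 \<le> t\<close> that show thesis by (auto simp: time_dom_def)
qed

text \<open>The integrand \<open>loss\<close> is continuous, so the integral equation can be
  differentiated; a later time \<open>u\<close> in the domain makes the derivative
  two-sided.\<close>

lemma c_deriv:
  assumes t: "t \<in> time_dom T" "0 < t" and rs: "(r, s) \<in> Idx"
  shows "((\<lambda>t. c t r s) has_real_derivative - loss t r s) (at t)"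
proof -
  obtain u where u: "t < u" "u \<in> time_dom T" using time_dom_greater[OF t(1)] .
  define f where "f = (\<lambda>t. loss t r s)"
  have cont: "continuous_on {0..u} f"
    unfolding f_def using loss_cont[OF rs] time_dom_subset[OF u(2)] continuous_on_subset by blast
  have eq: "c x r s = c 0 r s - integral {0..x} f" if "x \<in> {0<..<u}" for x
  proof -
    have x: "x \<in> time_dom T" using that time_dom_subset[OF u(2)] by auto
    have "continuous_on {0..x} f" using cont that by (auto intro: continuous_on_subset)
    then have "set_integrable lborel {0..x} f" by (rule borel_integrable_atLeastAtMost')
    then show ?thesis using c_eq[OF x rs] set_borel_integral_eq_integral(2) by (simp add: f_def)
  qed
  have "((\<lambda>x. integral {0..x} f) has_real_derivative f t) (at t within {0..u})"
    using cont t u by (intro integral_has_real_derivative) auto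
  then have "((\<lambda>x. integral {0..x} f) has_real_derivative f t) (at t)"
    using t u at_within_interior[of t "{0..u}"] by simp
  then have "((\<lambda>x. c 0 r s - integral {0..x} f) has_real_derivative - f t) (at t)"
    by (auto intro!: derivative_eq_intros)
  then have "((\<lambda>x. c x r s) has_real_derivative - f t) (at t)"
    by (rule has_field_derivative_transform_within_open[of _ _ _ "{0<..<u}"]) (use t u eq in auto)
  then show ?thesis by (simp add: f_def)
qed

text \<open>The weak form of the system, with an arbitrary weight \<open>g\<close>. The last two
  terms come from the monomer equations and contain the full flux series; for the weight r + s they
  cancel the interior sum up to a tail.\<close>

lemma sum_loss:
  "(\<Sum>(r, s)\<in>Idx_le (Suc N). g r s * - loss t r s) =
    (\<Sum>(r, s)\<in>Idx_le N. (g (r + 1) s - g r s) * Jt t r s + (g r (s + 1) - g r s) * Jdt t r s)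
    - (\<Sum>(r, s)\<in>Idx_eq (Suc N). g r s * (Jt t r s + Jdt t r s))
    - g 1 0 * flux t - g 0 1 * fluxd t"
proof -
  have "(\<Sum>(r, s)\<in>Idx_le (Suc N). g r s * - loss t r s) =
    - (\<Sum>(r, s)\<in>Idx_le (Suc N). g r s * (diff_r (J a b (c t)) r s + diff_s (Jd ad bd (c t)) r s))
    - (\<Sum>(r, s)\<in>Idx_le (Suc N). if (r, s) = (1, 0) then g 1 0 * flux t else 0)
    - (\<Sum>(r, s)\<in>Idx_le (Suc N). if (r, s) = (0, 1) then g 0 1 * fluxd t else 0)"
    unfolding loss_eq sum_negf[symmetric] sum_subtractf[symmetric]
    by (intro sum.cong) (auto simp: algebra_simps)
  also have "(\<Sum>(r, s)\<in>Idx_le (Suc N). if (r, s) = (1, 0) then g 1 0 * flux t else 0)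
      = (\<Sum>p\<in>Idx_le (Suc N). if p = (1, 0) then g 1 0 * flux t else 0)"
    by (intro sum.cong refl) (simp split: prod.splits)
  also have "\<dots> = g 1 0 * flux t"
    by (subst sum.delta) (simp, auto simp: Idx_le_def)
  also have "(\<Sum>(r, s)\<in>Idx_le (Suc N). if (r, s) = (0, 1) then g 0 1 * fluxd t else 0)
      = (\<Sum>p\<in>Idx_le (Suc N). if p = (0, 1) then g 0 1 * fluxd t else 0)"
    by (intro sum.cong refl) (simp split: prod.splits)
  also have "\<dots> = g 0 1 * fluxd t"
    by (subst sum.delta) (simp, auto simp: Idx_le_def)
  finally show ?thesis
    unfolding summation_by_parts by simp
qed

end

section \<open>Strict positivity\<close>

text \<open>The differential inequality makes exp (L * \<tau>) * x \<tau> nondecreasing, so together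
  with nonnegativity a zero at the final time propagates backwards.\<close>

lemma zero_backward:
  fixes x :: "real \<Rightarrow> real"
  assumes "continuous_on {0..t} x" "\<And>\<tau>. \<lbrakk>0 < \<tau>; \<tau> < t\<rbrakk> \<Longrightarrow> (x has_real_derivative x' \<tau>) (at \<tau>)"
    and "\<And>\<tau>. \<lbrakk>0 < \<tau>; \<tau> < t\<rbrakk> \<Longrightarrow> - (L * x \<tau>) \<le> x' \<tau>"
    and "\<And>\<tau>. \<tau> \<in> {0..t} \<Longrightarrow> 0 \<le> x \<tau>" and "x t = 0" and \<tau>: "\<tau> \<in> {0..t}"
  shows "x \<tau> = 0"
proof -
  have "exp (L * \<tau>) * x \<tau> \<le> exp (L * t) * x t"
  proof (rule DERIV_nonneg_imp_increasing_open[where f = "\<lambda>\<tau>. exp (L * \<tau>) * x \<tau>"])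
    show "\<exists>y. ((\<lambda>\<tau>. exp (L * \<tau>) * x \<tau>) has_real_derivative y) (at u) \<and> 0 \<le> y"
      if "\<tau> < u" "u < t" for u
    proof (intro exI conjI)
      show "((\<lambda>\<tau>. exp (L * \<tau>) * x \<tau>) has_real_derivative exp (L * u) * (L * x u + x' u)) (at u)"
        using \<tau> that by (auto intro!: derivative_eq_intros assms(2) simp: algebra_simps)
      show "0 \<le> exp (L * u) * (L * x u + x' u)"
        using assms(3)[of u] \<tau> that by auto
    qed
  qed (use \<tau> assms(1) in \<open>auto intro!: continuous_intros intro: continuous_on_subset\<close>)
  then have "x \<tau> \<le> 0" using assms(5) by (simp add: mult_le_0_iff)
  then show ?thesis using assms(4) \<tau> by force
qed

context bd_trajectory
begin

lemma coeff_mult_c_le: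
  assumes "t \<in> time_dom T" "(r, s) \<in> Idx" "A \<le> C * real (r + s) powr \<alpha>"
  shows "A * c t r s \<le> C * (real (r + s) * c t r s)"
proof -
  have "real (r + s) powr \<alpha> \<le> real (r + s) powr 1"
    using alpha assms(2) by (intro powr_mono) (auto simp: Idx_def)
  then have "C * real (r + s) powr \<alpha> \<le> C * real (r + s)"
    using const_ge(1) by (intro mult_left_mono) auto
  then have "A \<le> C * real (r + s)"
    using assms(3) by linarith
  from mult_right_mono[OF this c_nonneg[OF assms(1,2)]] show ?thesis
    by (simp add: mult.assoc)
qed

text \<open>The term at \<open>p\<close> is split off without being estimated, so that a negative
  part of \<open>f p\<close> survives in the bound.\<close>

lemma flux_le_aux:
  assumes t: "t \<in> time_dom T" and s: "f summable_on Idx" and p: "p \<in> Idx" and m: "0 \<le> m"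
    and f: "\<And>r s. (r, s) \<in> Idx \<Longrightarrow> f (r, s) \<le> m * (C * (real (r + s) * c t r s))"
  shows "infsum f Idx \<le> f p + m * C * M"
proof -
  obtain N where N: "p \<in> Idx_le N"
    using p by (cases p) (auto simp: Idx_le_def Idx_def)
  show ?thesis
  proof (rule tendsto_upperbound[OF has_sum_imp_Idx_le[OF has_sum_infsum[OF s]]])
    show "\<forall>\<^sub>F R in sequentially. sum f (Idx_le R) \<le> f p + m * C * M"
    proof (rule eventually_sequentiallyI[of N])
      fix R assume "N \<le> R"
      with N Idx_le_mono have "p \<in> Idx_le R" by blast
      then have "sum f (Idx_le R) = f p + sum f (Idx_le R - {p})"
        by (simp add: sum.remove)
      also have "sum f (Idx_le R - {p}) \<le> (\<Sum>(r, s)\<in>Idx_le R - {p}. m * (C * (real (r + s) * c t r s)))"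
        using f Idx_le_imp_Idx by (intro sum_mono) auto
      also have "\<dots> = m * C * (\<Sum>(r, s)\<in>Idx_le R - {p}. real (r + s) * c t r s)"
        by (simp add: sum_distrib_left split_def mult.assoc)
      also have "\<dots> \<le> m * C * M"
        using m const_ge t Idx_le_subset by (intro mult_left_mono mass_le) auto
      finally show "sum f (Idx_le R) \<le> f p + m * C * M" by simp
    qed
  qed simp
qed

lemma gain_nonneg:
  assumes t: "t \<in> time_dom T" and rs: "(r, s) \<in> Idx"
  shows "0 \<le> b (r + 1) s * c t (r + 1) s" "0 \<le> bd r (s + 1) * c t r (s + 1)"
  using pos[OF rs] c_nonneg[OF t] by (simp_all add: less_imp_le)

lemma J_le:
  assumes t: "t \<in> time_dom T" and rs: "(r, s) \<in> Idx"
  shows "Jt t r s \<le> c t 1 0 * (C * (real (r + s) * c t r s)) - b (r + 1) s * c t (r + 1) s"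
    and "Jdt t r s \<le> c t 0 1 * (C * (real (r + s) * c t r s)) - bd r (s + 1) * c t r (s + 1)"
proof -
  have "c t 1 0 * (a r s * c t r s) \<le> c t 1 0 * (C * (real (r + s) * c t r s))"
       "c t 0 1 * (ad r s * c t r s) \<le> c t 0 1 * (C * (real (r + s) * c t r s))"
    using t rs by (intro mult_left_mono coeff_mult_c_le c_nonneg coeff_le; simp)+
  then show "Jt t r s \<le> c t 1 0 * (C * (real (r + s) * c t r s)) - b (r + 1) s * c t (r + 1) s"
    and "Jdt t r s \<le> c t 0 1 * (C * (real (r + s) * c t r s)) - bd r (s + 1) * c t r (s + 1)"
    by (simp_all add: J_def Jd_def algebra_simps)
qed

lemma J_le':
  assumes t: "t \<in> time_dom T" and rs: "(r, s) \<in> Idx"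
  shows "Jt t r s \<le> C * M * c t 1 0 - b (r + 1) s * c t (r + 1) s"
    and "Jdt t r s \<le> C * M * c t 0 1 - bd r (s + 1) * c t r (s + 1)"
proof -
  have "c t 1 0 * (C * (real (r + s) * c t r s)) \<le> c t 1 0 * (C * M)"
       "c t 0 1 * (C * (real (r + s) * c t r s)) \<le> c t 0 1 * (C * M)"
    using t rs const_ge by (intro mult_left_mono size_c_le c_nonneg; simp)+
  then show "Jt t r s \<le> C * M * c t 1 0 - b (r + 1) s * c t (r + 1) s"
    and "Jdt t r s \<le> C * M * c t 0 1 - bd r (s + 1) * c t r (s + 1)"
    using J_le[OF t rs] by (simp_all add: mult.commute)
qed

text \<open>The 4 counts the two fluxes at the monomer itself, the flux at (r, s) and the rest of
  the series. The dissociation term at an arbitrary (r, s) is kept on purpose: if the monomer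
  density and its loss both vanish, this term must vanish too.\<close>

lemma loss_monomer_le:
  assumes t: "t \<in> time_dom T" and rs: "(r, s) \<in> Idx"
  shows "loss t 1 0 \<le> 4 * C * M * c t 1 0 - b (r + 1) s * c t (r + 1) s"
    and "loss t 0 1 \<le> 4 * C * M * c t 0 1 - bd r (s + 1) * c t r (s + 1)"
proof -
  note S = infsum_Idx_tail(1)[OF J_tail_sum, OF t] infsum_Idx_tail(1)[OF Jd_tail_sum, OF t]
  have f: "Jt t r s \<le> c t 1 0 * (C * (real (r + s) * c t r s))"
    "Jdt t r s \<le> c t 0 1 * (C * (real (r + s) * c t r s))" if "(r, s) \<in> Idx" for r s
    using J_le[OF t that] gain_nonneg[OF t that] by linarith+
  have "flux t \<le> Jt t r s + c t 1 0 * C * M"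
    unfolding flux_def
    using flux_le_aux[OF t S(1) rs, where m = "c t 1 0"] f(1) c_nonneg[OF t, of 1 0] by simp
  moreover have "fluxd t \<le> Jdt t r s + c t 0 1 * C * M"
    unfolding fluxd_def
    using flux_le_aux[OF t S(2) rs, where m = "c t 0 1"] f(2) c_nonneg[OF t, of 0 1] by simp
  moreover have "Jt t 1 0 \<le> C * M * c t 1 0" "Jdt t 0 1 \<le> C * M * c t 0 1"
    using J_le'(1)[OF t, of 1 0] gain_nonneg(1)[OF t, of 1 0]
      J_le'(2)[OF t, of 0 1] gain_nonneg(2)[OF t, of 0 1] by auto
  moreover have "Jdt t 1 0 \<le> C * M * c t 1 0" "Jt t 0 1 \<le> C * M * c t 0 1"
  proof -
    have "ad 1 0 * c t 0 1 * c t 1 0 \<le> C * M * c t 1 0" "a 0 1 * c t 1 0 * c t 0 1 \<le> C * M * c t 0 1"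
      using t const_ge coeff_le(2)[of 1 0] coeff_le(1)[of 0 1]
      by (auto intro!: mult_right_mono mult_mono c_le c_nonneg)
    then show "Jdt t 1 0 \<le> C * M * c t 1 0" "Jt t 0 1 \<le> C * M * c t 0 1"
      using gain_nonneg(2)[OF t, of 1 0] gain_nonneg(1)[OF t, of 0 1] by (auto simp: J_def Jd_def)
  qed
  moreover have "loss t 1 0 = Jt t 1 0 + Jdt t 1 0 + flux t" "loss t 0 1 = Jt t 0 1 + Jdt t 0 1 + fluxd t"
    by (simp_all add: loss_eq diff_r_def diff_s_def)
  ultimately show "loss t 1 0 \<le> 4 * C * M * c t 1 0 - b (r + 1) s * c t (r + 1) s"
    and "loss t 0 1 \<le> 4 * C * M * c t 0 1 - bd r (s + 1) * c t r (s + 1)"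
    using J_le'[OF t rs] by (simp_all add: mult.commute mult.left_commute)
qed

lemma in_time_dom: "t \<in> time_dom T \<Longrightarrow> 0 \<le> \<tau> \<Longrightarrow> \<tau> \<le> t \<Longrightarrow> \<tau> \<in> time_dom T"
  using time_dom_subset[of t] by auto

lemma c_cont_Icc: "t \<in> time_dom T \<Longrightarrow> 0 \<le> u \<Longrightarrow> (r, s) \<in> Idx \<Longrightarrow> continuous_on {u..t} (\<lambda>t. c t r s)"
  by (rule continuous_on_subset[OF c_cont]) (auto intro: in_time_dom)

lemma zero_at_0:
  assumes t: "t \<in> time_dom T" "0 < t" and rs: "(r, s) \<in> Idx"
    and 0: "\<And>\<tau>. 0 < \<tau> \<Longrightarrow> \<tau> < t \<Longrightarrow> c \<tau> r s = 0"
  shows "c 0 r s = 0"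
  using continuous_constant_on_closure[of "{0<..<t}" "\<lambda>t. c t r s" 0 0] c_cont_Icc[OF t(1) order_refl rs]
    t 0 by simp

text \<open>The loss is at most proportional to the density, hence \<open>zero_backward\<close>
  applies. The density is then constant on the open interval, so its derivative, the negative of
  \<open>loss\<close>, vanishes as well.\<close>

lemma monomer_vanishes:
  assumes t: "t \<in> time_dom T" "0 < t" and rs: "(r, s) \<in> {(1, 0), (0, 1)}" and 0: "c t r s = 0"
    and \<tau>: "0 < \<tau>" "\<tau> < t"
  shows "c \<tau> r s = 0" and "loss \<tau> r s = 0"
proof -
  have I: "(r, s) \<in> Idx" using rs by auto
  have z: "c \<tau> r s = 0" if "\<tau> \<in> {0..t}" for \<tau>
  proof (rule zero_backward[where x = "\<lambda>t. c t r s" and L = "4 * C * M" and t = t])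
    fix \<tau> assume \<tau>: "0 < \<tau>" "\<tau> < t"
    then have \<tau>': "\<tau> \<in> time_dom T" using t in_time_dom by auto
    show "((\<lambda>t. c t r s) has_real_derivative - loss \<tau> r s) (at \<tau>)"
      by (rule c_deriv[OF \<tau>' \<tau>(1) I])
    have "loss \<tau> r s \<le> 4 * C * M * c \<tau> r s"
      using rs loss_monomer_le(1)[OF \<tau>', of 1 0] gain_nonneg(1)[OF \<tau>', of 1 0]
        loss_monomer_le(2)[OF \<tau>', of 0 1] gain_nonneg(2)[OF \<tau>', of 0 1] by auto
    then show "- (4 * C * M * c \<tau> r s) \<le> - loss \<tau> r s" by simp
  next
    show "0 \<le> c \<tau> r s" if "\<tau> \<in> {0..t}" for \<tau>
      using that t I by (auto intro: c_nonneg in_time_dom)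
  qed (use that t I c_cont_Icc 0 in auto)
  show "c \<tau> r s = 0" using z \<tau> by simp
  have "((\<lambda>t. c t r s) has_real_derivative 0) (at \<tau>)"
    by (rule has_field_derivative_transform_within_open[of "\<lambda>_. 0" _ _ "{0<..<t}"])
      (use \<tau> z in auto)
  then show "loss \<tau> r s = 0"
    using c_deriv[OF in_time_dom[OF t(1), of \<tau>] \<tau>(1) I] \<tau> DERIV_unique by fastforce
qed

text \<open>If the monomer vanished at time t, then \<open>loss_monomer_le\<close> would force to 0
  on (0, t) every cluster that can release this monomer; continuity carries this to time 0, against
  the nonzero initial component.\<close>

lemma monomer_r_pos:
  assumes mass: "(r0, s0) \<in> Idx" "1 \<le> r0" "c 0 r0 s0 \<noteq> 0" and t: "t \<in> time_dom T" "0 < t"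
  shows "0 < c t 1 0"
proof (rule ccontr)
  assume "\<not> 0 < c t 1 0"
  then have 0: "c t 1 0 = 0" using c_nonneg[OF t(1), of 1 0] by simp
  have "c \<tau> r0 s0 = 0" if \<tau>: "0 < \<tau>" "\<tau> < t" for \<tau>
  proof (cases "(r0 - 1, s0) \<in> Idx")
    case True
    have \<tau>': "\<tau> \<in> time_dom T" using \<tau> t in_time_dom by auto
    have "b (r0 - 1 + 1) s0 * c \<tau> (r0 - 1 + 1) s0 \<le> 0"
      using loss_monomer_le(1)[OF \<tau>' True] monomer_vanishes[OF t _ 0 \<tau>] by simp
    then show ?thesis
      using pos(3)[OF True] c_nonneg[OF \<tau>' mass(1)] mass(2) by (auto simp: mult_le_0_iff)
  next
    case False
    then have "r0 = 1" "s0 = 0" using mass by (auto simp: Idx_def)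
    then show ?thesis using monomer_vanishes[OF t _ 0 \<tau>] by simp
  qed
  with zero_at_0[OF t mass(1)] mass(3) show False by blast
qed

lemma monomer_s_pos:
  assumes mass: "(r0, s0) \<in> Idx" "1 \<le> s0" "c 0 r0 s0 \<noteq> 0" and t: "t \<in> time_dom T" "0 < t"
  shows "0 < c t 0 1"
proof (rule ccontr)
  assume "\<not> 0 < c t 0 1"
  then have 0: "c t 0 1 = 0" using c_nonneg[OF t(1), of 0 1] by simp
  have "c \<tau> r0 s0 = 0" if \<tau>: "0 < \<tau>" "\<tau> < t" for \<tau>
  proof (cases "(r0, s0 - 1) \<in> Idx")
    case True
    have \<tau>': "\<tau> \<in> time_dom T" using \<tau> t in_time_dom by auto
    have "bd r0 (s0 - 1 + 1) * c \<tau> r0 (s0 - 1 + 1) \<le> 0"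
      using loss_monomer_le(2)[OF \<tau>' True] monomer_vanishes[OF t _ 0 \<tau>] by simp
    then show ?thesis
      using pos(4)[OF True] c_nonneg[OF \<tau>' mass(1)] mass(2) by (auto simp: mult_le_0_iff)
  next
    case False
    then have "r0 = 0" "s0 = 1" using mass by (auto simp: Idx_def)
    then show ?thesis using monomer_vanishes[OF t _ 0 \<tau>] by simp
  qed
  with zero_at_0[OF t mass(1)] mass(3) show False by blast
qed

text \<open>A zero of a nonnegative component at an interior time is a local minimum.\<close>

lemma loss_zero_at_min:
  assumes t: "t \<in> time_dom T" "0 < t" and rs: "(r, s) \<in> Idx" and 0: "c t r s = 0"
  shows "loss t r s = 0"
proof -
  obtain u where u: "t < u" "u \<in> time_dom T" using time_dom_greater[OF t(1)] .
  have "\<forall>y. \<bar>t - y\<bar> < min t (u - t) \<longrightarrow> c t r s \<le> c y r s"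
    using 0 u rs by (auto intro!: c_nonneg in_time_dom[OF u(2)])
  from DERIV_local_min[OF c_deriv[OF t rs] _ this] show ?thesis using t u by simp
qed

text \<open>At a zero of a component the outgoing fluxes are nonpositive, while the incoming flux
  from a smaller cluster, positive by induction, is strictly positive. So \<open>loss\<close> would
  be negative, against \<open>loss_zero_at_min\<close>.\<close>

lemma c_pos:
  assumes mass: "(r1, s1) \<in> Idx" "1 \<le> r1" "c 0 r1 s1 \<noteq> 0" "(r2, s2) \<in> Idx" "1 \<le> s2" "c 0 r2 s2 \<noteq> 0"
    and t: "t \<in> time_dom T" "0 < t" and rs: "(r, s) \<in> Idx"
  shows "0 < c t r s"
  using rs
proof (induction "r + s" arbitrary: r s rule: less_induct)
  case less
  have m: "0 < c t 1 0" "0 < c t 0 1"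
    using monomer_r_pos[OF mass(1-3) t] monomer_s_pos[OF mass(4-6) t] by auto
  show ?case
  proof (rule ccontr)
    assume "\<not> 0 < c t r s"
    then have 0: "c t r s = 0" using c_nonneg[OF t(1) less.prems] by simp
    have ne: "(r, s) \<noteq> (1, 0)" "(r, s) \<noteq> (0, 1)" using 0 m by (metis less_irrefl prod.inject)+
    have J0: "Jt t r s \<le> 0" "Jdt t r s \<le> 0"
      using gain_nonneg[OF t(1) less.prems] 0 by (auto simp: J_def Jd_def)
    have r: "0 < Jt t (r - 1) s" if "1 \<le> r"
    proof -
      have I: "(r - 1, s) \<in> Idx" using ne that by (auto simp: Idx_def)
      have "0 < c t (r - 1) s" by (rule less.hyps) (use that I in auto)
      with pos(1)[OF I] m 0 that show ?thesis by (simp add: J_def)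
    qed
    have s: "0 < Jdt t r (s - 1)" if "1 \<le> s"
    proof -
      have I: "(r, s - 1) \<in> Idx" using ne that by (auto simp: Idx_def)
      have "0 < c t r (s - 1)" by (rule less.hyps) (use that I in auto)
      with pos(2)[OF I] m 0 that show ?thesis by (simp add: Jd_def)
    qed
    have "loss t r s < 0"
      using J0 r s ne less.prems unfolding loss_eq diff_r_def diff_s_def
      by (auto simp: Idx_def split: if_splits)
    then show False using loss_zero_at_min[OF t less.prems 0] by simp
  qed
qed

end

section \<open>Propagation of the moment of order \<open>1 + \<alpha>\<close>\<close>

lemma increment_le:
  fixes f g :: "real \<Rightarrow> real"
  assumes "a \<le> b" "continuous_on {a..b} f" "continuous_on {a..b} g"
    and d: "\<And>x. \<lbrakk>a < x; x < b\<rbrakk> \<Longrightarrow> (f has_real_derivative f' x) (at x)"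
    and le: "\<And>x. \<lbrakk>a < x; x < b\<rbrakk> \<Longrightarrow> f' x \<le> g x"
  shows "f b - f a \<le> integral {a..b} g"
proof -
  define h where "h = (\<lambda>x. f x - integral {a..x} g)"
  have "h b \<le> h a"
  proof (rule DERIV_nonpos_imp_decreasing_open[where f = h])
    show "\<exists>y. (h has_real_derivative y) (at x) \<and> y \<le> 0" if x: "a < x" "x < b" for x
    proof (intro exI conjI)
      have "((\<lambda>x. integral {a..x} g) has_real_derivative g x) (at x within {a..b})"
        using assms x by (intro integral_has_real_derivative) auto
      then have "((\<lambda>x. integral {a..x} g) has_real_derivative g x) (at x)"
        using x at_within_interior[of x "{a..b}"] by simp
      then show "(h has_real_derivative f' x - g x) (at x)"
        unfolding h_def using d[OF x] by (auto intro!: derivative_eq_intros)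
    qed (use le[OF x] in simp)
    show "continuous_on {a..b} h"
      unfolding h_def using assms
      by (intro continuous_intros indefinite_integral_continuous_1 integrable_continuous_real)
  qed fact
  then show ?thesis by (simp add: h_def)
qed

lemma gronwall:
  fixes x :: "real \<Rightarrow> real"
  assumes "0 \<le> t" "continuous_on {0..t} x" "0 \<le> L" "0 \<le> B"
    and d: "\<And>\<tau>. \<lbrakk>0 < \<tau>; \<tau> < t\<rbrakk> \<Longrightarrow> (x has_real_derivative x' \<tau>) (at \<tau>)"
    and le: "\<And>\<tau>. \<lbrakk>0 < \<tau>; \<tau> < t\<rbrakk> \<Longrightarrow> x' \<tau> \<le> L * x \<tau> + B"
  shows "x t \<le> exp (L * t) * (x 0 + B * t)"
proof -
  define y where "y = (\<lambda>\<tau>. exp (- (L * \<tau>)) * x \<tau> - B * \<tau>)"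
  have "y t \<le> y 0"
  proof (rule DERIV_nonpos_imp_decreasing_open[where f = y])
    show "\<exists>z. (y has_real_derivative z) (at \<tau>) \<and> z \<le> 0" if \<tau>: "0 < \<tau>" "\<tau> < t" for \<tau>
    proof (intro exI conjI)
      show "(y has_real_derivative exp (- (L * \<tau>)) * (x' \<tau> - L * x \<tau>) - B) (at \<tau>)"
        unfolding y_def by (auto intro!: derivative_eq_intros d[OF \<tau>] simp: algebra_simps)
      have "exp (- (L * \<tau>)) * (x' \<tau> - L * x \<tau>) \<le> exp (- (L * \<tau>)) * B"
        using le[OF \<tau>] by (intro mult_left_mono) auto
      also have "\<dots> \<le> 1 * B"
        using assms \<tau> by (intro mult_right_mono) auto
      finally show "exp (- (L * \<tau>)) * (x' \<tau> - L * x \<tau>) - B \<le> 0" by simp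
    qed
    show "continuous_on {0..t} y"
      unfolding y_def using assms(2) by (intro continuous_intros)
  qed fact
  then have "exp (L * t) * (exp (- (L * t)) * x t) \<le> exp (L * t) * (x 0 + B * t)"
    by (intro mult_left_mono) (auto simp: y_def)
  then show ?thesis
    unfolding mult.assoc[symmetric, of "exp _"] exp_add[symmetric] by simp
qed

text \<open>Follows from (1 + 1 / x) powr \<alpha> <= 1 + 1 / x; the 3 bounds 2 + 1 / x.\<close>

lemma powr_1_plus_diff_le:
  assumes "0 \<le> \<alpha>" "\<alpha> \<le> 1" "1 \<le> n"
  shows "real (Suc n) powr (1 + \<alpha>) - real n powr (1 + \<alpha>) \<le> 3 * real n powr \<alpha>"
proof -
  define x where "x = real n"
  have x: "1 \<le> x" using assms by (simp add: x_def)
  have "(1 + 1 / x) powr \<alpha> \<le> (1 + 1 / x) powr 1"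
    using assms x by (intro powr_mono) auto
  then have "(1 + 1 / x) powr \<alpha> \<le> 1 + 1 / x"
    using x by (simp add: add_pos_nonneg)
  moreover have "(x + 1) powr \<alpha> = x powr \<alpha> * (1 + 1 / x) powr \<alpha>"
  proof -
    have "x + 1 = x * (1 + 1 / x)" using x by (simp add: field_simps)
    then show ?thesis using x by (metis powr_mult)
  qed
  ultimately have "(x + 1) powr \<alpha> \<le> x powr \<alpha> * (1 + 1 / x)"
    by (simp add: mult_left_mono)
  then have "(x + 1) * (x + 1) powr \<alpha> \<le> (x + 1) * (x powr \<alpha> * (1 + 1 / x))"
    using x by (intro mult_left_mono) auto
  also have "\<dots> = x powr \<alpha> * (x + 2 + 1 / x)"
    using x by (simp add: field_simps)
  also have "\<dots> \<le> x powr \<alpha> * (x + 3)"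
    using x by (intro mult_left_mono) auto
  finally show ?thesis
    using x by (simp add: x_def powr_add algebra_simps)
qed

context bd_trajectory
begin

lemma sum_c_deriv:
  assumes t: "t \<in> time_dom T" "0 < t"
  shows "((\<lambda>t. \<Sum>(r, s)\<in>Idx_le N. g r s * c t r s) has_real_derivative
    (\<Sum>(r, s)\<in>Idx_le N. g r s * - loss t r s)) (at t)"
  unfolding split_def
  by (intro DERIV_sum DERIV_cmult c_deriv t) (use Idx_le_imp_Idx in auto)

lemma sum_c_cont:
  assumes t: "t \<in> time_dom T" "0 \<le> u"
  shows "continuous_on {u..t} (\<lambda>t. \<Sum>(r, s)\<in>Idx_le N. g r s * c t r s)"
  unfolding split_def
  by (intro continuous_intros c_cont_Icc t) (use Idx_le_imp_Idx in auto)

definition "shell N t = (\<Sum>(r, s)\<in>Idx_eq N. c t r s)"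

lemma Idx_eq_Suc_imp_Idx: "(r, s) \<in> Idx_eq (Suc N) \<Longrightarrow> (r, s) \<in> Idx"
  by (auto simp: Idx_eq_def Idx_def)

lemma shell_nonneg: "t \<in> time_dom T \<Longrightarrow> 0 \<le> shell (Suc N) t"
  unfolding shell_def by (intro sum_nonneg) (auto intro: c_nonneg dest: Idx_eq_Suc_imp_Idx)

lemma shell_cont: "t \<in> time_dom T \<Longrightarrow> 0 \<le> u \<Longrightarrow> continuous_on {u..t} (shell (Suc N))"
  unfolding shell_def split_def
  by (intro continuous_on_sum c_cont_Icc) (auto dest: Idx_eq_Suc_imp_Idx)

lemma shell_shift:
  assumes t: "t \<in> time_dom T"
  shows "(\<Sum>(r, s)\<in>Idx_eq (Suc N). c t r s + c t (r + 1) s) \<le> shell (Suc N) t + shell (Suc (Suc N)) t"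
    and "(\<Sum>(r, s)\<in>Idx_eq (Suc N). c t r s + c t r (s + 1)) \<le> shell (Suc N) t + shell (Suc (Suc N)) t"
  using sum_Idx_eq_shift_r[of "Suc N" "c t"] sum_Idx_eq_shift_s[of "Suc N" "c t"] c_nonneg[OF t]
  by (auto simp: shell_def split_def sum.distrib Idx_def)

lemma J_shell:
  assumes t: "t \<in> time_dom T"
  shows "(\<Sum>(r, s)\<in>Idx_eq (Suc N). \<bar>Jt t r s\<bar>)
      \<le> C * M * real (Suc N) powr \<alpha> * (shell (Suc N) t + shell (Suc (Suc N)) t)"
    and "(\<Sum>(r, s)\<in>Idx_eq (Suc N). \<bar>Jdt t r s\<bar>)
      \<le> C * M * real (Suc N) powr \<alpha> * (shell (Suc N) t + shell (Suc (Suc N)) t)"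
proof -
  have p: "\<bar>Jt t r s\<bar> \<le> C * M * real (Suc N) powr \<alpha> * (c t r s + c t (r + 1) s)"
    "\<bar>Jdt t r s\<bar> \<le> C * M * real (Suc N) powr \<alpha> * (c t r s + c t r (s + 1))"
    if "(r, s) \<in> Idx_eq (Suc N)" for r s
  proof -
    have "r + s = Suc N" using that by (simp add: Idx_eq_def)
    then show "\<bar>Jt t r s\<bar> \<le> C * M * real (Suc N) powr \<alpha> * (c t r s + c t (r + 1) s)"
      "\<bar>Jdt t r s\<bar> \<le> C * M * real (Suc N) powr \<alpha> * (c t r s + c t r (s + 1))"
      using J_bound[OF t Idx_eq_Suc_imp_Idx[OF that]] Jd_bound[OF t Idx_eq_Suc_imp_Idx[OF that]]
      by (simp_all only:)
  qed
  have "(\<Sum>(r, s)\<in>Idx_eq (Suc N). \<bar>Jt t r s\<bar>)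
      \<le> (\<Sum>(r, s)\<in>Idx_eq (Suc N). C * M * real (Suc N) powr \<alpha> * (c t r s + c t (r + 1) s))"
    by (rule sum_mono) (use p in auto)
  also have "\<dots> = C * M * real (Suc N) powr \<alpha> * (\<Sum>(r, s)\<in>Idx_eq (Suc N). c t r s + c t (r + 1) s)"
    by (simp add: sum_distrib_left split_def)
  also have "\<dots> \<le> C * M * real (Suc N) powr \<alpha> * (shell (Suc N) t + shell (Suc (Suc N)) t)"
    using const_ge by (intro mult_left_mono shell_shift t) auto
  finally show "(\<Sum>(r, s)\<in>Idx_eq (Suc N). \<bar>Jt t r s\<bar>)
      \<le> C * M * real (Suc N) powr \<alpha> * (shell (Suc N) t + shell (Suc (Suc N)) t)" .
  have "(\<Sum>(r, s)\<in>Idx_eq (Suc N). \<bar>Jdt t r s\<bar>)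
      \<le> (\<Sum>(r, s)\<in>Idx_eq (Suc N). C * M * real (Suc N) powr \<alpha> * (c t r s + c t r (s + 1)))"
    by (rule sum_mono) (use p in auto)
  also have "\<dots> = C * M * real (Suc N) powr \<alpha> * (\<Sum>(r, s)\<in>Idx_eq (Suc N). c t r s + c t r (s + 1))"
    by (simp add: sum_distrib_left split_def)
  also have "\<dots> \<le> C * M * real (Suc N) powr \<alpha> * (shell (Suc N) t + shell (Suc (Suc N)) t)"
    using const_ge by (intro mult_left_mono shell_shift t) auto
  finally show "(\<Sum>(r, s)\<in>Idx_eq (Suc N). \<bar>Jdt t r s\<bar>)
      \<le> C * M * real (Suc N) powr \<alpha> * (shell (Suc N) t + shell (Suc (Suc N)) t)" .
qed

lemma J_shell_tail:
  assumes t: "t \<in> time_dom T"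
  shows "(\<Sum>(r, s)\<in>Idx_eq (Suc N). \<bar>Jt t r s\<bar>) \<le> tail_bound N"
    and "(\<Sum>(r, s)\<in>Idx_eq (Suc N). \<bar>Jdt t r s\<bar>) \<le> tail_bound N"
proof -
  have F: "Idx_eq (Suc N) \<subseteq> Idx - Idx_le N"
    by (auto simp: Idx_eq_def Idx_le_def Idx_def)
  show "(\<Sum>(r, s)\<in>Idx_eq (Suc N). \<bar>Jt t r s\<bar>) \<le> tail_bound N"
    "(\<Sum>(r, s)\<in>Idx_eq (Suc N). \<bar>Jdt t r s\<bar>) \<le> tail_bound N"
    using J_tail_sum[OF t finite_Idx_eq F] Jd_tail_sum[OF t finite_Idx_eq F]
    by (simp_all add: split_def)
qed

definition "moment N t = (\<Sum>(r, s)\<in>Idx_le N. real (r + s) powr (1 + \<alpha>) * c t r s)"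

text \<open>The 2 bounds the two boundary fluxes once the outer cutoff is chosen large; each
  \<open>tail_bound 0\<close> bounds one full flux series, which enters with the monomer weight
  1.\<close>

definition "moment_rate = 2 + 2 * tail_bound 0"

text \<open>The weight is frozen beyond size \<open>N\<close>, so that the boundary flux at size \<open>R\<close>
  is \<open>O(R powr (\<alpha> - 1))\<close>; the growth rate of the truncated moment does not depend on \<open>N\<close>.\<close>

lemma moment_le:
  assumes m0: "\<And>N. moment N 0 \<le> m0" and t: "t \<in> time_dom T"
  shows "moment N t \<le> exp (6 * C * M * t) * (m0 + moment_rate * t)"
proof (cases "N = 0")
  case True
  then show ?thesis
    using m0[of 0] t tail_bound_nonneg[of 0] by (simp add: moment_def moment_rate_def time_dom_def)
next
  case False
  define g where "g = (\<lambda>r s. real (min (r + s) N) powr (1 + \<alpha>))"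
  have t0: "0 \<le> t" using t by (simp add: time_dom_def)
  have "(\<lambda>R. real N powr (1 + \<alpha>) * tail_bound R) \<longlonglongrightarrow> 0"
    using tail_bound_lim by (intro tendsto_mult_right_zero)
  then have "\<forall>\<^sub>F R in sequentially. N \<le> R \<and> real N powr (1 + \<alpha>) * tail_bound R < 1"
    by (intro eventually_conj order_tendstoD(2) eventually_ge_at_top) auto
  \<comment> \<open>Both conditions concern the boundary: at size \<open>Suc R\<close> the weight is
    already frozen, and each of the two flux families crossing it contributes at most 1.\<close>
  then obtain R where R: "N \<le> R" "real N powr (1 + \<alpha>) * tail_bound R < 1"
    by (auto simp: eventually_sequentially)
  define P where "P = (\<lambda>t. \<Sum>(r, s)\<in>Idx_le (Suc R). g r s * c t r s)"
  have nn: "0 \<le> c \<tau> r s" if "\<tau> \<in> time_dom T" "(r, s) \<in> Idx_le K" for r s K \<tau>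
    using that by (auto intro: c_nonneg Idx_le_imp_Idx)
  have growth: "(\<Sum>(r, s)\<in>Idx_le (Suc R). g r s * - loss \<tau> r s) \<le> 6 * C * M * P \<tau> + moment_rate"
    if \<tau>: "\<tau> \<in> time_dom T" for \<tau>
  proof -
    have inner: "(g (r + 1) s - g r s) * Jt \<tau> r s + (g r (s + 1) - g r s) * Jdt \<tau> r s
        \<le> 6 * C * M * (g r s * c \<tau> r s)" if I: "(r, s) \<in> Idx" for r s
    proof -
      define n where "n = r + s"
      have n: "1 \<le> n" using I by (simp add: n_def Idx_def)
      define d where "d = g (r + 1) s - g r s"
      have d': "g r (s + 1) - g r s = d" by (simp add: d_def g_def)
      have d0: "0 \<le> d" unfolding d_def g_def using alpha by (auto intro!: powr_mono2)
      have cn: "0 \<le> c \<tau> r s" by (rule c_nonneg[OF \<tau> I])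
      \<comment> \<open>Increment of the weight times coefficient is of order n powr (2 * \<alpha>),
        which the weight n powr (1 + \<alpha>) dominates because \<alpha> < 1; this closes the
        Gronwall estimate.\<close>
      have "d * real n powr \<alpha> \<le> 3 * g r s"
      proof (cases "n < N")
        case True
        then have "d \<le> 3 * real n powr \<alpha>"
          using powr_1_plus_diff_le[of \<alpha> n] alpha n by (simp add: d_def g_def n_def)
        then have "d * real n powr \<alpha> \<le> 3 * real n powr \<alpha> * real n powr \<alpha>"
          by (intro mult_right_mono) auto
        also have "\<dots> = 3 * real n powr (\<alpha> + \<alpha>)" unfolding powr_add by simp
        also have "\<dots> \<le> 3 * real n powr (1 + \<alpha>)"
          using alpha n by (intro mult_left_mono powr_mono) auto
        finally show ?thesis using True by (simp add: g_def n_def)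
      next
        case False
        then have "d = 0" by (simp add: d_def g_def n_def min_def)
        then show ?thesis by (simp add: g_def)
      qed
      then have "d * real n powr \<alpha> * (C * M * c \<tau> r s) \<le> 3 * g r s * (C * M * c \<tau> r s)"
        using const_ge cn by (intro mult_right_mono) auto
      then have key: "d * (C * real n powr \<alpha> * M * c \<tau> r s) \<le> 3 * C * M * (g r s * c \<tau> r s)"
        by (simp add: algebra_simps)
      \<comment> \<open>Since \<open>d\<close> is nonnegative, upper bounds of the fluxes suffice
        and dissociation is dropped. Two families at 3 * C * M each give the rate 6 * C * M.\<close>
      have "Jt \<tau> r s \<le> C * real n powr \<alpha> * M * c \<tau> r s"
           "Jdt \<tau> r s \<le> C * real n powr \<alpha> * M * c \<tau> r s"
      proof -
        have "a r s * c \<tau> 1 0 * c \<tau> r s \<le> C * real n powr \<alpha> * M * c \<tau> r s"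
             "ad r s * c \<tau> 0 1 * c \<tau> r s \<le> C * real n powr \<alpha> * M * c \<tau> r s"
          using const_ge unfolding n_def
          by (intro mult_right_mono mult_mono coeff_le I c_le \<tau> cn c_nonneg; simp)+
        then show "Jt \<tau> r s \<le> C * real n powr \<alpha> * M * c \<tau> r s"
           "Jdt \<tau> r s \<le> C * real n powr \<alpha> * M * c \<tau> r s"
          using gain_nonneg[OF \<tau> I] by (simp_all add: J_def Jd_def)
      qed
      from this[THEN mult_left_mono, OF d0] key show ?thesis
        unfolding d' d_def[symmetric] by linarith
    qed
    have "(\<Sum>(r, s)\<in>Idx_le R. (g (r + 1) s - g r s) * Jt \<tau> r s + (g r (s + 1) - g r s) * Jdt \<tau> r s)
        \<le> (\<Sum>(r, s)\<in>Idx_le R. 6 * C * M * (g r s * c \<tau> r s))"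
      by (rule sum_mono) (use inner Idx_le_imp_Idx in auto)
    also have "\<dots> \<le> (\<Sum>(r, s)\<in>Idx_le (Suc R). 6 * C * M * (g r s * c \<tau> r s))"
      using Idx_le_mono[of R "Suc R"] const_ge nn[OF \<tau>, of _ _ "Suc R"]
      by (intro sum_mono2) (auto simp: g_def)
    also have "\<dots> = 6 * C * M * P \<tau>"
      by (simp add: P_def sum_distrib_left split_def)
    finally have 1: "(\<Sum>(r, s)\<in>Idx_le R. (g (r + 1) s - g r s) * Jt \<tau> r s
        + (g r (s + 1) - g r s) * Jdt \<tau> r s) \<le> 6 * C * M * P \<tau>" .
    have "- (\<Sum>(r, s)\<in>Idx_eq (Suc R). g r s * (Jt \<tau> r s + Jdt \<tau> r s))
        = (\<Sum>(r, s)\<in>Idx_eq (Suc R). real N powr (1 + \<alpha>) * - (Jt \<tau> r s + Jdt \<tau> r s))"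
      unfolding sum_negf[symmetric]
      using R(1) by (intro sum.cong) (auto simp: g_def Idx_eq_def min_def algebra_simps)
    also have "\<dots> \<le> (\<Sum>(r, s)\<in>Idx_eq (Suc R). real N powr (1 + \<alpha>) * (\<bar>Jt \<tau> r s\<bar> + \<bar>Jdt \<tau> r s\<bar>))"
      by (intro sum_mono) (auto intro!: mult_left_mono)
    also have "\<dots> = real N powr (1 + \<alpha>) * ((\<Sum>(r, s)\<in>Idx_eq (Suc R). \<bar>Jt \<tau> r s\<bar>)
        + (\<Sum>(r, s)\<in>Idx_eq (Suc R). \<bar>Jdt \<tau> r s\<bar>))"
      by (simp add: sum_distrib_left[symmetric] split_def sum.distrib)
    also have "\<dots> \<le> real N powr (1 + \<alpha>) * (tail_bound R + tail_bound R)"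
      by (intro mult_left_mono add_mono J_shell_tail \<tau>) auto
    finally have 2: "- (\<Sum>(r, s)\<in>Idx_eq (Suc R). g r s * (Jt \<tau> r s + Jdt \<tau> r s)) \<le> 2"
      using R(2) by (simp add: distrib_left)
    have 3: "g 1 0 = 1" "g 0 1 = 1" using False by (auto simp: g_def min_def)
    have 4: "\<bar>flux \<tau>\<bar> \<le> tail_bound 0" "\<bar>fluxd \<tau>\<bar> \<le> tail_bound 0"
      using flux_tail[OF \<tau>, of 0] by auto
    show ?thesis
      unfolding sum_loss 3 moment_rate_def using 1 2 4 by linarith
  qed
  have "P t \<le> exp (6 * C * M * t) * (P 0 + moment_rate * t)"
  proof (rule gronwall[OF t0])
    show "continuous_on {0..t} P" unfolding P_def by (rule sum_c_cont[OF t]) simp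
    show "0 \<le> moment_rate" using tail_bound_nonneg[of 0] by (simp add: moment_rate_def)
    fix \<tau> assume \<tau>: "0 < \<tau>" "\<tau> < t"
    then have "\<tau> \<in> time_dom T" using in_time_dom[OF t] by simp
    then show "(P has_real_derivative (\<Sum>(r, s)\<in>Idx_le (Suc R). g r s * - loss \<tau> r s)) (at \<tau>)"
      unfolding P_def using \<tau>(1) by (rule sum_c_deriv)
    show "(\<Sum>(r, s)\<in>Idx_le (Suc R). g r s * - loss \<tau> r s) \<le> 6 * C * M * P \<tau> + moment_rate"
      by (rule growth) fact
  qed (use const_ge in auto)
  moreover have "P 0 \<le> m0"
  proof -
    have z: "0 \<in> time_dom T" using in_time_dom[OF t, of 0] t0 by simp
    have "P 0 \<le> moment (Suc R) 0"
      unfolding P_def moment_def using alpha nn[OF z]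
      by (intro sum_mono) (auto simp: g_def intro!: mult_right_mono powr_mono2)
    with m0 show ?thesis by (rule order_trans[rotated])
  qed
  moreover have "moment N t \<le> P t"
  proof -
    have "moment N t = (\<Sum>(r, s)\<in>Idx_le N. g r s * c t r s)"
      unfolding moment_def by (intro sum.cong) (auto simp: g_def Idx_le_def min_def)
    also have "\<dots> \<le> P t"
      unfolding P_def using R Idx_le_mono[of N "Suc R"] nn[OF t, of _ _ "Suc R"]
      by (intro sum_mono2) (auto simp: g_def)
    finally show ?thesis .
  qed
  ultimately show ?thesis
    by (meson order_trans mult_left_mono add_right_mono exp_ge_zero)
qed

end

section \<open>Uniform approximation of the entropy\<close>

locale bd_trajectory_moment = bd_trajectory +
  fixes m0 :: real
  assumes moment_0: "moment N 0 \<le> m0"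
    and entropy_summable:
      "t \<in> time_dom T \<Longrightarrow> (\<lambda>(r, s). c t r s * (ln (c t r s / Q r s) - 1)) summable_on Idx"
    and mass_r: "\<exists>(r, s)\<in>Idx. 1 \<le> r \<and> c 0 r s \<noteq> 0"
    and mass_s: "\<exists>(r, s)\<in>Idx. 1 \<le> s \<and> c 0 r s \<noteq> 0"
begin

text \<open>One shell's share of the moment of order 1 + \<alpha>, the unit in which boundary errors
  at the cutoff are measured.\<close>

definition "wshell N t = real N powr (1 + \<alpha>) * shell N t"

lemma wshell_nonneg: "t \<in> time_dom T \<Longrightarrow> 0 \<le> wshell (Suc N) t"
  by (simp add: wshell_def shell_nonneg)

lemma wshell_cont: "t \<in> time_dom T \<Longrightarrow> 0 \<le> u \<Longrightarrow> continuous_on {u..t} (wshell (Suc N))"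
  unfolding wshell_def by (intro continuous_intros shell_cont)

lemma moment_eq: "moment N t = (\<Sum>k<N. wshell (Suc k) t)"
proof (induction N)
  case (Suc N)
  have "(\<Sum>(r, s)\<in>Idx_eq (Suc N). real (r + s) powr (1 + \<alpha>) * c t r s)
      = (\<Sum>(r, s)\<in>Idx_eq (Suc N). real (Suc N) powr (1 + \<alpha>) * c t r s)"
    by (intro sum.cong refl) (auto simp: Idx_eq_def simp del: of_nat_Suc of_nat_add)
  then show ?case
    using Suc by (simp add: moment_def sum_Idx_le_Suc wshell_def shell_def sum_distrib_left split_def)
qed (simp add: moment_def)

text \<open>The integrals are the terms of a nonnegative series whose partial sums are integrals of
  truncated moments, bounded by t * B; hence they tend to 0.\<close>

lemma wshell_integral_lim:
  assumes t: "t \<in> time_dom T"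
  shows "(\<lambda>N. integral {0..t} (wshell (Suc N))) \<longlonglongrightarrow> 0"
proof (rule summable_LIMSEQ_zero, rule summableI_nonneg_bounded)
  have t0: "0 \<le> t" using t by (simp add: time_dom_def)
  have int: "wshell (Suc k) integrable_on {0..t}" for k
    using wshell_cont[OF t] by (intro integrable_continuous_real) simp
  show "0 \<le> integral {0..t} (wshell (Suc k))" for k
    using int by (rule integral_nonneg) (auto intro: wshell_nonneg in_time_dom[OF t])
  define B where "B = exp (6 * C * M * t) * (m0 + moment_rate * t)"
  have rate: "0 \<le> moment_rate" and m0: "0 \<le> m0"
    using tail_bound_nonneg[of 0] moment_0[of 0] by (auto simp: moment_rate_def moment_def)
  have B: "moment N \<tau> \<le> B" if "\<tau> \<in> {0..t}" for N \<tau>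
  proof -
    have "moment N \<tau> \<le> exp (6 * C * M * \<tau>) * (m0 + moment_rate * \<tau>)"
      using that by (intro moment_le moment_0 in_time_dom[OF t]) auto
    also have "\<dots> \<le> B"
      unfolding B_def using that rate m0 const_ge
      by (intro mult_mono add_left_mono mult_left_mono) auto
    finally show ?thesis .
  qed
  show "(\<Sum>k<N. integral {0..t} (wshell (Suc k))) \<le> t * B" for N
  proof -
    have "(\<Sum>k<N. integral {0..t} (wshell (Suc k))) = integral {0..t} (moment N)"
      unfolding moment_eq using int by (subst integral_sum) auto
    also have "\<dots> \<le> integral {0..t} (\<lambda>_. B)"
    proof (rule integral_le)
      show "moment N integrable_on {0..t}"
        unfolding moment_eq[abs_def] using int by (intro integrable_sum) auto
    qed (use B in auto)
    also have "\<dots> = t * B" using t0 by simp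
    finally show ?thesis .
  qed
qed

section \<open>Conservation of mass up to a small drift\<close>

definition "msum N t = (\<Sum>(r, s)\<in>Idx_le N. real (r + s) * c t r s)"

text \<open>Bounds the rate of change of the mass up to size k + 1: flux tails beyond the truncation
  plus the weighted boundary fluxes.\<close>

definition "rest k u = 2 * tail_bound k + 2 * C * M * (wshell (Suc k) u + wshell (Suc (Suc k)) u)"

definition "drift t k = integral {0..t} (rest k)"

lemma rest_cont: "t \<in> time_dom T \<Longrightarrow> 0 \<le> u \<Longrightarrow> continuous_on {u..t} (rest k)"
  unfolding rest_def by (intro continuous_intros wshell_cont)

lemma rest_nonneg: "t \<in> time_dom T \<Longrightarrow> 0 \<le> rest k t"
  using const_ge tail_bound_nonneg wshell_nonneg by (simp add: rest_def)

lemma drift_lim: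
  assumes t: "t \<in> time_dom T"
  shows "drift t \<longlonglongrightarrow> 0"
proof -
  have int: "wshell (Suc k) integrable_on {0..t}" for k
    using wshell_cont[OF t] by (intro integrable_continuous_real) simp
  have "drift t k = 2 * tail_bound k * t
      + 2 * C * M * (integral {0..t} (wshell (Suc k)) + integral {0..t} (wshell (Suc (Suc k))))" for k
    using t int unfolding drift_def rest_def time_dom_def
    by (subst integral_add) (auto intro!: integrable_on_mult_right integrable_add simp: integral_add)
  then have d: "drift t = (\<lambda>k. 2 * tail_bound k * t
      + 2 * C * M * (integral {0..t} (wshell (Suc k)) + integral {0..t} (wshell (Suc (Suc k)))))"
    by auto
  have "(\<lambda>k. 2 * tail_bound k * t
      + 2 * C * M * (integral {0..t} (wshell (Suc k)) + integral {0..t} (wshell (Suc (Suc k)))))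
      \<longlonglongrightarrow> 2 * 0 * t + 2 * C * M * (0 + 0)"
    by (intro tendsto_intros tail_bound_lim wshell_integral_lim[OF t]
        LIMSEQ_Suc[OF wshell_integral_lim[OF t]])
  then show ?thesis unfolding d by simp
qed

lemma drift_mono:
  assumes "t \<in> time_dom T" "0 \<le> u" "u \<le> v" "v \<le> t"
  shows "integral {u..v} (rest k) \<le> drift t k"
  unfolding drift_def
  using assms rest_cont[OF assms(1), of 0 k] in_time_dom[OF assms(1)]
  by (intro integral_subset_le integrable_continuous_real)
     (auto intro: rest_nonneg continuous_on_subset)

text \<open>Mass weight times coefficient growth gives the power 1 + \<alpha>, so the boundary
  fluxes are measured by two shells of the moment.\<close>

lemma wshell_bound:
  assumes t: "t \<in> time_dom T"
  shows "real (Suc k) * ((\<Sum>(r, s)\<in>Idx_eq (Suc k). \<bar>Jt t r s\<bar>) + (\<Sum>(r, s)\<in>Idx_eq (Suc k). \<bar>Jdt t r s\<bar>))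
    \<le> 2 * C * M * (wshell (Suc k) t + wshell (Suc (Suc k)) t)"
proof -
  have "real (Suc k) * ((\<Sum>(r, s)\<in>Idx_eq (Suc k). \<bar>Jt t r s\<bar>) + (\<Sum>(r, s)\<in>Idx_eq (Suc k). \<bar>Jdt t r s\<bar>))
    \<le> real (Suc k) * (C * M * real (Suc k) powr \<alpha> * (shell (Suc k) t + shell (Suc (Suc k)) t)
       + C * M * real (Suc k) powr \<alpha> * (shell (Suc k) t + shell (Suc (Suc k)) t))"
    by (intro mult_left_mono add_mono J_shell t) simp
  also have "\<dots> = 2 * C * M * (real (Suc k) powr (1 + \<alpha>) * shell (Suc k) t
      + real (Suc k) powr (1 + \<alpha>) * shell (Suc (Suc k)) t)"
    by (simp add: powr_add algebra_simps)
  also have "\<dots> \<le> 2 * C * M * (wshell (Suc k) t + wshell (Suc (Suc k)) t)"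
    unfolding wshell_def using const_ge alpha
    by (intro mult_left_mono add_left_mono mult_right_mono powr_mono2 shell_nonneg t) auto
  finally show ?thesis .
qed

lemma msum_drift:
  assumes t: "t \<in> time_dom T" and \<tau>: "\<tau> \<in> {0..t}"
  shows "\<bar>msum (Suc k) \<tau> - msum (Suc k) 0\<bar> \<le> drift t k"
proof -
  define d where "d = (\<lambda>u. \<Sum>(r, s)\<in>Idx_le (Suc k). real (r + s) * - loss u r s)"
  have dom: "u \<in> time_dom T" if "u \<in> {0..\<tau>}" for u
    using that \<tau> in_time_dom[OF t] by auto
  have der: "(msum (Suc k) has_real_derivative d u) (at u)" if "0 < u" "u < \<tau>" for u
    unfolding msum_def d_def using dom[of u] that by (intro sum_c_deriv) auto
  have cont: "continuous_on {0..\<tau>} (msum (Suc k))"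
    unfolding msum_def using dom[of \<tau>] \<tau> by (intro sum_c_cont) auto
  have bd: "\<bar>d u\<bar> \<le> rest k u" if "0 < u" "u < \<tau>" for u
  proof -
    have u: "u \<in> time_dom T" using dom that by auto
    \<comment> \<open>For the weight r + s all increments equal 1, so the interior sum is a partial
      flux series and cancels against \<open>flux\<close> and \<open>fluxd\<close> up to their
      tails.\<close>
    have 1: "d u = (\<Sum>(r, s)\<in>Idx_le k. Jt u r s) + (\<Sum>(r, s)\<in>Idx_le k. Jdt u r s)
      - (\<Sum>(r, s)\<in>Idx_eq (Suc k). real (r + s) * (Jt u r s + Jdt u r s)) - flux u - fluxd u"
      unfolding d_def sum_loss by (simp add: split_def sum.distrib)
    have "\<bar>\<Sum>(r, s)\<in>Idx_eq (Suc k). real (r + s) * (Jt u r s + Jdt u r s)\<bar>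
      \<le> (\<Sum>(r, s)\<in>Idx_eq (Suc k). real (Suc k) * (\<bar>Jt u r s\<bar> + \<bar>Jdt u r s\<bar>))"
    proof (rule sum_abs[THEN order_trans], rule sum_mono, clarify)
      fix r s assume "(r, s) \<in> Idx_eq (Suc k)"
      then have e: "r + s = Suc k" by (simp add: Idx_eq_def)
      show "\<bar>real (r + s) * (Jt u r s + Jdt u r s)\<bar> \<le> real (Suc k) * (\<bar>Jt u r s\<bar> + \<bar>Jdt u r s\<bar>)"
        unfolding e abs_mult by (simp add: mult_left_mono)
    qed
    also have "\<dots> = real (Suc k) * ((\<Sum>(r, s)\<in>Idx_eq (Suc k). \<bar>Jt u r s\<bar>)
        + (\<Sum>(r, s)\<in>Idx_eq (Suc k). \<bar>Jdt u r s\<bar>))"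
      by (simp only: sum_distrib_left[symmetric] split_def sum.distrib)
    also note wshell_bound[OF u]
    finally show ?thesis
      using flux_tail[OF u, of k] unfolding 1 rest_def by linarith
  qed
  have le: "integral {0..\<tau>} (rest k) \<le> drift t k"
    using \<tau> by (intro drift_mono[OF t]) auto
  have rc: "continuous_on {0..\<tau>} (rest k)" using dom[of \<tau>] \<tau> by (intro rest_cont) auto
  have "msum (Suc k) \<tau> - msum (Suc k) 0 \<le> integral {0..\<tau>} (rest k)"
    by (rule increment_le[OF _ cont rc der]) (use \<tau> bd in \<open>auto simp: abs_le_iff\<close>)
  moreover have "- msum (Suc k) \<tau> - - msum (Suc k) 0 \<le> integral {0..\<tau>} (rest k)"
    by (rule increment_le[OF _ _ rc DERIV_minus[OF der]])
       (use \<tau> bd cont in \<open>auto simp: abs_le_iff intro: continuous_intros\<close>)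
  ultimately show ?thesis using le by linarith
qed

section \<open>Entropy tails and continuity of the entropy\<close>

definition "ent N t = (\<Sum>(r, s)\<in>Idx_le N. c t r s * (ln (c t r s / Q r s) - 1))"

lemma ent_lim: "t \<in> time_dom T \<Longrightarrow> (\<lambda>N. ent N t) \<longlonglongrightarrow> entropy Q (c t)"
  unfolding ent_def entropy_def by (intro has_sum_imp_Idx_le has_sum_infsum entropy_summable)

text \<open>Uses \<open>abs_x_ln_x_le\<close> with the cluster size as parameter; the logarithm of
  \<open>Q\<close> costs \<open>K\<close> per unit of size.\<close>

lemma c_ln_c_le:
  assumes t: "t \<in> time_dom T" and rs: "(r, s) \<in> Idx"
  shows "\<bar>c t r s * ln (c t r s / Q r s)\<bar>
    \<le> (K + M + 1) * (real (r + s) * c t r s) + 2 * exp (- (real (r + s) / 2))"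
proof -
  define x n where "x = c t r s" and "n = real (r + s)"
  have n: "n \<ge> 1" using rs by (auto simp: Idx_def n_def)
  have x: "0 \<le> x" "x \<le> M" using c_nonneg c_le t rs by (auto simp: x_def)
  have "\<bar>x * ln (x / Q r s)\<bar> \<le> x * \<bar>ln x\<bar> + x * \<bar>ln (Q r s)\<bar>"
  proof (cases "x = 0")
    case False
    then have "\<bar>ln (x / Q r s)\<bar> \<le> \<bar>ln x\<bar> + \<bar>ln (Q r s)\<bar>"
      using x pos[OF rs] by (simp add: ln_div)
    then have "x * \<bar>ln (x / Q r s)\<bar> \<le> x * (\<bar>ln x\<bar> + \<bar>ln (Q r s)\<bar>)"
      using x by (intro mult_left_mono)
    then show ?thesis using x unfolding abs_mult by (simp add: distrib_left)
  qed simp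
  also have "\<dots> \<le> ((n + M) * x + 2 * exp (- (n / 2))) + x * (K * n)"
    using abs_x_ln_x_le[OF x, of n] lnQ_le[OF rs] n x
    by (intro add_mono mult_left_mono) (auto simp: n_def)
  also have "\<dots> \<le> (K + M + 1) * (n * x) + 2 * exp (- (n / 2))"
    using mult_left_mono[OF n, of "M * x"] const_ge x by (simp add: algebra_simps)
  finally show ?thesis by (simp add: x_def n_def)
qed

lemma ent_term_le:
  assumes t: "t \<in> time_dom T" and rs: "(r, s) \<in> Idx"
  shows "\<bar>c t r s * (ln (c t r s / Q r s) - 1)\<bar>
    \<le> (K + M + 2) * (real (r + s) * c t r s) + 2 * exp (- (real (r + s) / 2))"
proof -
  have "1 * c t r s \<le> real (r + s) * c t r s"
    using rs by (intro mult_right_mono c_nonneg t rs) (auto simp: Idx_def)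
  then show ?thesis
    using c_ln_c_le[OF t rs] c_nonneg[OF t rs] by (simp add: algebra_simps)
qed

definition "expsum N = (\<Sum>(r, s)\<in>Idx_le N. 2 * exp (- (real (r + s) / 2)))"

lemma exp_shell: "(\<Sum>(r, s)\<in>Idx_eq N. 2 * exp (- (real (r + s) / 2))) = 2 * real (Suc N) * exp (- 1 / 2) ^ N"
proof -
  have "exp (- 1 / 2 :: real) ^ N = exp (- (real N / 2))"
    by (simp flip: exp_of_nat_mult)
  moreover have "(\<Sum>(r, s)\<in>Idx_eq N. 2 * exp (- (real (r + s) / 2)))
      = (\<Sum>p\<in>Idx_eq N. 2 * exp (- (real N / 2)))"
    by (intro sum.cong) (auto simp: Idx_eq_def)
  ultimately show ?thesis by (simp add: card_Idx_eq algebra_simps)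
qed

text \<open>Grouped by shells, the series is the termwise derivative of a geometric series.\<close>

lemma expsum_convergent: "convergent expsum"
proof -
  have "(\<lambda>n. of_nat (Suc n) * exp (- 1 / 2 :: real) ^ n) sums (1 / (1 - exp (- 1 / 2))\<^sup>2)"
    by (rule geometric_deriv_sums) simp
  then have "summable (\<lambda>k. real (Suc k) * exp (- 1 / 2 :: real) ^ k)"
    by (rule sums_summable)
  then have "summable (\<lambda>k. real (Suc (Suc k)) * exp (- 1 / 2 :: real) ^ Suc k)"
    by (rule summable_Suc_iff[THEN iffD2])
  then have "summable (\<lambda>k. 2 * (real (Suc (Suc k)) * exp (- 1 / 2 :: real) ^ Suc k))"
    by (rule summable_mult)
  moreover have "expsum = (\<lambda>N. \<Sum>k<N. 2 * (real (Suc (Suc k)) * exp (- 1 / 2 :: real) ^ Suc k))"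
  proof
    fix N show "expsum N = (\<Sum>k<N. 2 * (real (Suc (Suc k)) * exp (- 1 / 2 :: real) ^ Suc k))"
    proof (induction N)
      case (Suc N)
      have "expsum (Suc N) = expsum N + 2 * real (Suc (Suc N)) * exp (- 1 / 2) ^ Suc N"
        unfolding expsum_def sum_Idx_le_Suc exp_shell ..
      then show ?case using Suc by simp
    qed (simp add: expsum_def)
  qed
  ultimately show ?thesis by (metis summable_iff_convergent)
qed

lemma msum_le: "t \<in> time_dom T \<Longrightarrow> msum N t \<le> M"
  unfolding msum_def using Idx_le_subset by (intro mass_le) auto

text \<open>Mass conservation up to \<open>drift\<close> makes the mass tails, hence the entropy tails,
  uniformly small in time; for \<open>\<alpha> = 0\<close> the moment bound alone would not suffice.\<close>

lemma ent_uniform_limit: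
  assumes t: "t \<in> time_dom T"
  shows "uniform_limit {0..t} (\<lambda>k \<tau>. ent (Suc k) \<tau>) (\<lambda>\<tau>. entropy Q (c \<tau>)) sequentially"
proof -
  have z: "0 \<in> time_dom T" using t in_time_dom[OF t, of 0] by (simp add: time_dom_def)
  have "incseq (\<lambda>N. msum N 0)"
    unfolding incseq_def msum_def using Idx_le_mono
    by (auto intro!: sum_mono2 c_nonneg[OF z] mult_nonneg_nonneg dest: Idx_le_imp_Idx)
  then obtain m where m: "(\<lambda>N. msum N 0) \<longlonglongrightarrow> m"
    using incseq_convergent[of _ M] msum_le[OF z] by blast
  obtain e where e: "expsum \<longlonglongrightarrow> e"
    using expsum_convergent by (auto simp: convergent_def)
  \<comment> \<open>The limit for R -> infinity of the bound in \<open>le\<close> below, where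
    \<open>m\<close> and \<open>e\<close> are the limits of the truncated initial masses and of
    \<open>expsum\<close>.\<close>
  define B where "B = (\<lambda>k. (K + M + 2) * (m - msum (Suc k) 0 + drift t k) + (e - expsum (Suc k)))"
  show ?thesis
  proof (rule uniform_limit_real_bound)
    have "B \<longlonglongrightarrow> (K + M + 2) * (m - m + 0) + (e - e)"
      unfolding B_def by (intro tendsto_intros LIMSEQ_Suc m e drift_lim[OF t])
    then show "B \<longlonglongrightarrow> 0" by simp
    fix k \<tau> assume \<tau>: "\<tau> \<in> {0..t}"
    then have \<tau>': "\<tau> \<in> time_dom T" using in_time_dom[OF t] by auto
    have le: "\<bar>ent (Suc k) \<tau> - ent (Suc R) \<tau>\<bar> \<le> (K + M + 2) * (msum (Suc R) 0 + drift t R - msum (Suc k) 0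
        + drift t k) + (expsum (Suc R) - expsum (Suc k))" if "k \<le> R" for R
    proof -
      have diff: "sum f (Idx_le (Suc R)) - sum f (Idx_le (Suc k)) = sum f (Idx_le (Suc R) - Idx_le (Suc k))"
        for f :: "nat \<times> nat \<Rightarrow> real"
        using that by (intro sum_diff[symmetric] Idx_le_mono) auto
      have "\<bar>ent (Suc k) \<tau> - ent (Suc R) \<tau>\<bar> = \<bar>ent (Suc R) \<tau> - ent (Suc k) \<tau>\<bar>"
        by (rule abs_minus_commute)
      also have "\<dots> \<le> (\<Sum>(r, s)\<in>Idx_le (Suc R) - Idx_le (Suc k).
          (K + M + 2) * (real (r + s) * c \<tau> r s) + 2 * exp (- (real (r + s) / 2)))"
        unfolding ent_def diff
        by (rule sum_abs[THEN order_trans], rule sum_mono) (use ent_term_le[OF \<tau>'] Idx_le_imp_Idx in auto)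
      also have "\<dots> = (K + M + 2) * (msum (Suc R) \<tau> - msum (Suc k) \<tau>) + (expsum (Suc R) - expsum (Suc k))"
        unfolding msum_def expsum_def diff by (simp only: split_def sum.distrib sum_distrib_left)
      also have "\<dots> \<le> (K + M + 2) * (msum (Suc R) 0 + drift t R - msum (Suc k) 0 + drift t k)
          + (expsum (Suc R) - expsum (Suc k))"
        using msum_drift[OF t \<tau>, of R] msum_drift[OF t \<tau>, of k] const_ge
        by (intro add_right_mono mult_left_mono) auto
      finally show ?thesis .
    qed
    have "(\<lambda>R. (K + M + 2) * (msum (Suc R) 0 + drift t R - msum (Suc k) 0
        + drift t k) + (expsum (Suc R) - expsum (Suc k)))
        \<longlonglongrightarrow> (K + M + 2) * (m + 0 - msum (Suc k) 0 + drift t k) + (e - expsum (Suc k))"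
      by (intro tendsto_intros LIMSEQ_Suc m e drift_lim[OF t])
    moreover have "(\<lambda>R. \<bar>ent (Suc k) \<tau> - ent (Suc R) \<tau>\<bar>) \<longlonglongrightarrow> \<bar>ent (Suc k) \<tau> - entropy Q (c \<tau>)\<bar>"
      by (intro tendsto_intros LIMSEQ_Suc ent_lim[OF \<tau>'])
    ultimately show "\<bar>ent (Suc k) \<tau> - entropy Q (c \<tau>)\<bar> \<le> B k"
      unfolding B_def using le by (intro LIMSEQ_le) auto
  qed
qed

text \<open>Only x = 0 needs an argument: the substitution x = 1 / y turns x ln x into - (ln y / y),
  which tends to 0.\<close>

lemma x_ln_x_div_cont:
  assumes "0 < q"
  shows "continuous_on {0..} (\<lambda>x::real. x * (ln (x / q) - 1))"
proof -
  have "continuous (at x within {0..}) (\<lambda>x. x * ln x)" if "0 \<le> x" for x :: real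
  proof (cases "x = 0")
    case True
    have "\<forall>\<^sub>F x::real in at_top. - (ln x / x) = inverse x * ln (inverse x)"
      using eventually_gt_at_top[of 0] by eventually_elim (simp add: ln_inverse divide_inverse mult.commute)
    then have "((\<lambda>x::real. inverse x * ln (inverse x)) \<longlongrightarrow> - 0) at_top"
      by (rule Lim_transform_eventually[rotated]) (intro tendsto_minus ln_x_over_x_tendsto_0)
    then have "((\<lambda>x::real. x * ln x) \<longlongrightarrow> 0) (at_right 0)"
      by (simp add: filterlim_at_right_to_top)
    then show ?thesis using True by (simp add: continuous_within at_within_Ici_at_right)
  next
    case False
    then show ?thesis using that by (auto intro!: continuous_intros)
  qed
  then have 1: "continuous_on {0..} (\<lambda>x::real. x * ln x)"
    by (simp add: continuous_on_eq_continuous_within)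
  have "continuous_on {0..} (\<lambda>x::real. x * ln x - x * (ln q + 1))"
    by (intro continuous_intros 1)
  moreover have "x * (ln (x / q) - 1) = x * ln x - x * (ln q + 1)" if "0 \<le> x" for x :: real
    using that assms by (cases "x = 0") (auto simp: ln_div algebra_simps)
  ultimately show ?thesis
    using continuous_on_cong[of "{0..}" "{0..}" "\<lambda>x. x * (ln (x / q) - 1)" "\<lambda>x. x * ln x - x * (ln q + 1)"]
    by simp
qed

lemma ent_cont:
  assumes t: "t \<in> time_dom T"
  shows "continuous_on {0..t} (ent N)"
  unfolding ent_def split_def
proof (intro continuous_on_sum)
  fix p assume "p \<in> Idx_le N"
  then have I: "(fst p, snd p) \<in> Idx" using Idx_le_imp_Idx[of "fst p" "snd p"] by simp
  have "continuous_on {0..t} ((\<lambda>x. x * (ln (x / Q (fst p) (snd p)) - 1)) \<circ> (\<lambda>t. c t (fst p) (snd p)))"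
    by (rule continuous_on_compose[OF c_cont_Icc[OF t order_refl I]],
        rule continuous_on_subset[OF x_ln_x_div_cont])
       (use pos(5)[OF I] in \<open>auto intro!: c_nonneg[OF _ I] in_time_dom[OF t]\<close>)
  then show "continuous_on {0..t} (\<lambda>t. c t (fst p) (snd p) * (ln (c t (fst p) (snd p) / Q (fst p) (snd p)) - 1))"
    by (simp add: o_def)
qed

lemma entropy_cont:
  assumes t: "t \<in> time_dom T"
  shows "continuous_on {0..t} (\<lambda>\<tau>. entropy Q (c \<tau>))"
  by (rule uniform_limit_theorem[OF _ ent_uniform_limit[OF t]]) (auto intro: ent_cont[OF t] always_eventually)

end

section \<open>The truncated entropy rate\<close>

text \<open>A * x - B * y is a flux between sizes n and n + 1, \<open>P\<close> stands for C * n
  powr \<alpha>, and \<open>l\<close>, \<open>l'\<close> are the logarithms at its two ends. The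
  product of a density with its own logarithm is controlled in absolute value, the mixed products y
  * l and x * l' only from above; this fixes the sign in each conclusion. The 2 in \<open>yl\<close>
  and \<open>l'\<close> reflects n + 1 <= 2 * n.\<close>

lemma flux_ln_le:
  fixes A B P M x y l l' \<kappa> n e :: real
  assumes A: "0 \<le> A" "A \<le> P * M" and B: "0 \<le> B" "B \<le> P" and M: "1 \<le> M" and P: "0 \<le> P"
    and xy: "0 \<le> x" "0 \<le> y" and n: "0 \<le> \<kappa> * n"
    and xl: "\<bar>x * l\<bar> \<le> \<kappa> * n * x + e" and yl: "\<bar>y * l'\<bar> \<le> 2 * (\<kappa> * n) * y + e"
    and l: "l \<le> \<kappa> * n" and l': "l' \<le> 2 * (\<kappa> * n)" and e: "0 \<le> e"
  shows "- (l * (A * x - B * y)) \<le> P * M * (2 * (\<kappa> * n) * (x + y) + e)"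
    and "(A * x - B * y) * l' \<le> P * M * (2 * (\<kappa> * n) * (x + y) + e)"
proof -
  have PM: "0 \<le> P * M" "B \<le> P * M"
    using P M B mult_left_mono[of 1 M P] by auto
  have kx: "0 \<le> \<kappa> * n * x" "0 \<le> \<kappa> * n * y" using n xy by auto
  have "- (l * (A * x - B * y)) = A * - (x * l) + B * (y * l)" by (simp add: algebra_simps)
  also have "\<dots> \<le> A * (\<kappa> * n * x + e) + B * (y * (\<kappa> * n))"
    using A B xl l xy by (intro add_mono mult_left_mono) (auto simp: abs_le_iff)
  also have "\<dots> \<le> P * M * (\<kappa> * n * x + e) + P * M * (y * (\<kappa> * n))"
    using A PM kx e xy n by (intro add_mono mult_right_mono) auto
  also have "\<dots> = P * M * (\<kappa> * n * x + e + \<kappa> * n * y)" by (simp add: algebra_simps)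
  also have "\<dots> \<le> P * M * (2 * (\<kappa> * n) * (x + y) + e)"
    using PM kx by (intro mult_left_mono) (auto simp: algebra_simps)
  finally show "- (l * (A * x - B * y)) \<le> P * M * (2 * (\<kappa> * n) * (x + y) + e)" .
  have "(A * x - B * y) * l' = A * (x * l') + B * - (y * l')" by (simp add: algebra_simps)
  also have "\<dots> \<le> A * (x * (2 * (\<kappa> * n))) + B * (2 * (\<kappa> * n) * y + e)"
    using A B yl l' xy by (intro add_mono mult_left_mono) (auto simp: abs_le_iff)
  also have "\<dots> \<le> P * M * (x * (2 * (\<kappa> * n))) + P * M * (2 * (\<kappa> * n) * y + e)"
    using A PM kx e xy n by (intro add_mono mult_right_mono) auto
  also have "\<dots> = P * M * (2 * (\<kappa> * n) * (x + y) + e)" by (simp add: algebra_simps)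
  finally show "(A * x - B * y) * l' \<le> P * M * (2 * (\<kappa> * n) * (x + y) + e)" .
qed

context bd_trajectory_moment
begin

abbreviation "lr t r s \<equiv> ln (c t r s / Q r s)"
abbreviation "dt t r s \<equiv> dissipation_term a ad b bd Q (c t) r s"

definition "diss N t = (\<Sum>(r, s)\<in>Idx_le N. dt t r s)"

lemma c_gt_0: "t \<in> time_dom T \<Longrightarrow> 0 < t \<Longrightarrow> (r, s) \<in> Idx \<Longrightarrow> 0 < c t r s"
  using mass_r mass_s c_pos by blast

text \<open>The - 1 in the entropy makes the derivative of its summand exactly the logarithm of c /
  Q.\<close>

lemma ent_deriv:
  assumes t: "t \<in> time_dom T" "0 < t"
  shows "(ent N has_real_derivative (\<Sum>(r, s)\<in>Idx_le N. lr t r s * - loss t r s)) (at t)"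
  unfolding ent_def[abs_def] split_def
proof (intro DERIV_sum)
  fix p assume "p \<in> Idx_le N"
  then have I: "(fst p, snd p) \<in> Idx" using Idx_le_imp_Idx[of "fst p" "snd p"] by simp
  show "((\<lambda>t. c t (fst p) (snd p) * (ln (c t (fst p) (snd p) / Q (fst p) (snd p)) - 1))
      has_real_derivative lr t (fst p) (snd p) * - loss t (fst p) (snd p)) (at t)"
    using c_gt_0[OF t I] pos(5)[OF I]
    by (auto intro!: derivative_eq_intros c_deriv[OF t I] simp: field_simps)
qed

text \<open>The weight in \<open>sum_loss\<close> is the logarithm of c / Q. As \<open>Q\<close> is
  1 at the monomers, their equations supply the monomer logarithms of the dissipation, up to the
  flux tails \<open>F\<close> and \<open>Fd\<close>. The second form moves the dissipation of shell
  k + 1 out of the boundary term, which replaces each logarithm there by that of its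
  neighbour.\<close>

lemma ent_rate:
  defines "F k t \<equiv> flux t - (\<Sum>(r, s)\<in>Idx_le k. Jt t r s)"
    and "Fd k t \<equiv> fluxd t - (\<Sum>(r, s)\<in>Idx_le k. Jdt t r s)"
  shows "(\<Sum>(r, s)\<in>Idx_le (Suc k). lr t r s * - loss t r s) =
      - diss k t - (\<Sum>(r, s)\<in>Idx_eq (Suc k). lr t r s * Jt t r s + lr t r s * Jdt t r s)
      - ln (c t 1 0) * F k t - ln (c t 0 1) * Fd k t" (is "?L = ?R")
    and "(\<Sum>(r, s)\<in>Idx_le (Suc k). lr t r s * - loss t r s) =
      - diss (Suc k) t - (\<Sum>(r, s)\<in>Idx_eq (Suc k). Jt t r s * lr t (r + 1) s + Jdt t r s * lr t r (s + 1))
      - ln (c t 1 0) * F (Suc k) t - ln (c t 0 1) * Fd (Suc k) t"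
proof -
  have Q1: "Q 1 0 = 1" "Q 0 1 = 1" using balance by (auto simp: detailed_balance_def)
  have dt: "dt t r s = - ((lr t (r + 1) s - lr t r s) * Jt t r s + (lr t r (s + 1) - lr t r s) * Jdt t r s)
      + ln (c t 1 0) * Jt t r s + ln (c t 0 1) * Jdt t r s" for r s
    by (simp add: dissipation_term_def algebra_simps)
  have d: "diss k t = - (\<Sum>(r, s)\<in>Idx_le k. (lr t (r + 1) s - lr t r s) * Jt t r s
        + (lr t r (s + 1) - lr t r s) * Jdt t r s)
      + ln (c t 1 0) * (\<Sum>(r, s)\<in>Idx_le k. Jt t r s) + ln (c t 0 1) * (\<Sum>(r, s)\<in>Idx_le k. Jdt t r s)"
    unfolding diss_def dt by (simp only: split_def sum.distrib sum_negf sum_distrib_left)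
  show 1: "?L = ?R"
    unfolding sum_loss d F_def Fd_def Q1 by (simp add: algebra_simps)
  have e: "(\<Sum>(r, s)\<in>Idx_eq (Suc k). dt t r s) =
      (\<Sum>(r, s)\<in>Idx_eq (Suc k). lr t r s * Jt t r s + lr t r s * Jdt t r s)
      - (\<Sum>(r, s)\<in>Idx_eq (Suc k). Jt t r s * lr t (r + 1) s + Jdt t r s * lr t r (s + 1))
      + ln (c t 1 0) * (\<Sum>(r, s)\<in>Idx_eq (Suc k). Jt t r s)
      + ln (c t 0 1) * (\<Sum>(r, s)\<in>Idx_eq (Suc k). Jdt t r s)"
    unfolding dt sum_distrib_left sum_subtractf[symmetric] sum.distrib[symmetric]
    by (intro sum.cong) (auto simp: algebra_simps)
  have D: "diss (Suc k) t = diss k t + (\<Sum>(r, s)\<in>Idx_eq (Suc k). dt t r s)"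
    by (simp add: diss_def sum_Idx_le_Suc)
  have FS: "F (Suc k) t = F k t - (\<Sum>(r, s)\<in>Idx_eq (Suc k). Jt t r s)"
    "Fd (Suc k) t = Fd k t - (\<Sum>(r, s)\<in>Idx_eq (Suc k). Jdt t r s)"
    by (simp_all add: F_def Fd_def sum_Idx_le_Suc)
  show "?L = - diss (Suc k) t
      - (\<Sum>(r, s)\<in>Idx_eq (Suc k). Jt t r s * lr t (r + 1) s + Jdt t r s * lr t r (s + 1))
      - ln (c t 1 0) * F (Suc k) t - ln (c t 0 1) * Fd (Suc k) t"
    unfolding 1 D FS e by (simp add: algebra_simps)
qed

lemma lr_le:
  assumes t: "t \<in> time_dom T" "0 < t" and rs: "(r, s) \<in> Idx"
  shows "lr t r s \<le> (K + M + 1) * real (r + s)"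
proof -
  have n: "1 \<le> real (r + s)" using rs by (auto simp: Idx_def)
  have "lr t r s = ln (c t r s) - ln (Q r s)"
    using c_gt_0[OF t rs] pos(5)[OF rs] by (simp add: ln_div)
  also have "\<dots> \<le> M + K * real (r + s)"
    using ln_le_self[of "c t r s"] c_nonneg[OF t(1) rs] c_le[OF t(1) rs] lnQ_le[OF rs] by linarith
  also have "M + K * real (r + s) \<le> (K + M + 1) * real (r + s)"
    using mult_left_mono[OF n, of "M + 1"] const_ge by (simp add: algebra_simps)
  finally show ?thesis .
qed

lemma flux_ln_bound:
  assumes t: "t \<in> time_dom T" "0 < t" and rs: "(r, s) \<in> Idx" and N: "r + s = N"
  defines "\<epsilon> x y \<equiv> C * real N powr \<alpha> * M
     * (2 * ((K + M + 1) * real N) * (x + y) + 2 * exp (- (real N / 2)))"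
  shows "- (lr t r s * Jt t r s) \<le> \<epsilon> (c t r s) (c t (r + 1) s)"
    and "Jt t r s * lr t (r + 1) s \<le> \<epsilon> (c t r s) (c t (r + 1) s)"
    and "- (lr t r s * Jdt t r s) \<le> \<epsilon> (c t r s) (c t r (s + 1))"
    and "Jdt t r s * lr t r (s + 1) \<le> \<epsilon> (c t r s) (c t r (s + 1))"
proof -
  define \<kappa> where "\<kappa> = K + M + 1"
  have k: "0 \<le> \<kappa>" using const_ge by (simp add: \<kappa>_def)
  have N1: "1 \<le> N" using rs N by (auto simp: Idx_def)
  have x: "\<bar>c t r s * lr t r s\<bar> \<le> \<kappa> * real N * c t r s + 2 * exp (- (real N / 2))"
    using c_ln_c_le[OF t(1) rs] N by (simp add: \<kappa>_def mult.assoc)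
  have y: "\<bar>c t r' s' * lr t r' s'\<bar> \<le> 2 * (\<kappa> * real N) * c t r' s' + 2 * exp (- (real N / 2))"
    and ly: "lr t r' s' \<le> 2 * (\<kappa> * real N)" if rs': "(r', s') \<in> Idx" and N': "r' + s' = Suc N" for r' s'
  proof -
    have s2: "\<kappa> * real (Suc N) \<le> 2 * (\<kappa> * real N)"
      using N1 mult_left_mono[OF _ k, of 1 "real N"] by (simp add: algebra_simps)
    have "\<bar>c t r' s' * lr t r' s'\<bar> \<le> \<kappa> * real (Suc N) * c t r' s' + 2 * exp (- (real (Suc N) / 2))"
      using c_ln_c_le[OF t(1) rs'] N' by (simp only: \<kappa>_def mult.assoc)
    also have "\<dots> \<le> 2 * (\<kappa> * real N) * c t r' s' + 2 * exp (- (real N / 2))"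
      using s2 c_nonneg[OF t(1) rs'] by (intro add_mono mult_right_mono mult_left_mono) auto
    finally show "\<bar>c t r' s' * lr t r' s'\<bar> \<le> 2 * (\<kappa> * real N) * c t r' s' + 2 * exp (- (real N / 2))" .
    have "lr t r' s' \<le> \<kappa> * real (Suc N)"
      using lr_le[OF t rs'] N' by (simp only: \<kappa>_def)
    with s2 show "lr t r' s' \<le> 2 * (\<kappa> * real N)" by linarith
  qed
  have l: "lr t r s \<le> \<kappa> * real N" using lr_le[OF t rs] N by (simp add: \<kappa>_def)
  have c1: "0 \<le> c t 1 0" "c t 1 0 \<le> M" "0 \<le> c t 0 1" "c t 0 1 \<le> M"
    using t by (auto intro: c_nonneg c_le)
  have co: "a r s \<le> C * real N powr \<alpha>" "ad r s \<le> C * real N powr \<alpha>"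
      "b (r + 1) s \<le> C * real N powr \<alpha>" "bd r (s + 1) \<le> C * real N powr \<alpha>"
    using coeff_le[OF rs] N by auto
  note p = pos[OF rs, THEN less_imp_le]
  have A: "a r s * c t 1 0 \<le> C * real N powr \<alpha> * M" "ad r s * c t 0 1 \<le> C * real N powr \<alpha> * M"
    using co c1 p const_ge by (auto intro!: mult_mono)
  have I: "(r + 1, s) \<in> Idx" "(r, s + 1) \<in> Idx" "r + 1 + s = Suc N" "r + (s + 1) = Suc N"
    using N by auto
  show "- (lr t r s * Jt t r s) \<le> \<epsilon> (c t r s) (c t (r + 1) s)"
    and "Jt t r s * lr t (r + 1) s \<le> \<epsilon> (c t r s) (c t (r + 1) s)"
    unfolding \<epsilon>_def J_def \<kappa>_def[symmetric]
    by (rule flux_ln_le[OF _ A(1) p(3) co(3) _ _ _ _ _ x y[OF I(1,3)] l ly[OF I(1,3)]];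
        use c1 p const_ge k t rs in \<open>auto intro: c_nonneg\<close>)+
  show "- (lr t r s * Jdt t r s) \<le> \<epsilon> (c t r s) (c t r (s + 1))"
    and "Jdt t r s * lr t r (s + 1) \<le> \<epsilon> (c t r s) (c t r (s + 1))"
    unfolding \<epsilon>_def Jd_def \<kappa>_def[symmetric]
    by (rule flux_ln_le[OF _ A(2) p(4) co(4) _ _ _ _ _ x y[OF I(2,4)] l ly[OF I(2,4)]];
        use c1 p const_ge k t rs in \<open>auto intro: c_nonneg\<close>)+
qed

text \<open>Exponential error of shell k + 1: coefficient growth, the number k + 2 of its indices,
  and the decay exp (- (n / 2)) at n = k + 1.\<close>

definition "expo k = real (Suc k) powr \<alpha> * (real (Suc (Suc k)) * exp (- 1 / 2) ^ Suc k)"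

text \<open>Writing exp (- 1 / 2) as the square of exp (- 1 / 4) gives each of the two linear
  factors its own exponential.\<close>

lemma expo_lim: "expo \<longlonglongrightarrow> 0"
proof -
  define y :: real where "y = exp (- 1 / 4)"
  have y2: "exp (- 1 / 2) = y * y" by (simp add: y_def flip: exp_add)
  have "(\<lambda>n. real n * y ^ n) \<longlonglongrightarrow> 0"
    by (rule powser_times_n_limit_0) (simp add: y_def)
  then have "(\<lambda>n. 2 * ((real (Suc n) * y ^ Suc n) * (real (Suc n) * y ^ Suc n))) \<longlonglongrightarrow> 2 * (0 * 0)"
    by (intro tendsto_intros LIMSEQ_Suc)
  then have lim: "(\<lambda>n. 2 * ((real (Suc n) * y ^ Suc n) * (real (Suc n) * y ^ Suc n))) \<longlonglongrightarrow> 0"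
    by (simp only: mult_zero_right)
  have "norm (expo n) \<le> 2 * ((real (Suc n) * y ^ Suc n) * (real (Suc n) * y ^ Suc n))" for n
  proof -
    have "real (Suc n) powr \<alpha> \<le> real (Suc n) powr 1"
      using alpha by (intro powr_mono) auto
    then have "expo n \<le> real (Suc n) * (2 * real (Suc n) * (y * y) ^ Suc n)"
      unfolding expo_def y2 by (intro mult_mono) (auto simp: y_def)
    also have "\<dots> = 2 * ((real (Suc n) * y ^ Suc n) * (real (Suc n) * y ^ Suc n))"
      by (simp only: power_mult_distrib mult_ac)
    finally show ?thesis
      by (simp add: expo_def)
  qed
  then show ?thesis
    by (intro Lim_null_comparison[OF always_eventually lim]) blast
qed

text \<open>Collects the moment shells, the exponential remainder of x ln x, and the flux tails
  multiplied by the two monomer logarithms, which \<open>\<Lambda>\<close> is to bound.\<close>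

definition "err \<Lambda> k t = 4 * C * M * (K + M + 1) * (wshell (Suc k) t + wshell (Suc (Suc k)) t)
   + 4 * C * M * expo k + 2 * \<Lambda> * tail_bound k"

text \<open>Summed over the shell, the densities become two adjacent shell sums by
  \<open>shell_shift\<close>, while the constant remainder is multiplied by the number of
  indices.\<close>

lemma flux_ln_shell:
  assumes t: "t \<in> time_dom T"
  defines "\<epsilon> N x y \<equiv> C * real N powr \<alpha> * M
     * (2 * ((K + M + 1) * real N) * (x + y) + 2 * exp (- (real N / 2)))"
  shows "(\<Sum>(r, s)\<in>Idx_eq (Suc k). \<epsilon> (Suc k) (c t r s) (c t (r + 1) s) + \<epsilon> (Suc k) (c t r s) (c t r (s + 1)))
    \<le> 4 * C * M * (K + M + 1) * (wshell (Suc k) t + wshell (Suc (Suc k)) t) + 4 * C * M * expo k"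
proof -
  define N where "N = Suc k"
  define z where "z = C * M * (real N powr \<alpha> * real N) * (2 * (K + M + 1))"
  have z: "0 \<le> z" using const_ge by (simp add: z_def)
  have e: "\<epsilon> N x y = z * (x + y) + C * M * real N powr \<alpha> * (2 * exp (- (real N / 2)))" for x y
    by (simp add: \<epsilon>_def z_def algebra_simps)
  have "(\<Sum>(r, s)\<in>Idx_eq N. \<epsilon> N (c t r s) (c t (r + 1) s) + \<epsilon> N (c t r s) (c t r (s + 1)))
     = z * (\<Sum>(r, s)\<in>Idx_eq N. c t r s + c t (r + 1) s) + z * (\<Sum>(r, s)\<in>Idx_eq N. c t r s + c t r (s + 1))
       + real (card (Idx_eq N)) * (2 * (C * M * real N powr \<alpha> * (2 * exp (- (real N / 2)))))"
    unfolding e split_def by (simp add: sum.distrib sum_distrib_left[symmetric] algebra_simps)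
  also have "\<dots> \<le> z * (shell N t + shell (Suc N) t) + z * (shell N t + shell (Suc N) t)
       + real (card (Idx_eq N)) * (2 * (C * M * real N powr \<alpha> * (2 * exp (- (real N / 2)))))"
    unfolding N_def using shell_shift[OF t] z by (intro add_right_mono add_mono mult_left_mono) auto
  also have "exp (- (real N / 2)) = exp (- 1 / 2 :: real) ^ N"
    by (simp flip: exp_of_nat_mult)
  also have "z * (shell N t + shell (Suc N) t) + z * (shell N t + shell (Suc N) t)
      + real (card (Idx_eq N)) * (2 * (C * M * real N powr \<alpha> * (2 * exp (- 1 / 2 :: real) ^ N)))
     = 4 * C * M * (K + M + 1) * (real N powr (1 + \<alpha>) * shell N t + real N powr (1 + \<alpha>) * shell (Suc N) t)
       + 4 * C * M * expo k"
    unfolding N_def expo_def z_def card_Idx_eq by (simp add: powr_add algebra_simps)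
  also have "\<dots> \<le> 4 * C * M * (K + M + 1) * (wshell N t + wshell (Suc N) t) + 4 * C * M * expo k"
    unfolding wshell_def using const_ge alpha
    by (intro add_right_mono mult_left_mono add_left_mono mult_right_mono powr_mono2 shell_nonneg t) auto
  finally show ?thesis unfolding N_def .
qed

lemma tail_bound_Suc: "tail_bound (Suc k) \<le> tail_bound k"
  unfolding tail_bound_def using const_ge alpha by (intro mult_left_mono powr_mono2') auto

text \<open>The entropy rate is split at the boundary shell in two ways: the boundary term carries
  \<open>ln (c r s / Q r s)\<close> or its neighbour's value, and each choice controls only one sign of the
  term where the logarithm is very negative.\<close>

lemma ent_rate_bounds:
  assumes t: "t \<in> time_dom T" "0 < t" and \<Lambda>: "\<bar>ln (c t 1 0)\<bar> \<le> \<Lambda>" "\<bar>ln (c t 0 1)\<bar> \<le> \<Lambda>"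
  shows "(\<Sum>(r, s)\<in>Idx_le (Suc k). lr t r s * - loss t r s) \<le> err \<Lambda> k t - diss k t"
    and "- (\<Sum>(r, s)\<in>Idx_le (Suc k). lr t r s * - loss t r s) \<le> err \<Lambda> k t + diss (Suc k) t"
proof -
  define F where "F = (\<lambda>k. flux t - (\<Sum>(r, s)\<in>Idx_le k. Jt t r s))"
  define Fd where "Fd = (\<lambda>k. fluxd t - (\<Sum>(r, s)\<in>Idx_le k. Jdt t r s))"
  define U where "U = (\<Sum>(r, s)\<in>Idx_eq (Suc k). lr t r s * Jt t r s + lr t r s * Jdt t r s)"
  define W where "W = (\<Sum>(r, s)\<in>Idx_eq (Suc k). Jt t r s * lr t (r + 1) s + Jdt t r s * lr t r (s + 1))"
  have log: "\<bar>ln (c t 1 0) * F m\<bar> \<le> \<Lambda> * tail_bound k" "\<bar>ln (c t 0 1) * Fd m\<bar> \<le> \<Lambda> * tail_bound k"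
    if "m = k \<or> m = Suc k" for m
  proof -
    have "tail_bound m \<le> tail_bound k" using that tail_bound_Suc by auto
    then have "\<bar>F m\<bar> \<le> tail_bound k" "\<bar>Fd m\<bar> \<le> tail_bound k"
      using flux_tail[OF t(1), of m] by (auto simp: F_def Fd_def)
    then show "\<bar>ln (c t 1 0) * F m\<bar> \<le> \<Lambda> * tail_bound k" "\<bar>ln (c t 0 1) * Fd m\<bar> \<le> \<Lambda> * tail_bound k"
      using \<Lambda> unfolding abs_mult by (auto intro!: mult_mono)
  qed
  define B where "B = 4 * C * M * (K + M + 1) * (wshell (Suc k) t + wshell (Suc (Suc k)) t)
    + 4 * C * M * expo k"
  have err: "err \<Lambda> k t = B + 2 * (\<Lambda> * tail_bound k)"
    by (simp add: err_def B_def)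
  note shell = flux_ln_shell[OF t(1), of k, folded B_def]
  have bU: "- U \<le> B"
  proof (rule order_trans[OF _ shell])
    show "- U \<le> (\<Sum>(r, s)\<in>Idx_eq (Suc k).
      C * real (Suc k) powr \<alpha> * M * (2 * ((K + M + 1) * real (Suc k)) * (c t r s + c t (r + 1) s)
        + 2 * exp (- (real (Suc k) / 2)))
      + C * real (Suc k) powr \<alpha> * M * (2 * ((K + M + 1) * real (Suc k)) * (c t r s + c t r (s + 1))
        + 2 * exp (- (real (Suc k) / 2))))"
      unfolding U_def sum_negf[symmetric]
    proof (rule sum_mono, clarify)
      fix r s assume rs: "(r, s) \<in> Idx_eq (Suc k)"
      then have N: "r + s = Suc k" by (simp add: Idx_eq_def)
      show "- (lr t r s * Jt t r s + lr t r s * Jdt t r s) \<le>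
        C * real (Suc k) powr \<alpha> * M * (2 * ((K + M + 1) * real (Suc k)) * (c t r s + c t (r + 1) s)
        + 2 * exp (- (real (Suc k) / 2)))
      + C * real (Suc k) powr \<alpha> * M * (2 * ((K + M + 1) * real (Suc k)) * (c t r s + c t r (s + 1))
        + 2 * exp (- (real (Suc k) / 2)))"
        using flux_ln_bound(1,3)[OF t Idx_eq_Suc_imp_Idx[OF rs] N] by linarith
    qed
  qed
  have bW: "W \<le> B"
  proof (rule order_trans[OF _ shell])
    show "W \<le> (\<Sum>(r, s)\<in>Idx_eq (Suc k).
      C * real (Suc k) powr \<alpha> * M * (2 * ((K + M + 1) * real (Suc k)) * (c t r s + c t (r + 1) s)
        + 2 * exp (- (real (Suc k) / 2)))
      + C * real (Suc k) powr \<alpha> * M * (2 * ((K + M + 1) * real (Suc k)) * (c t r s + c t r (s + 1))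
        + 2 * exp (- (real (Suc k) / 2))))"
      unfolding W_def
    proof (rule sum_mono, clarify)
      fix r s assume rs: "(r, s) \<in> Idx_eq (Suc k)"
      then have N: "r + s = Suc k" by (simp add: Idx_eq_def)
      show "Jt t r s * lr t (r + 1) s + Jdt t r s * lr t r (s + 1) \<le>
        C * real (Suc k) powr \<alpha> * M * (2 * ((K + M + 1) * real (Suc k)) * (c t r s + c t (r + 1) s)
        + 2 * exp (- (real (Suc k) / 2)))
      + C * real (Suc k) powr \<alpha> * M * (2 * ((K + M + 1) * real (Suc k)) * (c t r s + c t r (s + 1))
        + 2 * exp (- (real (Suc k) / 2)))"
        using flux_ln_bound(2,4)[OF t Idx_eq_Suc_imp_Idx[OF rs] N] by linarith
    qed
  qed
  have 1: "(\<Sum>(r, s)\<in>Idx_le (Suc k). lr t r s * - loss t r s)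
      = - diss k t - U - ln (c t 1 0) * F k - ln (c t 0 1) * Fd k"
    and 2: "(\<Sum>(r, s)\<in>Idx_le (Suc k). lr t r s * - loss t r s)
      = - diss (Suc k) t - W - ln (c t 1 0) * F (Suc k) - ln (c t 0 1) * Fd (Suc k)"
    unfolding U_def W_def F_def Fd_def by (rule ent_rate)+
  have "- (ln (c t 1 0) * F k) \<le> \<Lambda> * tail_bound k" "- (ln (c t 0 1) * Fd k) \<le> \<Lambda> * tail_bound k"
    "ln (c t 1 0) * F (Suc k) \<le> \<Lambda> * tail_bound k" "ln (c t 0 1) * Fd (Suc k) \<le> \<Lambda> * tail_bound k"
    using log[of k] log[of "Suc k"] by (simp_all add: abs_le_iff)
  note bounds = bU bW this
  show "(\<Sum>(r, s)\<in>Idx_le (Suc k). lr t r s * - loss t r s) \<le> err \<Lambda> k t - diss k t"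
    unfolding err 1 using bounds by linarith
  show "- (\<Sum>(r, s)\<in>Idx_le (Suc k). lr t r s * - loss t r s) \<le> err \<Lambda> k t + diss (Suc k) t"
    unfolding err 2 using bounds by linarith
qed

end

section \<open>The entropy identity\<close>

context bd_trajectory_moment
begin

abbreviation "V t \<equiv> entropy Q (c t)"
abbreviation "dis t \<equiv> dissipation a ad b bd Q (c t)"

lemma dt_nonneg: "t \<in> time_dom T \<Longrightarrow> 0 < t \<Longrightarrow> (r, s) \<in> Idx \<Longrightarrow> 0 \<le> dt t r s"
  by (rule dissipation_term_nonneg[OF balance]) (auto intro: c_gt_0)

lemma diss_nonneg: "t \<in> time_dom T \<Longrightarrow> 0 < t \<Longrightarrow> 0 \<le> diss N t"
  unfolding diss_def by (intro sum_nonneg) (auto intro: dt_nonneg dest: Idx_le_imp_Idx)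

lemma diss_mono: "t \<in> time_dom T \<Longrightarrow> 0 < t \<Longrightarrow> N \<le> N' \<Longrightarrow> diss N t \<le> diss N' t"
  unfolding diss_def using Idx_le_mono by (intro sum_mono2) (auto intro: dt_nonneg dest: Idx_le_imp_Idx)

lemma diss_lim:
  assumes t: "t \<in> time_dom T" "0 < t"
  shows "(\<lambda>N. ennreal (diss N t)) \<longlonglongrightarrow> dis t"
proof -
  have "(\<lambda>N. \<Sum>(r, s)\<in>Idx_le N. ennreal (dt t r s)) \<longlonglongrightarrow> dis t"
    unfolding dissipation_def
    by (rule has_sum_imp_Idx_le, rule has_sum_infsum, rule nonneg_summable_on_complete) auto
  moreover have "(\<Sum>(r, s)\<in>Idx_le N. ennreal (dt t r s)) = ennreal (diss N t)" for N
    unfolding diss_def split_def using Idx_le_imp_Idx[of _ _ N] dt_nonneg[OF t]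
    by (subst sum_ennreal) auto
  ultimately show ?thesis by simp
qed

lemma lr_cont:
  assumes t: "t \<in> time_dom T" "0 < u" and rs: "(r, s) \<in> Idx"
  shows "continuous_on {u..t} (\<lambda>t. lr t r s)" "continuous_on {u..t} (\<lambda>t. ln (c t r s))"
proof -
  have p: "0 < c \<tau> r s" if "\<tau> \<in> {u..t}" for \<tau>
    using that t in_time_dom[OF t(1)] by (intro c_gt_0 rs) auto
  have "continuous_on {u..t} (\<lambda>t. c t r s)"
    using t by (intro c_cont_Icc rs) auto
  then show "continuous_on {u..t} (\<lambda>t. lr t r s)" "continuous_on {u..t} (\<lambda>t. ln (c t r s))"
    using p pos(5)[OF rs] by (force intro!: continuous_intros)+
qed

lemma diss_cont:
  assumes t: "t \<in> time_dom T" "0 < u"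
  shows "continuous_on {u..t} (diss N)"
proof -
  have sub: "{u..t} \<subseteq> time_dom T" using t in_time_dom[OF t(1)] by auto
  have "continuous_on {u..t} (\<lambda>t. dt t r s)" if I: "(r, s) \<in> Idx" for r s
    unfolding dissipation_term_def
    by (intro continuous_on_minus continuous_on_add continuous_on_diff continuous_on_mult lr_cont[OF t]
        continuous_on_subset[OF J_cont[OF I] sub] continuous_on_subset[OF Jd_cont[OF I] sub])
       (use I in simp_all)
  then show ?thesis
    unfolding diss_def[abs_def] split_def
    by (intro continuous_on_sum) (use Idx_le_imp_Idx in auto)
qed

text \<open>The two bounds on the entropy rate enclose the integral of \<open>diss\<close> between
  entropy differences at neighbouring cutoffs, up to an error \<open>\<eta>\<close> that tends to
  0.\<close>

lemma diss_integral_lim: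
  assumes t: "t \<in> time_dom T" and u: "0 < u" "u \<le> t"
  shows "(\<lambda>N. integral {u..t} (diss N)) \<longlonglongrightarrow> V u - V t"
proof -
  have dom: "\<tau> \<in> time_dom T" if "\<tau> \<in> {u..t}" for \<tau> using that u in_time_dom[OF t] by auto
  \<comment> \<open>Here u > 0 enters: strict positivity on the compact interval {u..t} bounds the
    monomer logarithms.\<close>
  obtain \<Lambda>1 where L1: "\<And>\<tau>. \<tau> \<in> {u..t} \<Longrightarrow> \<bar>ln (c \<tau> 1 0)\<bar> \<le> \<Lambda>1"
    using compact_imp_bounded[OF compact_continuous_image[OF lr_cont(2)[OF t u(1), of 1 0]]]
    by (force simp: bounded_iff)
  obtain \<Lambda>2 where L2: "\<And>\<tau>. \<tau> \<in> {u..t} \<Longrightarrow> \<bar>ln (c \<tau> 0 1)\<bar> \<le> \<Lambda>2"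
    using compact_imp_bounded[OF compact_continuous_image[OF lr_cont(2)[OF t u(1), of 0 1]]]
    by (force simp: bounded_iff)
  define \<Lambda> where "\<Lambda> = max \<Lambda>1 \<Lambda>2"
  have L: "\<bar>ln (c \<tau> 1 0)\<bar> \<le> \<Lambda>" "\<bar>ln (c \<tau> 0 1)\<bar> \<le> \<Lambda>" if "\<tau> \<in> {u..t}" for \<tau>
    using L1[OF that] L2[OF that] by (auto simp: \<Lambda>_def)
  define \<eta> where "\<eta> = (\<lambda>k. integral {u..t} (err \<Lambda> k))"
  have ec: "continuous_on {u..t} (err \<Lambda> k)" for k
    unfolding err_def[abs_def] using u by (intro continuous_intros wshell_cont t) auto
  have entc: "continuous_on {u..t} (ent N)" for N
    by (rule continuous_on_subset[OF ent_cont[OF t]]) (use u in auto)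
  have dc: "continuous_on {u..t} (diss N)" for N by (rule diss_cont[OF t u(1)])
  have der: "(ent N has_real_derivative (\<Sum>(r, s)\<in>Idx_le N. lr \<tau> r s * - loss \<tau> r s)) (at \<tau>)"
    if "u < \<tau>" "\<tau> < t" for \<tau> N
    using that u by (intro ent_deriv dom) auto
  have up: "integral {u..t} (diss k) \<le> ent (Suc k) u - ent (Suc k) t + \<eta> k" for k
  proof -
    have "ent (Suc k) t - ent (Suc k) u \<le> integral {u..t} (\<lambda>\<tau>. err \<Lambda> k \<tau> - diss k \<tau>)"
      by (rule increment_le[OF u(2) entc _ der ent_rate_bounds(1)])
         (use u L dom in \<open>auto intro!: continuous_intros ec dc\<close>)
    also have "\<dots> = \<eta> k - integral {u..t} (diss k)"
      unfolding \<eta>_def by (intro integral_diff integrable_continuous_real ec dc)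
    finally show ?thesis by simp
  qed
  have low: "ent (Suc k) u - ent (Suc k) t - \<eta> k \<le> integral {u..t} (diss (Suc k))" for k
  proof -
    have "- ent (Suc k) t - - ent (Suc k) u \<le> integral {u..t} (\<lambda>\<tau>. err \<Lambda> k \<tau> + diss (Suc k) \<tau>)"
      by (rule increment_le[OF u(2) _ _ DERIV_minus[OF der] ent_rate_bounds(2)])
         (use u L dom in \<open>auto intro!: continuous_intros ec dc entc\<close>)
    also have "\<dots> = \<eta> k + integral {u..t} (diss (Suc k))"
      unfolding \<eta>_def by (intro integral_add integrable_continuous_real ec dc)
    finally show ?thesis by simp
  qed
  \<comment> \<open>As \<open>err\<close> is nonnegative, its integral over {u..t} is at most that
    over {0..t}, where \<open>wshell_integral_lim\<close> applies.\<close>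
  have \<eta>: "\<eta> \<longlonglongrightarrow> 0"
  proof (rule Lim_null_comparison[OF always_eventually])
    define \<beta> where "\<beta> = (\<lambda>k. 4 * C * M * (K + M + 1) *
        (integral {0..t} (wshell (Suc k)) + integral {0..t} (wshell (Suc (Suc k))))
        + (4 * C * M * expo k + 2 * \<Lambda> * tail_bound k) * t)"
    have w: "wshell (Suc k) integrable_on {0..t}" for k
      using wshell_cont[OF t] by (intro integrable_continuous_real) simp
    have "0 \<le> \<Lambda>" using L(1)[of t] u by auto
    then have e0: "0 \<le> err \<Lambda> k \<tau>" if "\<tau> \<in> time_dom T" for k \<tau>
      using wshell_nonneg[OF that] const_ge tail_bound_nonneg[of k]
      unfolding err_def expo_def by (auto intro!: add_nonneg_nonneg mult_nonneg_nonneg)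
    have ec0: "continuous_on {0..t} (err \<Lambda> k)" for k
      unfolding err_def[abs_def] by (intro continuous_intros wshell_cont t) auto
    have "integral {0..t} (err \<Lambda> k) = \<beta> k" for k
    proof -
      have "((\<lambda>\<tau>. 4 * C * M * (K + M + 1) * (wshell (Suc k) \<tau> + wshell (Suc (Suc k)) \<tau>)
          + (4 * C * M * expo k + 2 * \<Lambda> * tail_bound k)) has_integral
          4 * C * M * (K + M + 1) *
            (integral {0..t} (wshell (Suc k)) + integral {0..t} (wshell (Suc (Suc k))))
          + measure lborel {0..t} *\<^sub>R (4 * C * M * expo k + 2 * \<Lambda> * tail_bound k)) {0..t}"
        by (intro has_integral_add has_integral_mult_right has_integral_const_real integrable_integral w)
      then show ?thesis
        using u by (intro integral_unique) (simp add: \<beta>_def err_def[abs_def] add.assoc mult.commute)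
    qed
    moreover have "\<eta> k \<le> integral {0..t} (err \<Lambda> k)" for k
      unfolding \<eta>_def using u e0 in_time_dom[OF t]
      by (intro integral_subset_le integrable_continuous_real ec ec0) auto
    moreover have "0 \<le> \<eta> k" for k
      unfolding \<eta>_def by (intro integral_nonneg integrable_continuous_real ec e0 dom)
    ultimately show "\<forall>k. norm (\<eta> k) \<le> \<beta> k" by auto
    have "\<beta> \<longlonglongrightarrow> 4 * C * M * (K + M + 1) * (0 + 0) + (4 * C * M * 0 + 2 * \<Lambda> * 0) * t"
      unfolding \<beta>_def
      by (intro tendsto_intros LIMSEQ_Suc[OF wshell_integral_lim[OF t]] wshell_integral_lim[OF t] expo_lim tail_bound_lim)
    then show "\<beta> \<longlonglongrightarrow> 0" by simp
  qed
  have lim: "(\<lambda>k. ent (Suc k) u - ent (Suc k) t) \<longlonglongrightarrow> V u - V t"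
    using u by (intro tendsto_intros LIMSEQ_Suc ent_lim dom) auto
  \<comment> \<open>\<open>up\<close> is used at k + 1, so that it and \<open>low\<close> enclose
    the same integral.\<close>
  have "(\<lambda>k. integral {u..t} (diss (Suc k))) \<longlonglongrightarrow> V u - V t"
  proof (rule tendsto_sandwich[OF always_eventually always_eventually])
    show "\<forall>k. ent (Suc k) u - ent (Suc k) t - \<eta> k \<le> integral {u..t} (diss (Suc k))"
      using low by blast
    show "\<forall>k. integral {u..t} (diss (Suc k)) \<le> ent (Suc (Suc k)) u - ent (Suc (Suc k)) t + \<eta> (Suc k)"
      using up by blast
    show "(\<lambda>k. ent (Suc k) u - ent (Suc k) t - \<eta> k) \<longlonglongrightarrow> V u - V t"
      using tendsto_diff[OF lim \<eta>] by simp
    show "(\<lambda>k. ent (Suc (Suc k)) u - ent (Suc (Suc k)) t + \<eta> (Suc k)) \<longlonglongrightarrow> V u - V t"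
      using LIMSEQ_Suc[OF tendsto_add[OF lim \<eta>]] by simp
  qed
  then show ?thesis by (rule LIMSEQ_imp_Suc)
qed

lemma nn_integral_diss:
  assumes t: "t \<in> time_dom T" and u: "0 < u" "u \<le> t"
  shows "(\<integral>\<^sup>+\<tau>\<in>{u..t}. ennreal (diss N \<tau>) \<partial>lborel) = ennreal (integral {u..t} (diss N))"
proof -
  have i: "set_integrable lborel {u..t} (diss N)"
    by (rule borel_integrable_atLeastAtMost'[OF diss_cont[OF t u(1)]])
  have nn: "0 \<le> diss N \<tau>" if "\<tau> \<in> {u..t}" for \<tau>
    using that u in_time_dom[OF t] by (intro diss_nonneg) auto
  have "(\<integral>\<^sup>+\<tau>\<in>{u..t}. ennreal (diss N \<tau>) \<partial>lborel)
      = (\<integral>\<^sup>+\<tau>. ennreal (indicator {u..t} \<tau> *\<^sub>R diss N \<tau>) \<partial>lborel)"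
    by (intro nn_integral_cong) (auto split: split_indicator)
  also have "\<dots> = ennreal (LINT \<tau>:{u..t}|lborel. diss N \<tau>)"
    unfolding set_lebesgue_integral_def using i nn
    by (intro nn_integral_eq_integral) (auto simp: set_integrable_def split: split_indicator)
  also have "\<dots> = ennreal (integral {u..t} (diss N))"
    using set_borel_integral_eq_integral(2)[OF i] by simp
  finally show ?thesis .
qed

lemma indicator_diss_measurable:
  assumes t: "t \<in> time_dom T" and u: "0 < u" "u \<le> t"
  shows "(\<lambda>\<tau>. ennreal (diss N \<tau>) * indicator {u..t} \<tau>) \<in> borel_measurable lborel"
proof -
  have "(\<lambda>\<tau>. indicator {u..t} \<tau> *\<^sub>R diss N \<tau>) \<in> borel_measurable lborel"
    using borel_integrable_atLeastAtMost'[OF diss_cont[OF t u(1)]]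
    unfolding set_integrable_def by (rule borel_measurable_integrable)
  then have "(\<lambda>\<tau>. ennreal (indicator {u..t} \<tau> *\<^sub>R diss N \<tau>)) \<in> borel_measurable lborel"
    by measurable
  moreover have "(\<lambda>\<tau>. ennreal (indicator {u..t} \<tau> *\<^sub>R diss N \<tau>)) = (\<lambda>\<tau>. ennreal (diss N \<tau>) * indicator {u..t} \<tau>)"
    by (auto split: split_indicator)
  ultimately show ?thesis by simp
qed

lemma indicator_diss_lim:
  assumes t: "t \<in> time_dom T" and u: "0 < u"
  shows "(\<lambda>N. ennreal (diss N \<tau>) * indicator {u..t} \<tau>) \<longlonglongrightarrow> dis \<tau> * indicator {u..t} \<tau>"
  using u diss_lim[OF in_time_dom[OF t]] by (auto split: split_indicator)

text \<open>Monotone convergence in the cutoff: the summands of the dissipation are nonnegative, so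
  \<open>diss\<close> increases to it.\<close>

lemma entropy_dissipation_pos:
  assumes t: "t \<in> time_dom T" and u: "0 < u" "u \<le> t"
  shows "(\<integral>\<^sup>+\<tau>\<in>{u..t}. dis \<tau> \<partial>lborel) = ennreal (V u - V t)" and "V t \<le> V u"
    and "(\<lambda>\<tau>. dis \<tau> * indicator {u..t} \<tau>) \<in> borel_measurable lborel"
proof -
  note lim = diss_integral_lim[OF t u]
  have "(\<lambda>N. \<integral>\<^sup>+\<tau>. ennreal (diss N \<tau>) * indicator {u..t} \<tau> \<partial>lborel)
      \<longlonglongrightarrow> (\<integral>\<^sup>+\<tau>. dis \<tau> * indicator {u..t} \<tau> \<partial>lborel)"
  proof (rule nn_integral_LIMSEQ)
    show "incseq (\<lambda>N \<tau>. ennreal (diss N \<tau>) * indicator {u..t} \<tau>)"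
      using u in_time_dom[OF t]
      by (auto simp: incseq_def le_fun_def split: split_indicator intro!: ennreal_leI diss_mono)
  qed (intro indicator_diss_measurable[OF t u] indicator_diss_lim[OF t u(1)])+
  then have "(\<lambda>N. ennreal (integral {u..t} (diss N))) \<longlonglongrightarrow> (\<integral>\<^sup>+\<tau>\<in>{u..t}. dis \<tau> \<partial>lborel)"
    by (simp only: nn_integral_diss[OF t u])
  moreover have "(\<lambda>N. ennreal (integral {u..t} (diss N))) \<longlonglongrightarrow> ennreal (V u - V t)"
    by (intro tendsto_ennrealI lim)
  ultimately show "(\<integral>\<^sup>+\<tau>\<in>{u..t}. dis \<tau> \<partial>lborel) = ennreal (V u - V t)"
    by (rule LIMSEQ_unique)
  have "0 \<le> integral {u..t} (diss N)" for N
    using u in_time_dom[OF t]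
    by (intro integral_nonneg integrable_continuous_real diss_cont t) (auto intro: diss_nonneg)
  then have "0 \<le> V u - V t"
    by (intro LIMSEQ_le_const[OF lim]) auto
  then show "V t \<le> V u" by simp
  show "(\<lambda>\<tau>. dis \<tau> * indicator {u..t} \<tau>) \<in> borel_measurable lborel"
    by (rule borel_measurable_LIMSEQ_order[OF indicator_diss_lim[OF t u(1)] indicator_diss_measurable[OF t u]])
qed

text \<open>Monotone convergence along times t / (k + 1) decreasing to 0; the entropy side converges
  by its continuity at 0. The interval is open at 0 because strict positivity is only available at
  positive times.\<close>

lemma entropy_dissipation:
  assumes t: "t \<in> time_dom T" "0 < t"
  shows "(\<integral>\<^sup>+\<tau>\<in>{0<..t}. dis \<tau> \<partial>lborel) = ennreal (V 0 - V t)" and "V t \<le> V 0"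
proof -
  define u where "u = (\<lambda>k. t / real (Suc k))"
  have u: "0 < u k" "u k \<le> t" for k using t by (auto simp: u_def field_simps)
  have "(\<lambda>k. t * inverse (real (Suc k))) \<longlonglongrightarrow> t * 0"
    by (intro tendsto_intros LIMSEQ_inverse_real_of_nat)
  then have ulim: "u \<longlonglongrightarrow> 0" by (simp add: u_def divide_inverse)
  have Vlim: "(\<lambda>k. V (u k)) \<longlonglongrightarrow> V 0"
  proof (rule continuous_on_tendsto_compose[OF entropy_cont[OF t(1)] ulim])
    show "\<forall>\<^sub>F k in sequentially. u k \<in> {0..t}"
      using u by (auto intro!: always_eventually less_imp_le)
  qed (use t in auto)
  have "(\<lambda>k. \<integral>\<^sup>+\<tau>. dis \<tau> * indicator {u k..t} \<tau> \<partial>lborel)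
      \<longlonglongrightarrow> (\<integral>\<^sup>+\<tau>. dis \<tau> * indicator {0<..t} \<tau> \<partial>lborel)"
  proof (rule nn_integral_LIMSEQ)
    have "decseq u"
      using t by (auto simp: decseq_def u_def intro!: divide_left_mono)
    then show "incseq (\<lambda>k \<tau>. dis \<tau> * indicator {u k..t} \<tau>)"
      by (auto simp: incseq_def decseq_def le_fun_def split: split_indicator dest: order_trans)
    show "(\<lambda>k. dis \<tau> * indicator {u k..t} \<tau>) \<longlonglongrightarrow> dis \<tau> * indicator {0<..t} \<tau>" for \<tau>
    proof (cases "0 < \<tau>")
      case True
      then have "\<forall>\<^sub>F k in sequentially. u k < \<tau>"
        by (rule order_tendstoD(2)[OF ulim])
      then have "\<forall>\<^sub>F k in sequentially. dis \<tau> * indicator {u k..t} \<tau> = dis \<tau> * indicator {0<..t} \<tau>"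
        by eventually_elim (use True in \<open>auto split: split_indicator\<close>)
      then show ?thesis by (rule tendsto_eventually)
    next
      case False
      then have "indicator {u k..t} \<tau> = (0::ennreal)" for k
        using u(1)[of k] by (auto split: split_indicator)
      then show ?thesis using False by simp
    qed
  qed (rule entropy_dissipation_pos(3)[OF t(1) u])
  then have "(\<lambda>k. ennreal (V (u k) - V t)) \<longlonglongrightarrow> (\<integral>\<^sup>+\<tau>\<in>{0<..t}. dis \<tau> \<partial>lborel)"
    by (simp only: entropy_dissipation_pos(1)[OF t(1) u])
  moreover have "(\<lambda>k. ennreal (V (u k) - V t)) \<longlonglongrightarrow> ennreal (V 0 - V t)"
    by (intro tendsto_intros tendsto_ennrealI Vlim)
  ultimately show "(\<integral>\<^sup>+\<tau>\<in>{0<..t}. dis \<tau> \<partial>lborel) = ennreal (V 0 - V t)"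
    by (rule LIMSEQ_unique)
  show "V t \<le> V 0"
    using entropy_dissipation_pos(2)[OF t(1) u] by (intro LIMSEQ_le_const[OF Vlim]) auto
qed

lemma entropy_identity:
  assumes t: "t \<in> time_dom T"
  shows "ereal (V t) = ereal (V 0) - enn2ereal (\<integral>\<^sup>+\<tau>\<in>{0<..t}. dis \<tau> \<partial>lborel)"
proof (cases "t = 0")
  case True
  then show ?thesis by (simp add: zero_ennreal.rep_eq)
next
  case False
  then have "0 < t" using t by (simp add: time_dom_def)
  then show ?thesis
    using entropy_dissipation[OF t] by (simp add: enn2ereal_ennreal)
qed

end

section \<open>From the hypotheses to the standing assumptions\<close>

text \<open>The root conditions confine the roots of \<open>Q\<close> between two positive constants
  at large sizes, so the logarithm grows at most linearly; the finitely many smaller sizes are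
  absorbed into the constant.\<close>

lemma ln_Q_linear_bound:
  assumes Qpos: "\<And>r s. (r, s) \<in> Idx \<Longrightarrow> 0 < Q r s"
    and Qinf: "Q_root_liminf Q > 0" and Qsup: "Q_root_limsup Q < \<infinity>"
  obtains K where "0 \<le> K" "\<And>r s. (r, s) \<in> Idx \<Longrightarrow> \<bar>ln (Q r s)\<bar> \<le> K * real (r + s)"
proof -
  define A where "A = (\<lambda>N::nat. {(r, s)\<in>Idx. r + s \<ge> N})"
  define q where "q = (\<lambda>(r, s). ereal (Q r s powr (1 / real (r + s))))"
  have A_mono: "m \<le> n \<Longrightarrow> A n \<subseteq> A m" for m n
    by (auto simp: A_def)
  have "(\<lambda>N. INF p\<in>A N. q p) \<longlonglongrightarrow> (SUP N. INF p\<in>A N. q p)"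
    by (intro LIMSEQ_SUP incseq_def[THEN iffD2] allI impI INF_superset_mono A_mono) auto
  then have "0 < (SUP N. INF p\<in>A N. q p)"
    using Qinf limI unfolding Q_root_liminf_def A_def q_def by (metis (no_types, lifting))
  then obtain N1 where N1: "0 < (INF p\<in>A N1. q p)"
    unfolding less_SUP_iff by blast
  obtain e where e: "0 < ereal e" "ereal e < (INF p\<in>A N1. q p)"
    using ereal_dense2[OF N1] by blast
  have "(\<lambda>N. SUP p\<in>A N. q p) \<longlonglongrightarrow> (INF N. SUP p\<in>A N. q p)"
    by (intro LIMSEQ_INF decseq_def[THEN iffD2] allI impI SUP_subset_mono A_mono) auto
  then have "(INF N. SUP p\<in>A N. q p) < \<infinity>"
    using Qsup limI unfolding Q_root_limsup_def A_def q_def by (metis (no_types, lifting))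
  then obtain N2 where N2: "(SUP p\<in>A N2. q p) < \<infinity>"
    unfolding INF_less_iff by blast
  obtain E where E: "(SUP p\<in>A N2. q p) < ereal E"
    using ereal_dense2[OF N2] by blast
  define N where "N = max N1 N2"
  define S where "S = (\<Sum>(r, s)\<in>Idx_le N. \<bar>ln (Q r s)\<bar>)"
  define K where "K = \<bar>ln e\<bar> + \<bar>ln E\<bar> + S"
  have S: "0 \<le> S" unfolding S_def by (intro sum_nonneg) auto
  have "\<bar>ln (Q r s)\<bar> \<le> K * real (r + s)" if rs: "(r, s) \<in> Idx" for r s
  proof -
    have n: "1 \<le> real (r + s)" using rs by (auto simp: Idx_def)
    show ?thesis
    proof (cases "r + s \<le> N")
      case True
      then have "(r, s) \<in> Idx_le N" using rs by (simp add: Idx_le_def Idx_def)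
      then have "\<bar>ln (Q r s)\<bar> \<le> S"
        unfolding S_def using member_le_sum[of "(r, s)" "Idx_le N" "\<lambda>(r, s). \<bar>ln (Q r s)\<bar>"] by auto
      also have "S \<le> K * 1" by (simp add: K_def)
      also have "\<dots> \<le> K * real (r + s)"
        using n S by (intro mult_left_mono) (auto simp: K_def)
      finally show ?thesis .
    next
      case False
      then have m: "(r, s) \<in> A N1" "(r, s) \<in> A N2" using rs by (auto simp: A_def N_def)
      define y where "y = Q r s powr (1 / real (r + s))"
      have "e < y" "y < E"
        using less_le_trans[OF e(2) INF_lower[OF m(1)]] le_less_trans[OF SUP_upper[OF m(2)] E]
        by (auto simp: q_def y_def)
      with e(1) have "ln e \<le> ln y" "ln y \<le> ln E" by auto
      then have "\<bar>ln y\<bar> \<le> K" using S by (auto simp: K_def)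
      moreover have "ln (Q r s) = ln y * real (r + s)"
        using n Qpos[OF rs] by (simp add: y_def ln_powr)
      ultimately show ?thesis using n by (simp add: abs_mult mult_right_mono)
    qed
  qed
  moreover have "0 \<le> K" using S by (simp add: K_def)
  ultimately show thesis using that by blast
qed

text \<open>Stated for every larger constant, so that the four coefficient families can share
  one.\<close>

lemma bigO_pow_bound:
  assumes "bigO_pow \<alpha> f"
  obtains C where "\<And>C' r s. C \<le> C' \<Longrightarrow> (r, s) \<in> Idx \<Longrightarrow> f r s \<le> C' * real (r + s) powr \<alpha>"
proof -
  obtain C where C: "\<And>r s. (r, s) \<in> Idx \<Longrightarrow> \<bar>f r s\<bar> \<le> C * real (r + s) powr \<alpha>"
    using assms unfolding bigO_pow_def by blast
  have "f r s \<le> C' * real (r + s) powr \<alpha>" if "C \<le> C'" "(r, s) \<in> Idx" for C' r s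
    using C[OF that(2)] mult_right_mono[OF that(1), of "real (r + s) powr \<alpha>"] by auto
  with that show thesis by blast
qed

lemma Xplus_sum_le_normX:
  assumes "c \<in> Xplus" "finite F" "F \<subseteq> Idx"
  shows "(\<Sum>(r, s)\<in>F. real (r + s) * c r s) \<le> normX c"
proof -
  have "\<bar>c r s\<bar> = c r s" if "(r, s) \<in> F" for r s
  proof -
    have "(r, s) \<in> Idx" using assms(3) that by blast
    then show ?thesis using assms(1) by (auto simp: Xplus_def)
  qed
  then have "(\<Sum>(r, s)\<in>F. real (r + s) * c r s) = (\<Sum>(r, s)\<in>F. real (r + s) * \<bar>c r s\<bar>)"
    by (intro sum.cong) auto
  also have "\<dots> \<le> normX c"
    unfolding normX_def using assms by (intro finite_sum_le_infsum) (auto simp: Xplus_def X_def)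
  finally show ?thesis .
qed

lemma net_loss_simps:
  "net_loss a ad b bd c 1 0 = J a b c 1 0 + Jd ad bd c 1 0 + (\<Sum>\<^sub>\<infinity>(r, s)\<in>Idx. J a b c r s)"
  "net_loss a ad b bd c 0 1 = J a b c 0 1 + Jd ad bd c 0 1 + (\<Sum>\<^sub>\<infinity>(r, s)\<in>Idx. Jd ad bd c r s)"
  "2 \<le> r + s \<Longrightarrow> net_loss a ad b bd c r s = diff_r (J a b c) r s + diff_s (Jd ad bd c) r s"
  by (auto simp: net_loss_def diff_r_def diff_s_def Idx_def)

theorem theorem2p17:
  fixes a ad b bd Q :: "nat \<Rightarrow> nat \<Rightarrow> real"
    and c0 :: "nat \<Rightarrow> nat \<Rightarrow> real" and c :: "real \<Rightarrow> nat \<Rightarrow> nat \<Rightarrow> real"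
    and \<alpha> :: real and T :: ereal
  assumes "detailed_balance a ad b bd Q"
    and "0 \<le> \<alpha>" and "\<alpha> < 1"
    and "bigO_pow \<alpha> a" and "bigO_pow \<alpha> ad"
    and "bigO_pow \<alpha> (\<lambda>r s. b (r + 1) s)" and "bigO_pow \<alpha> (\<lambda>r s. bd r (s + 1))"
    and "Q_root_liminf Q > 0" and "Q_root_limsup Q < \<infinity>"
    and "c0 \<in> Xplus"
    and "(\<Sum>\<^sub>\<infinity>(r, s)\<in>Idx. real r * c0 r s) \<noteq> 0"
    and "(\<Sum>\<^sub>\<infinity>(r, s)\<in>Idx. real s * c0 r s) \<noteq> 0"
    and "(\<lambda>(r, s). real (r + s) powr (1 + \<alpha>) * c0 r s) summable_on Idx"
    and "0 < T"
    and "is_solution a ad b bd T c0 c"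
  shows "\<forall>t\<in>time_dom T.
           ereal (entropy Q (c t)) = ereal (entropy Q (c 0))
             - enn2ereal (\<integral>\<^sup>+\<tau>\<in>{0<..t}. dissipation a ad b bd Q (c \<tau>) \<partial>lborel)"
proof -
  have Qpos: "0 < Q r s" if "(r, s) \<in> Idx" for r s
    using that assms(1) unfolding detailed_balance_def by blast
  obtain K where K: "0 \<le> K" "\<And>r s. (r, s) \<in> Idx \<Longrightarrow> \<bar>ln (Q r s)\<bar> \<le> K * real (r + s)"
    using ln_Q_linear_bound[OF Qpos assms(8,9)] by blast
  obtain C1 where C1: "\<And>C' r s. C1 \<le> C' \<Longrightarrow> (r, s) \<in> Idx \<Longrightarrow> a r s \<le> C' * real (r + s) powr \<alpha>"
    using bigO_pow_bound[OF assms(4)] by blast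
  obtain C2 where C2: "\<And>C' r s. C2 \<le> C' \<Longrightarrow> (r, s) \<in> Idx \<Longrightarrow> ad r s \<le> C' * real (r + s) powr \<alpha>"
    using bigO_pow_bound[OF assms(5)] by blast
  obtain C3 where C3: "\<And>C' r s. C3 \<le> C' \<Longrightarrow> (r, s) \<in> Idx \<Longrightarrow> b (r + 1) s \<le> C' * real (r + s) powr \<alpha>"
    using bigO_pow_bound[OF assms(6)] by blast
  obtain C4 where C4: "\<And>C' r s. C4 \<le> C' \<Longrightarrow> (r, s) \<in> Idx \<Longrightarrow> bd r (s + 1) \<le> C' * real (r + s) powr \<alpha>"
    using bigO_pow_bound[OF assms(7)] by blast
  define C where "C = Max {1, C1, C2, C3, C4}"
  have C: "1 \<le> C" "C1 \<le> C" "C2 \<le> C" "C3 \<le> C" "C4 \<le> C" by (auto simp: C_def)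
  note sol = assms(15)[unfolded is_solution_def]
  have Xp: "c t \<in> Xplus" if "t \<in> time_dom T" for t
    using sol that by blast
  obtain M0 where M0: "\<And>t. t \<in> time_dom T \<Longrightarrow> normX (c t) \<le> M0"
    using sol unfolding bdd_above_def by auto
  define M where "M = max 1 M0"
  have eqs: "c t r s = c0 r s - (LINT \<tau>:{0..t}|lborel. net_loss a ad b bd (c \<tau>) r s)"
    if t: "t \<in> time_dom T" and rs: "(r, s) \<in> Idx" for t r s
  proof -
    have e: "c t 1 0 = c0 1 0 - (LINT \<tau>:{0..t}|lborel. net_loss a ad b bd (c \<tau>) 1 0)"
      "c t 0 1 = c0 0 1 - (LINT \<tau>:{0..t}|lborel. net_loss a ad b bd (c \<tau>) 0 1)"
      unfolding net_loss_simps(1,2) using sol t by blast+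
    have e2: "c t r s = c0 r s - (LINT \<tau>:{0..t}|lborel.
        diff_r (J a b (c \<tau>)) r s + diff_s (Jd ad bd (c \<tau>)) r s)" if "2 \<le> r + s"
      using sol t that by blast
    consider "r = 1" "s = 0" | "r = 0" "s = 1" | "2 \<le> r + s"
      using rs unfolding Idx_def by force
    then show ?thesis
      by cases (use e e2 in \<open>simp_all only: net_loss_simps(3)\<close>)
  qed
  have z: "0 \<in> time_dom T" using \<open>0 < T\<close> by (simp add: time_dom_def zero_ereal_def)
  \<comment> \<open>At t = 0 the integral runs over a single point, so \<open>c 0\<close> agrees
    with \<open>c0\<close> on \<open>Idx\<close>; the trajectory locale is phrased with
    \<open>c 0\<close>.\<close>
  have "(LINT \<tau>:{0..0}|lborel. f \<tau>) = 0" for f :: "real \<Rightarrow> real"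
    unfolding set_lebesgue_integral_def
    by (rule integral_eq_zero_AE, rule eventually_mono[OF AE_lborel_singleton[of 0]]) auto
  then have c_0: "c 0 r s = c0 r s" if "(r, s) \<in> Idx" for r s
    using eqs[OF z that] by simp
  interpret bd_trajectory a ad b bd Q c \<alpha> C M K T
  proof
    fix r s assume rs: "(r, s) \<in> Idx"
    show "a r s \<le> C * real (r + s) powr \<alpha>" "ad r s \<le> C * real (r + s) powr \<alpha>"
      "b (r + 1) s \<le> C * real (r + s) powr \<alpha>" "bd r (s + 1) \<le> C * real (r + s) powr \<alpha>"
      by (intro C1[OF C(2) rs] C2[OF C(3) rs] C3[OF C(4) rs] C4[OF C(5) rs])+
    show "continuous_on (time_dom T) (\<lambda>t. c t r s)" using sol rs by blast
    show "0 \<le> c t r s" if "t \<in> time_dom T" for t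
      using Xp[OF that] rs by (auto simp: Xplus_def)
    show "c t r s = c 0 r s - (LINT \<tau>:{0..t}|lborel. net_loss a ad b bd (c \<tau>) r s)"
      if "t \<in> time_dom T" for t
      using eqs[OF that rs] c_0[OF rs] by simp
  next
    fix t and F :: "(nat \<times> nat) set" assume "t \<in> time_dom T" "finite F" "F \<subseteq> Idx"
    then show "(\<Sum>(r, s)\<in>F. real (r + s) * c t r s) \<le> M"
      using Xplus_sum_le_normX[OF Xp] M0 unfolding M_def by (meson max.coboundedI2 order_trans)
  qed (use assms(1-3) C(1) K M_def in auto)
  have nonneg0: "0 \<le> c0 r s" if "(r, s) \<in> Idx" for r s
    using assms(10) that by (auto simp: Xplus_def)
  interpret bd_trajectory_moment a ad b bd Q c \<alpha> C M K T
    "\<Sum>\<^sub>\<infinity>(r, s)\<in>Idx. real (r + s) powr (1 + \<alpha>) * c0 r s"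
  proof
    fix N
    have "moment N 0 = (\<Sum>(r, s)\<in>Idx_le N. real (r + s) powr (1 + \<alpha>) * c0 r s)"
      unfolding moment_def by (intro sum.cong) (auto dest: Idx_le_imp_Idx simp: c_0)
    also have "\<dots> \<le> (\<Sum>\<^sub>\<infinity>(r, s)\<in>Idx. real (r + s) powr (1 + \<alpha>) * c0 r s)"
      using Idx_le_subset nonneg0 by (intro finite_sum_le_infsum assms(13)) auto
    finally show "moment N 0 \<le> (\<Sum>\<^sub>\<infinity>(r, s)\<in>Idx. real (r + s) powr (1 + \<alpha>) * c0 r s)" .
  next
    show "(\<lambda>(r, s). c t r s * (ln (c t r s / Q r s) - 1)) summable_on Idx" if "t \<in> time_dom T" for t
      using Qpos by (intro summable_entropy[OF _ assms(8,9) Xp[OF that]]) auto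
    \<comment> \<open>Otherwise every term of the first component's mass series would vanish, and
      with it the sum.\<close>
    show "\<exists>(r, s)\<in>Idx. 1 \<le> r \<and> c 0 r s \<noteq> 0"
    proof (rule ccontr)
      assume contr: "\<not> ?thesis"
      have "real r * c0 r s = 0" if "(r, s) \<in> Idx" for r s
      proof -
        have "r = 0 \<or> c 0 r s = 0" using contr that by force
        then show ?thesis using c_0[OF that] by auto
      qed
      then have "(\<Sum>\<^sub>\<infinity>(r, s)\<in>Idx. real r * c0 r s) = 0"
        by (intro infsum_0) auto
      with assms(11) show False by simp
    qed
    show "\<exists>(r, s)\<in>Idx. 1 \<le> s \<and> c 0 r s \<noteq> 0"
    proof (rule ccontr)
      assume contr: "\<not> ?thesis"
      have "real s * c0 r s = 0" if "(r, s) \<in> Idx" for r s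
      proof -
        have "s = 0 \<or> c 0 r s = 0" using contr that by force
        then show ?thesis using c_0[OF that] by auto
      qed
      then have "(\<Sum>\<^sub>\<infinity>(r, s)\<in>Idx. real s * c0 r s) = 0"
        by (intro infsum_0) auto
      with assms(12) show False by simp
    qed
  qed
  show ?thesis using entropy_identity by blast
qed

end
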